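(* Let $0<\delta<1$ and let $\phi$ be a twice smooth classifying loss. Suppose $f_\rho^\phi\in Lip^{(r,c_0)}$ for some $r>0$, $c_0>0$, and that $\rho$ satisfies the Tsybakov noise condition with exponent $q\in[0,\infty)$. Let $\lambda=m^{-1}$ and $\sigma=m^{-1/(2r+d)}$. Then for every $0<\nu<\frac{2r(q+1)}{(2r+d)(q+2)}$, with probability at least $1-\delta$, $$\mathcal R(\mathrm{sign}(f_{D,\sigma,\lambda}))-\mathcal R(f_c)\le\hat C\,m^{-\frac{2r(q+1)}{(2r+d)(q+2)}+\nu}\log\frac4\delta,$$ where $\hat C$ is a constant independent of $\delta$ and $m$.
   Context: Setting: $X=[0,1]^d$, $Y=\{-1,1\}$, $\rho$ a Borel probability measure on $Z=X\times Y$ with marginal $\rho_X$; $\eta(x)=\mathbf P[y=1|x]$; sample $D=\{(x_i,y_i)\}_{i=1}^m$ i.i.d. from $\rho$; $\mathcal R(\mathcal C)=\mathbf P[\mathcal C(x)\ne y]$; Bayes rule $f_c(x)=1$ if $\eta(x)\ge1/2$, else $-1$. For a loss $\phi$, $f_\rho^\phi(x)$ is a minimizer over $t\in\mathbf R$ of $\int_Y\phi(yt)d\rho(y|x)$. A classifying loss is a convex $\phi:\mathbf R\to\mathbf R_+$, differentiable at $0$ with $\phi'(0)<0$, whose smallest zero is $1$; a twice smooth classifying loss is additionally differentiable with $|\phi'(u)-\phi'(v)|\le L^*|u-v|$ for all $u,v$ and modulus of convexity $\delta(\epsilon)=\inf\{\frac{\phi(u)+\phi(v)}2-\phi(\frac{u+v}2):|u-v|\ge\epsilon\}\ge\mu\epsilon^2$,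 for some $L^*,\mu>0$. Tsybakov noise condition with exponent $q\in[0,\infty]$: there is $\hat c_q>0$ with $\rho_X(\{x:|2\eta(x)-1|\le\hat c_qt\})\le t^q$ for all $t>0$. $G_\sigma(x,x')=\exp(-\|x-x'\|_2^2/\sigma^2)$ with RKHS $(\mathcal H_\sigma,\|\cdot\|_\sigma)$; $f_{D,\sigma,\lambda}=\arg\min_{f\in\mathcal H_\sigma}\{\frac1m\sum_i\phi(y_if(x_i))+\lambda\|f\|_\sigma^2\}$. $Lip^{(r,c_0)}$ ($r=u+v$, $u\in\mathbf N_0$, $0<v\le1$) is the set of functions on $X$ whose partial derivatives of total order $u$ exist and satisfy $|\partial^\alpha f(x)-\partial^\alpha f(x')|\le c_0\|x-x'\|_2^v$. *)

theory Defs
  imports "HOL-Probability.Probability"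
begin

definition unit_cube :: "(real^'d) set" where
  "unit_cube = {x. \<forall>i. 0 \<le> x$i \<and> x$i \<le> 1}"

definition classifying_loss :: "(real \<Rightarrow> real) \<Rightarrow> bool" where
  "classifying_loss \<phi> \<longleftrightarrow>
     convex_on UNIV \<phi> \<and> (\<forall>u. 0 \<le> \<phi> u) \<and>
     (\<exists>D. (\<phi> has_real_derivative D) (at 0) \<and> D < 0) \<and>
     \<phi> 1 = 0 \<and> (\<forall>u. \<phi> u = 0 \<longrightarrow> 1 \<le> u)"

text \<open>Twice smooth classifying loss: differentiable, Lipschitz derivative with
  constant L, and modulus of convexity bounded below by mu*eps^2 (the inequality
  inf{...} >= mu eps^2 unfolded).\<close>
definition twice_smooth_classifying_loss :: "(real \<Rightarrow> real) \<Rightarrow> bool" where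
  "twice_smooth_classifying_loss \<phi> \<longleftrightarrow>
     classifying_loss \<phi> \<and> (\<forall>u. \<phi> differentiable (at u)) \<and>
     (\<exists>L \<mu>. L > 0 \<and> \<mu> > 0 \<and>
        (\<forall>u v. \<bar>deriv \<phi> u - deriv \<phi> v\<bar> \<le> L * \<bar>u - v\<bar>) \<and>
        (\<forall>\<epsilon>>0. \<forall>u v. \<bar>u - v\<bar> \<ge> \<epsilon> \<longrightarrow>
             (\<phi> u + \<phi> v) / 2 - \<phi> ((u + v) / 2) \<ge> \<mu> * \<epsilon>\<^sup>2))"

text \<open>t minimises the conditional phi-risk at a point with conditional
  probability e = eta(x).\<close>
definition phi_minimizer :: "(real \<Rightarrow> real) \<Rightarrow> real \<Rightarrow> real \<Rightarrow> bool" where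
  "phi_minimizer \<phi> e t \<longleftrightarrow>
     (\<forall>s. e * \<phi> t + (1 - e) * \<phi> (- t) \<le> e * \<phi> s + (1 - e) * \<phi> (- s))"

text \<open>Lip^(r,c0) on X: r = u + v, u natural, 0 < v <= 1; partial derivatives
  Df alpha (alpha a multi-index) of all total orders up to u exist on X
  (one-sided within X at the boundary), and those of order u are v-Hoelder
  with constant c0.\<close>
definition hoelder_class :: "real \<Rightarrow> real \<Rightarrow> (real^'d) set \<Rightarrow> (real^'d \<Rightarrow> real) \<Rightarrow> bool" where
  "hoelder_class r c0 X f \<longleftrightarrow>
    (\<exists>(u::nat) (v::real) (Df :: ('d \<Rightarrow> nat) \<Rightarrow> real^'d \<Rightarrow> real).
       r = real u + v \<and> 0 < v \<and> v \<le> 1 \<and>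
       (\<forall>x\<in>X. Df (\<lambda>_. 0) x = f x) \<and>
       (\<forall>\<alpha> i. sum \<alpha> UNIV < u \<longrightarrow>
          (\<forall>x\<in>X. ((\<lambda>t. Df \<alpha> (x + t *\<^sub>R axis i 1)) has_real_derivative
                      Df (\<alpha>(i := \<alpha> i + 1)) x) (at 0 within {t. x + t *\<^sub>R axis i 1 \<in> X}))) \<and>
       (\<forall>\<alpha>. sum \<alpha> UNIV = u \<longrightarrow>
          (\<forall>x\<in>X. \<forall>x'\<in>X. \<bar>Df \<alpha> x - Df \<alpha> x'\<bar> \<le> c0 * norm (x - x') powr v)))"

text \<open>rho is given by its marginal rho_X and the conditional probability eta:
  rho(A x {1}) = int_A eta d rho_X, rho(A x {-1}) = int_A (1-eta) d rho_X.\<close>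
definition rho_meas :: "(real^'d) measure \<Rightarrow> (real^'d \<Rightarrow> real) \<Rightarrow> ((real^'d) \<times> real) measure" where
  "rho_meas \<rho>X \<eta> = density (\<rho>X \<Otimes>\<^sub>M count_space {-1, 1})
      (\<lambda>z. ennreal (if snd z = 1 then \<eta> (fst z) else 1 - \<eta> (fst z)))"

definition tsybakov :: "(real^'d) measure \<Rightarrow> (real^'d \<Rightarrow> real) \<Rightarrow> real \<Rightarrow> bool" where
  "tsybakov \<rho>X \<eta> q \<longleftrightarrow>
     (\<exists>c>0. \<forall>t>0. measure \<rho>X {x \<in> space \<rho>X. \<bar>2 * \<eta> x - 1\<bar> \<le> c * t} \<le> t powr q)"

definition sample_space :: "(real^'d) measure \<Rightarrow> (real^'d \<Rightarrow> real) \<Rightarrow> nat \<Rightarrow>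
     (nat \<Rightarrow> (real^'d) \<times> real) measure" where
  "sample_space \<rho>X \<eta> m = PiM {..<m} (\<lambda>_. rho_meas \<rho>X \<eta>)"

definition risk :: "((real^'d) \<times> real) measure \<Rightarrow> (real^'d \<Rightarrow> real) \<Rightarrow> real" where
  "risk \<rho> C = measure \<rho> {z \<in> space \<rho>. C (fst z) \<noteq> snd z}"

definition bayes_rule :: "(real^'d \<Rightarrow> real) \<Rightarrow> real^'d \<Rightarrow> real" where
  "bayes_rule \<eta> x = (if \<eta> x \<ge> 1/2 then 1 else -1)"

definition sign_fun :: "(real^'d \<Rightarrow> real) \<Rightarrow> real^'d \<Rightarrow> real" where
  "sign_fun f x = (if f x \<ge> 0 then 1 else -1)"

definition gauss_kernel :: "real \<Rightarrow> real^'d \<Rightarrow> real^'d \<Rightarrow> real" where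
  "gauss_kernel \<sigma> x x' = exp (- (norm (x - x'))\<^sup>2 / \<sigma>\<^sup>2)"

text \<open>Squared RKHS norm of f (restricted to X) in the RKHS of kernel K on X,
  via the dual characterisation ||f||^2 = sup (sum c_i f(x_i))^2 / ||sum c_i K_{x_i}||^2;
  it is infinite iff f is not in the RKHS.\<close>
definition rkhs_norm_sq :: "('a \<Rightarrow> 'a \<Rightarrow> real) \<Rightarrow> 'a set \<Rightarrow> ('a \<Rightarrow> real) \<Rightarrow> ereal" where
  "rkhs_norm_sq K X f = Sup ({0} \<union>
     {ereal ((\<Sum>x\<in>S. c x * f x)\<^sup>2 / (\<Sum>x\<in>S. \<Sum>y\<in>S. c x * c y * K x y)) | S c.
        finite S \<and> S \<subseteq> X \<and> (\<Sum>x\<in>S. \<Sum>y\<in>S. c x * c y * K x y) > 0})"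

definition in_rkhs :: "('a \<Rightarrow> 'a \<Rightarrow> real) \<Rightarrow> 'a set \<Rightarrow> ('a \<Rightarrow> real) \<Rightarrow> bool" where
  "in_rkhs K X f \<longleftrightarrow> rkhs_norm_sq K X f < \<infinity>"

definition reg_objective :: "(real \<Rightarrow> real) \<Rightarrow> ('a \<Rightarrow> 'a \<Rightarrow> real) \<Rightarrow> 'a set \<Rightarrow> real \<Rightarrow> nat \<Rightarrow>
     (nat \<Rightarrow> 'a \<times> real) \<Rightarrow> ('a \<Rightarrow> real) \<Rightarrow> real" where
  "reg_objective \<phi> K X lam m D f =
     (1 / real m) * (\<Sum>i<m. \<phi> (snd (D i) * f (fst (D i)))) + lam * real_of_ereal (rkhs_norm_sq K X f)"

definition erm_solution :: "(real \<Rightarrow> real) \<Rightarrow> ('a \<Rightarrow> 'a \<Rightarrow> real) \<Rightarrow> 'a set \<Rightarrow> real \<Rightarrow> nat \<Rightarrow>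
     (nat \<Rightarrow> 'a \<times> real) \<Rightarrow> ('a \<Rightarrow> real) \<Rightarrow> bool" where
  "erm_solution \<phi> K X lam m D f \<longleftrightarrow> in_rkhs K X f \<and>
     (\<forall>g. in_rkhs K X g \<longrightarrow> reg_objective \<phi> K X lam m D f \<le> reg_objective \<phi> K X lam m D g)"

end

theory Submission
  imports Defs
begin

text \<open>
  The loss is strongly convex with Lipschitz derivative, so its excess risk is comparable to the
  squared \<open>L\<^sup>2\<close> distance to the target. This gives the Bernstein condition (variance at most a
  constant times mean), and the noise condition turns a squared distance \<open>A\<close> into an excess
  misclassification risk of order \<open>A\<close> to the power \<open>(q + 1) / (q + 2)\<close>. Truncating the estimator
  to \<open>[-1, 1]\<close> decreases the empirical loss, so only bounded functions enter the concentration
  argument.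

  Estimation. On a cube of side \<open>\<sigma> m\<^bsup>-\<kappa>\<^esup>\<close> a function in the Gaussian RKHS is determined, up to a
  negative power of \<open>m\<close> as large as desired, by its values at a fixed number of interpolation
  nodes. Hence the relevant ball has a net of log-cardinality \<open>\<sigma>\<^bsup>-d\<^esup>\<close> times an arbitrarily small
  power of \<open>m\<close>. As that small power is affordable, an exponential Markov inequality and a union
  bound over one net replace chaining and peeling.

  Approximation. The approximant averages \<open>f (x + j w)\<close>, weighted by finite-difference
  coefficients, over \<open>w = z + h (c - x)\<close> with \<open>z\<close> Gaussian of scale \<open>\<sigma>\<close>, \<open>c\<close> the centre of the
  cube and \<open>h = 2 R \<sigma>\<close>. The drift towards \<open>c\<close> keeps all evaluation points in the cube unless
  \<open>norm z\<close> exceeds \<open>R \<sigma>\<close>, so no smooth extension of the target beyond the cube is needed.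
\<close>

section \<open>Strongly convex losses\<close>

definition clip :: "real \<Rightarrow> real" where
  "clip t = max (- 1) (min 1 t)"

lemma abs_clip_le: "\<bar>clip t\<bar> \<le> 1"
  by (auto simp: clip_def)

lemma clip_nonneg_iff: "0 \<le> clip t \<longleftrightarrow> 0 \<le> t"
  by (auto simp: clip_def)

lemma clip_diff_le: "\<bar>clip s - clip t\<bar> \<le> \<bar>s - t\<bar>"
  by (auto simp: clip_def)

lemma mult_clip: "y \<in> {- 1, 1} \<Longrightarrow> y * clip t = clip (y * t)"
  by (auto simp: clip_def max_def min_def)

lemma continuous_on_clip: "continuous_on S f \<Longrightarrow> continuous_on S (\<lambda>x. clip (f x))"
  unfolding clip_def by (intro continuous_intros)

lemma DERIV_bound_imp_lipschitz:
  fixes f :: "real \<Rightarrow> real"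
  assumes deriv: "\<And>z. (f has_real_derivative f' z) (at z)"
    and bound: "\<And>z. z \<in> closed_segment s t \<Longrightarrow> \<bar>f' z\<bar> \<le> B"
  shows "\<bar>f s - f t\<bar> \<le> B * \<bar>s - t\<bar>"
proof -
  have "norm (f s - f t) \<le> B * norm (s - t)"
  proof (rule field_differentiable_bound)
    show "(f has_field_derivative f' z) (at z within closed_segment s t)" for z
      using deriv has_field_derivative_at_within by blast
  qed (use bound in auto)
  then show ?thesis by simp
qed

lemma phi_minimizer_flip:
  assumes "phi_minimizer \<phi> e t"
  shows "phi_minimizer \<phi> (1 - e) (- t)"
  unfolding phi_minimizer_def
proof
  fix s
  show "(1 - e) * \<phi> (- t) + (1 - (1 - e)) * \<phi> (- (- t))
      \<le> (1 - e) * \<phi> s + (1 - (1 - e)) * \<phi> (- s)"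
    using assms[unfolded phi_minimizer_def, rule_format, of "- s"] by simp
qed

locale smooth_loss =
  fixes \<phi> \<phi>' :: "real \<Rightarrow> real" and L \<mu> :: real
  assumes loss_convex: "convex_on UNIV \<phi>"
    and loss_nonneg: "0 \<le> \<phi> u"
    and loss_one: "\<phi> 1 = 0"
    and loss_deriv: "(\<phi> has_real_derivative \<phi>' u) (at u)"
    and loss_deriv_0_neg: "\<phi>' 0 < 0"
    and L_pos: "0 < L"
    and \<mu>_pos: "0 < \<mu>"
    and loss_deriv_lipschitz: "\<bar>\<phi>' u - \<phi>' v\<bar> \<le> L * \<bar>u - v\<bar>"
    and loss_modulus: "\<mu> * (u - v)\<^sup>2 \<le> (\<phi> u + \<phi> v) / 2 - \<phi> ((u + v) / 2)"

lemma twice_smooth_imp_smooth_loss: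
  assumes "twice_smooth_classifying_loss \<phi>"
  obtains L \<mu> where "smooth_loss \<phi> (deriv \<phi>) L \<mu>"
proof -
  from assms obtain L \<mu> D where convex: "convex_on UNIV \<phi>" and nonneg: "\<forall>u. 0 \<le> \<phi> u"
    and one: "\<phi> 1 = 0" and diff: "\<forall>u. \<phi> differentiable (at u)"
    and D: "(\<phi> has_real_derivative D) (at 0)" "D < 0" and pos: "L > 0" "\<mu> > 0"
    and lipschitz: "\<forall>u v. \<bar>deriv \<phi> u - deriv \<phi> v\<bar> \<le> L * \<bar>u - v\<bar>"
    and modulus: "\<forall>\<epsilon>>0. \<forall>u v. \<bar>u - v\<bar> \<ge> \<epsilon> \<longrightarrow>
      (\<phi> u + \<phi> v) / 2 - \<phi> ((u + v) / 2) \<ge> \<mu> * \<epsilon>\<^sup>2"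
    unfolding twice_smooth_classifying_loss_def classifying_loss_def by blast
  have "smooth_loss \<phi> (deriv \<phi>) L \<mu>"
  proof
    show "(\<phi> has_real_derivative deriv \<phi> u) (at u)" for u
      using diff by (metis DERIV_deriv_iff_real_differentiable)
    show "deriv \<phi> 0 < 0"
      using D DERIV_imp_deriv by metis
    show "\<mu> * (u - v)\<^sup>2 \<le> (\<phi> u + \<phi> v) / 2 - \<phi> ((u + v) / 2)" for u v
      using modulus[rule_format, of "\<bar>u - v\<bar>" u v] by (cases "u = v") auto
  qed (use convex nonneg one pos lipschitz in auto)
  then show ?thesis by (rule that)
qed

context smooth_loss
begin

lemma loss_pos:
  assumes "u \<noteq> 1"
  shows "0 < \<phi> u"
proof -
  have "0 < \<mu> * (u - 1)\<^sup>2"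
    using assms \<mu>_pos by simp
  also have "\<dots> \<le> \<phi> u / 2"
    using loss_modulus[of u 1] loss_nonneg[of "(u + 1) / 2"] loss_one by simp
  finally show ?thesis by simp
qed

lemma loss_strict_antimono:
  assumes "u < v" "v \<le> 1"
  shows "\<phi> v < \<phi> u"
proof -
  define s where "s = (v - u) / (1 - u)"
  have s: "0 < s" "s \<le> 1"
    using assms by (auto simp: s_def field_simps)
  have "v = u + s * (1 - u)"
    using assms by (simp add: s_def)
  then have "v = (1 - s) *\<^sub>R u + s *\<^sub>R 1"
    by (simp add: algebra_simps)
  then have "\<phi> v \<le> (1 - s) * \<phi> u + s * \<phi> 1"
    using convex_onD[OF loss_convex, of s u 1] s by simp
  also have "\<dots> < \<phi> u"
    using s loss_pos[of u] loss_one assms by (simp add: algebra_simps)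
  finally show ?thesis .
qed

lemma loss_clip_le: "\<phi> (clip t) \<le> \<phi> t"
proof -
  consider (below) "t < - 1" | (inside) "\<bar>t\<bar> \<le> 1" | (above) "1 < t" by linarith
  then show ?thesis
  proof cases
    case below
    then show ?thesis
      using loss_strict_antimono[of t "- 1"] by (simp add: clip_def)
  next
    case inside
    then show ?thesis by (simp add: clip_def)
  next
    case above
    then show ?thesis
      using loss_nonneg[of t] loss_one by (simp add: clip_def)
  qed
qed

definition lip_const :: "real \<Rightarrow> real" where
  "lip_const M = L * M - \<phi>' 0"

lemma lip_const_pos: "0 \<le> M \<Longrightarrow> 0 < lip_const M"
  using loss_deriv_0_neg L_pos mult_nonneg_nonneg[of L M] unfolding lip_const_def by linarith

lemma loss_lipschitz:
  assumes "\<bar>u\<bar> \<le> M" "\<bar>v\<bar> \<le> M"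
  shows "\<bar>\<phi> u - \<phi> v\<bar> \<le> lip_const M * \<bar>u - v\<bar>"
  unfolding lip_const_def
proof (rule DERIV_bound_imp_lipschitz[OF loss_deriv])
  fix z assume "z \<in> closed_segment u v"
  then have "\<bar>z\<bar> \<le> M"
    using assms by (auto simp: closed_segment_eq_real_ivl split: if_splits)
  then have "L * \<bar>z\<bar> \<le> L * M"
    using L_pos by simp
  then show "\<bar>\<phi>' z\<bar> \<le> L * M - \<phi>' 0"
    using loss_deriv_lipschitz[of z 0] loss_deriv_0_neg by simp
qed

lemma loss_measurable [measurable]: "\<phi> \<in> borel_measurable borel"
  using loss_deriv DERIV_isCont
  by (intro borel_measurable_continuous_onI) (auto simp: continuous_on_eq_continuous_at)

definition cond_risk :: "real \<Rightarrow> real \<Rightarrow> real" where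
  "cond_risk e s = e * \<phi> s + (1 - e) * \<phi> (- s)"

lemma phi_minimizer_cond_risk_le: "phi_minimizer \<phi> e t \<Longrightarrow> cond_risk e t \<le> cond_risk e s"
  by (simp add: phi_minimizer_def cond_risk_def)

lemma phi_minimizer_le_1:
  assumes e: "0 \<le> e" "e \<le> 1" and t: "phi_minimizer \<phi> e t"
  shows "t \<le> 1"
proof (rule ccontr)
  assume "\<not> t \<le> 1"
  then have greater: "0 < \<phi> t" "\<phi> (- 1) < \<phi> (- t)"
    using loss_pos[of t] loss_strict_antimono[of "- t" "- 1"] by auto
  have "cond_risk e 1 < cond_risk e t"
  proof (cases "e = 0")
    case True
    then show ?thesis using greater by (simp add: cond_risk_def)
  next
    case False
    then have "0 < e * \<phi> t" using e greater by simp
    moreover have "(1 - e) * \<phi> (- 1) \<le> (1 - e) * \<phi> (- t)"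
      using e greater by (intro mult_left_mono) auto
    ultimately show ?thesis by (simp add: cond_risk_def loss_one)
  qed
  then show False
    using phi_minimizer_cond_risk_le[OF t, of 1] by simp
qed

lemma phi_minimizer_abs_le_1:
  assumes "0 \<le> e" "e \<le> 1" "phi_minimizer \<phi> e t"
  shows "\<bar>t\<bar> \<le> 1"
  using phi_minimizer_le_1[of e t] phi_minimizer_le_1[of "1 - e" "- t"] phi_minimizer_flip assms
  by (simp add: abs_le_iff)

lemma phi_minimizer_nonneg:
  assumes e: "0 \<le> e" "e \<le> 1" "1 / 2 < e" and t: "phi_minimizer \<phi> e t"
  shows "0 \<le> t"
proof (rule ccontr)
  assume "\<not> 0 \<le> t"
  then have "\<phi> (- t) < \<phi> t"
    using phi_minimizer_abs_le_1[OF e(1,2) t] by (intro loss_strict_antimono) auto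
  then have "0 < (2 * e - 1) * (\<phi> t - \<phi> (- t))"
    using e by simp
  then show False
    using phi_minimizer_cond_risk_le[OF t, of "- t"] by (simp add: cond_risk_def algebra_simps)
qed

lemma phi_minimizer_nonpos:
  assumes "0 \<le> e" "e \<le> 1" "e < 1 / 2" "phi_minimizer \<phi> e t"
  shows "t \<le> 0"
  using phi_minimizer_nonneg[of "1 - e" "- t"] phi_minimizer_flip assms by simp

lemma cond_excess_risk_ge:
  assumes e: "0 \<le> e" "e \<le> 1" and t: "phi_minimizer \<phi> e t"
  shows "2 * \<mu> * (s - t)\<^sup>2 \<le> cond_risk e s - cond_risk e t"
proof -
  have pos: "\<mu> * (s - t)\<^sup>2 \<le> (\<phi> s + \<phi> t) / 2 - \<phi> ((s + t) / 2)"
    by (rule loss_modulus)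
  have neg: "\<mu> * (s - t)\<^sup>2 \<le> (\<phi> (- s) + \<phi> (- t)) / 2 - \<phi> (- ((s + t) / 2))"
    using loss_modulus[of "- s" "- t"] by (simp add: power2_commute minus_divide_left)
  have "\<mu> * (s - t)\<^sup>2 = e * (\<mu> * (s - t)\<^sup>2) + (1 - e) * (\<mu> * (s - t)\<^sup>2)"
    by (simp add: algebra_simps)
  also have "\<dots> \<le> e * ((\<phi> s + \<phi> t) / 2 - \<phi> ((s + t) / 2))
      + (1 - e) * ((\<phi> (- s) + \<phi> (- t)) / 2 - \<phi> (- ((s + t) / 2)))"
    using pos neg e by (intro add_mono mult_left_mono) auto
  also have "\<dots> = (cond_risk e s + cond_risk e t) / 2 - cond_risk e ((s + t) / 2)"
    by (simp add: cond_risk_def field_simps)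
  finally show ?thesis
    using phi_minimizer_cond_risk_le[OF t, of "(s + t) / 2"] by (simp add: field_simps)
qed

lemma cond_risk_deriv:
  "(cond_risk e has_real_derivative (e * \<phi>' s - (1 - e) * \<phi>' (- s))) (at s)"
proof -
  have "((\<lambda>s. \<phi> (- s)) has_real_derivative \<phi>' (- s) * - 1) (at s)"
    by (rule DERIV_chain2[OF loss_deriv]) (auto intro!: derivative_eq_intros)
  then show ?thesis
    unfolding cond_risk_def by (auto intro!: derivative_eq_intros loss_deriv)
qed

lemma phi_minimizer_stationary:
  assumes "phi_minimizer \<phi> e t"
  shows "e * \<phi>' t = (1 - e) * \<phi>' (- t)"
proof -
  have "e * \<phi>' t - (1 - e) * \<phi>' (- t) = 0"
    by (rule DERIV_local_min[OF cond_risk_deriv, where d = 1])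
      (use phi_minimizer_cond_risk_le[OF assms] in auto)
  then show ?thesis by simp
qed

lemma cond_excess_risk_le:
  assumes e: "0 \<le> e" "e \<le> 1" and t: "phi_minimizer \<phi> e t"
  shows "cond_risk e s - cond_risk e t \<le> L * (s - t)\<^sup>2"
proof -
  have "\<bar>cond_risk e s - cond_risk e t\<bar> \<le> (L * \<bar>s - t\<bar>) * \<bar>s - t\<bar>"
  proof (rule DERIV_bound_imp_lipschitz[OF cond_risk_deriv])
    fix z assume "z \<in> closed_segment s t"
    then have z: "\<bar>z - t\<bar> \<le> \<bar>s - t\<bar>"
      by (auto simp: closed_segment_eq_real_ivl split: if_splits)
    have "e * \<phi>' z - (1 - e) * \<phi>' (- z)
        = e * (\<phi>' z - \<phi>' t) - (1 - e) * (\<phi>' (- z) - \<phi>' (- t))"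
      using phi_minimizer_stationary[OF t] by (simp add: algebra_simps)
    also have "\<bar>\<dots>\<bar> \<le> e * \<bar>\<phi>' z - \<phi>' t\<bar> + (1 - e) * \<bar>\<phi>' (- z) - \<phi>' (- t)\<bar>"
      using e by (intro order_trans[OF abs_triangle_ineq4]) (simp add: abs_mult)
    also have "\<dots> \<le> e * (L * \<bar>z - t\<bar>) + (1 - e) * (L * \<bar>z - t\<bar>)"
      using e loss_deriv_lipschitz[of z t] loss_deriv_lipschitz[of "- z" "- t"]
      by (intro add_mono mult_left_mono) (auto simp: abs_minus_commute)
    also have "\<dots> \<le> L * \<bar>s - t\<bar>"
      using z L_pos by (simp add: algebra_simps)
    finally show "\<bar>e * \<phi>' z - (1 - e) * \<phi>' (- z)\<bar> \<le> L * \<bar>s - t\<bar>" .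
  qed
  then show ?thesis by (simp add: power2_eq_square)
qed

definition margin_const :: real where
  "margin_const = 2 * L / (- \<phi>' 0)"

lemma margin_const_pos: "0 < margin_const"
  using L_pos loss_deriv_0_neg by (simp add: margin_const_def divide_pos_neg)

lemma margin_le_phi_minimizer:
  assumes e: "0 \<le> e" "e \<le> 1" and t: "phi_minimizer \<phi> e t"
  shows "\<bar>2 * e - 1\<bar> \<le> margin_const * \<bar>t\<bar>"
proof (cases "2 * L * \<bar>t\<bar> \<le> - \<phi>' 0")
  case True
  have "- \<phi>' 0 \<le> \<bar>\<phi>' t + \<phi>' (- t)\<bar>"
    using loss_deriv_lipschitz[of t 0] loss_deriv_lipschitz[of "- t" 0] True by simp
  then have "\<bar>2 * e - 1\<bar> * (- \<phi>' 0) \<le> \<bar>2 * e - 1\<bar> * \<bar>\<phi>' t + \<phi>' (- t)\<bar>"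
    by (intro mult_left_mono) auto
  also have "\<dots> = \<bar>\<phi>' t - \<phi>' (- t)\<bar>"
  proof -
    have "(2 * e - 1) * (\<phi>' t + \<phi>' (- t)) = - (\<phi>' t - \<phi>' (- t))"
      using phi_minimizer_stationary[OF t] by (simp add: algebra_simps)
    then show ?thesis by (metis abs_minus_cancel abs_mult)
  qed
  also have "\<dots> \<le> 2 * L * \<bar>t\<bar>"
    using loss_deriv_lipschitz[of t "- t"] by simp
  finally show ?thesis
    using loss_deriv_0_neg by (simp add: margin_const_def field_simps)
next
  case False
  then have "1 \<le> margin_const * \<bar>t\<bar>"
    using loss_deriv_0_neg by (simp add: margin_const_def field_simps)
  then show ?thesis using e by (auto simp: abs_if)
qed

lemma margin_le_distance:
  assumes e: "0 \<le> e" "e \<le> 1" and t: "phi_minimizer \<phi> e t"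
    and misclassified: "(0 \<le> s) \<noteq> (1 / 2 \<le> e)"
  shows "\<bar>2 * e - 1\<bar> \<le> margin_const * \<bar>s - t\<bar>"
proof (cases "e = 1 / 2")
  case True
  then have "2 * e - 1 = 0" by simp
  then show ?thesis using margin_const_pos by simp
next
  case False
  then have "\<bar>t\<bar> \<le> \<bar>s - t\<bar>"
    using misclassified phi_minimizer_nonneg[OF e _ t] phi_minimizer_nonpos[OF e _ t] by fastforce
  then have "margin_const * \<bar>t\<bar> \<le> margin_const * \<bar>s - t\<bar>"
    using margin_const_pos by simp
  then show ?thesis using margin_le_phi_minimizer[OF e t] by simp
qed

end

section \<open>Finite differences of Hoelder functions on boxes\<close>

lemma unit_cube_eq_cbox: "unit_cube = cbox 0 (1 :: real^'d)"
  by (auto simp: unit_cube_def mem_box_cart)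

lemma convex_mem_along_line:
  fixes x w :: "'a::real_vector"
  assumes X: "convex X" "x \<in> X" "x + T *\<^sub>R w \<in> X" and s: "s \<in> closed_segment 0 T"
  shows "x + s *\<^sub>R w \<in> X"
proof -
  obtain u where u: "0 \<le> u" "u \<le> 1" "s = u * T"
    using s by (auto simp: in_segment)
  have "(1 - u) *\<^sub>R x + u *\<^sub>R (x + T *\<^sub>R w) \<in> X"
    using X u by (intro convexD_alt) auto
  then show ?thesis
    using u by (simp add: algebra_simps)
qed

definition partials_on ::
    "(real^'d) set \<Rightarrow> (real^'d \<Rightarrow> real) \<Rightarrow> ('d \<Rightarrow> real^'d \<Rightarrow> real) \<Rightarrow> bool" where
  "partials_on X f D \<longleftrightarrow> (\<forall>i. \<forall>x\<in>X.
     ((\<lambda>t. f (x + t *\<^sub>R axis i 1)) has_real_derivative D i x)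
       (at 0 within {t. x + t *\<^sub>R axis i 1 \<in> X}))"

lemma partials_on_cong:
  assumes eq: "\<And>x. x \<in> X \<Longrightarrow> f x = g x" and D: "partials_on X f D"
  shows "partials_on X g D"
  unfolding partials_on_def has_field_derivative_def
proof (intro allI ballI)
  fix i x assume x: "x \<in> X"
  show "((\<lambda>t. g (x + t *\<^sub>R axis i 1)) has_derivative (*) (D i x))
      (at 0 within {t. x + t *\<^sub>R axis i 1 \<in> X})"
  proof (rule has_derivative_transform)
    show "((\<lambda>t. f (x + t *\<^sub>R axis i 1)) has_derivative (*) (D i x))
        (at 0 within {t. x + t *\<^sub>R axis i 1 \<in> X})"
      using D x by (simp add: partials_on_def has_field_derivative_def)
  qed (use x eq in auto)
qed

lemma partials_on_DERIV_axis:
  assumes D: "partials_on X f D" and x: "x + s *\<^sub>R axis i 1 \<in> X"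
  shows "((\<lambda>t. f (x + t *\<^sub>R axis i 1)) has_real_derivative D i (x + s *\<^sub>R axis i 1))
    (at s within {t. x + t *\<^sub>R axis i 1 \<in> X})"
proof -
  let ?S = "{t. (x + s *\<^sub>R axis i 1) + t *\<^sub>R axis i 1 \<in> X}"
  have "((\<lambda>t. f (x + (s + t) *\<^sub>R axis i 1)) has_real_derivative D i (x + s *\<^sub>R axis i 1))
      (at 0 within ?S)"
    using D[unfolded partials_on_def, rule_format, OF x, of i]
    by (simp add: scaleR_add_left add.assoc)
  then have "((\<lambda>t. f (x + t *\<^sub>R axis i 1)) has_real_derivative D i (x + s *\<^sub>R axis i 1))
      (at (s + 0) within (+) s ` ?S)"
    by (rule iffD2[OF DERIV_at_within_shift])
  moreover have "(+) s ` ?S = {t. x + t *\<^sub>R axis i 1 \<in> X}"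
  proof (intro equalityI subsetI)
    fix t assume "t \<in> {t. x + t *\<^sub>R axis i 1 \<in> X}"
    then show "t \<in> (+) s ` ?S"
      by (intro image_eqI[of _ _ "t - s"]) (auto simp: algebra_simps)
  qed (auto simp: algebra_simps)
  ultimately show ?thesis by simp
qed

lemma partials_on_axis_increment_bound:
  fixes f :: "real^'d \<Rightarrow> real"
  assumes D: "partials_on X f D" and X: "convex X" "x \<in> X" "x + T *\<^sub>R axis i 1 \<in> X"
    and bound: "\<And>s. s \<in> closed_segment 0 T \<Longrightarrow> \<bar>D i (x + s *\<^sub>R axis i 1) - c\<bar> \<le> \<epsilon>"
  shows "\<bar>f (x + T *\<^sub>R axis i 1) - f x - T * c\<bar> \<le> \<epsilon> * \<bar>T\<bar>"
proof -
  let ?h = "\<lambda>s. f (x + s *\<^sub>R axis i 1) - s * c" and ?S = "closed_segment 0 T"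
  have mem: "x + s *\<^sub>R axis i 1 \<in> X" if "s \<in> ?S" for s
    using convex_mem_along_line[OF X that] .
  have "norm (?h T - ?h 0) \<le> \<epsilon> * norm (T - 0)"
  proof (rule field_differentiable_bound)
    fix s assume s: "s \<in> ?S"
    have "((\<lambda>t. f (x + t *\<^sub>R axis i 1)) has_real_derivative D i (x + s *\<^sub>R axis i 1))
        (at s within ?S)"
      by (rule DERIV_subset[OF partials_on_DERIV_axis[OF D mem[OF s]]]) (use mem in blast)
    then show "(?h has_real_derivative D i (x + s *\<^sub>R axis i 1) - c) (at s within ?S)"
      by (auto intro!: derivative_eq_intros)
    show "norm (D i (x + s *\<^sub>R axis i 1) - c) \<le> \<epsilon>"
      using bound[OF s] by simp
  qed auto
  then show ?thesis by (simp add: algebra_simps)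
qed

definition merge_coords :: "'d set \<Rightarrow> real^'d \<Rightarrow> real^'d \<Rightarrow> real^'d" where
  "merge_coords S y x = (\<chi> i. if i \<in> S then y $ i else x $ i)"

lemma partials_on_increment_bound:
  fixes f :: "real^'d \<Rightarrow> real"
  assumes D: "partials_on (cbox a b) f D" and x: "x \<in> cbox a b" and y: "y \<in> cbox a b"
    and bound: "\<And>i p. p \<in> cbox a b \<Longrightarrow> (\<And>j. \<bar>p $ j - x $ j\<bar> \<le> \<bar>y $ j - x $ j\<bar>)
      \<Longrightarrow> \<bar>D i p - D i x\<bar> \<le> \<epsilon>"
  shows "\<bar>f (merge_coords S y x) - f x - (\<Sum>i\<in>S. (y $ i - x $ i) * D i x)\<bar>
    \<le> \<epsilon> * (\<Sum>i\<in>S. \<bar>y $ i - x $ i\<bar>)"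
  using finite[of S]
proof (induction S rule: finite_induct)
  case empty
  have "merge_coords {} y x = x" by (simp add: merge_coords_def)
  then show ?case by simp
next
  case (insert i S)
  let ?z = "merge_coords S y x" and ?T = "y $ i - x $ i"
  have step: "merge_coords (insert i S) y x = ?z + ?T *\<^sub>R axis i 1"
    using insert.hyps by (auto simp: merge_coords_def vec_eq_iff axis_def)
  have mem: "merge_coords A y x \<in> cbox a b" for A
    using x y by (auto simp: merge_coords_def mem_box_cart)
  have "\<bar>f (?z + ?T *\<^sub>R axis i 1) - f ?z - ?T * D i x\<bar> \<le> \<epsilon> * \<bar>?T\<bar>"
  proof (rule partials_on_axis_increment_bound[OF D convex_box(1)])
    show "?z \<in> cbox a b" "?z + ?T *\<^sub>R axis i 1 \<in> cbox a b"
      using mem by (simp_all flip: step)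
    fix s assume s: "s \<in> closed_segment 0 ?T"
    show "\<bar>D i (?z + s *\<^sub>R axis i 1) - D i x\<bar> \<le> \<epsilon>"
    proof (rule bound)
      show "?z + s *\<^sub>R axis i 1 \<in> cbox a b"
        using convex_mem_along_line[OF convex_box(1) mem _ s] mem by (simp flip: step)
      show "\<bar>(?z + s *\<^sub>R axis i 1) $ j - x $ j\<bar> \<le> \<bar>y $ j - x $ j\<bar>" for j
        using s insert.hyps
        by (auto simp: merge_coords_def axis_def closed_segment_eq_real_ivl split: if_splits)
    qed
  qed
  then show ?case
    using insert unfolding step by (simp add: distrib_left)
qed

lemma has_derivative_from_partials:
  fixes f :: "real^'d \<Rightarrow> real"
  assumes D: "partials_on (cbox a b) f D"
    and cont: "\<And>i. continuous_on (cbox a b) (D i)" and x: "x \<in> cbox a b"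
  shows "(f has_derivative (\<lambda>w. \<Sum>i\<in>UNIV. w $ i * D i x)) (at x within cbox a b)"
  unfolding has_derivative_within_alt
proof (intro conjI allI impI)
  show "bounded_linear (\<lambda>w. \<Sum>i\<in>UNIV. w $ i * D i x)"
    by (intro bounded_linear_sum bounded_linear_compose[OF bounded_linear_mult_left]
        bounded_linear_vec_nth)
  fix e :: real assume "0 < e"
  define \<epsilon> where "\<epsilon> = e / CARD('d)"
  have \<epsilon>: "0 < \<epsilon>" using \<open>0 < e\<close> by (simp add: \<epsilon>_def)
  have "\<exists>\<delta>>0. \<forall>y\<in>cbox a b. dist y x < \<delta> \<longrightarrow> \<bar>D i y - D i x\<bar> \<le> \<epsilon>" for i
    using cont[of i] x \<epsilon> unfolding continuous_on_iff dist_real_def by (meson less_imp_le)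
  then obtain \<delta> where \<delta>: "\<And>i. 0 < \<delta> i"
    "\<And>i y. y \<in> cbox a b \<Longrightarrow> dist y x < \<delta> i \<Longrightarrow> \<bar>D i y - D i x\<bar> \<le> \<epsilon>"
    by metis
  show "\<exists>d>0. \<forall>y\<in>cbox a b. norm (y - x) < d \<longrightarrow>
       norm (f y - f x - (\<Sum>i\<in>UNIV. (y - x) $ i * D i x)) \<le> e * norm (y - x)"
  proof (intro exI[of _ "Min (range \<delta>)"] conjI ballI impI)
    show "0 < Min (range \<delta>)" using \<delta>(1) by simp
    fix y assume y: "y \<in> cbox a b" and yx: "norm (y - x) < Min (range \<delta>)"
    have "\<bar>f (merge_coords UNIV y x) - f x - (\<Sum>i\<in>UNIV. (y $ i - x $ i) * D i x)\<bar>
        \<le> \<epsilon> * (\<Sum>i\<in>UNIV. \<bar>y $ i - x $ i\<bar>)"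
    proof (rule partials_on_increment_bound[OF D x y])
      fix i p assume p: "p \<in> cbox a b" "\<And>j. \<bar>p $ j - x $ j\<bar> \<le> \<bar>y $ j - x $ j\<bar>"
      have "norm (p - x) \<le> norm (y - x)"
        by (rule norm_le_componentwise_cart) (use p in simp)
      also have "\<dots> < \<delta> i" using yx by simp
      finally show "\<bar>D i p - D i x\<bar> \<le> \<epsilon>"
        using \<delta>(2) p(1) by (simp add: dist_norm)
    qed
    then have "\<bar>f y - f x - (\<Sum>i\<in>UNIV. (y - x) $ i * D i x)\<bar> \<le> \<epsilon> * (\<Sum>i\<in>UNIV. \<bar>(y - x) $ i\<bar>)"
      by (simp add: merge_coords_def)
    also have "\<dots> \<le> \<epsilon> * (\<Sum>i\<in>(UNIV::'d set). norm (y - x))"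
      using \<epsilon> by (intro mult_left_mono sum_mono component_le_norm_cart) auto
    finally show "norm (f y - f x - (\<Sum>i\<in>UNIV. (y - x) $ i * D i x)) \<le> e * norm (y - x)"
      by (simp add: \<epsilon>_def)
  qed
qed

lemma has_real_derivative_along_line:
  fixes f :: "real^'d \<Rightarrow> real"
  assumes D: "partials_on (cbox a b) f D" and cont: "\<And>i. continuous_on (cbox a b) (D i)"
    and T: "\<And>t. t \<in> T \<Longrightarrow> x + t *\<^sub>R w \<in> cbox a b" and s: "s \<in> T"
  shows "((\<lambda>t. f (x + t *\<^sub>R w)) has_real_derivative (\<Sum>i\<in>UNIV. w $ i * D i (x + s *\<^sub>R w)))
    (at s within T)"
proof -
  let ?p = "\<lambda>t. x + t *\<^sub>R w"
  have "(f has_derivative (\<lambda>w. \<Sum>i\<in>UNIV. w $ i * D i (?p s))) (at (?p s) within ?p ` T)"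
    using T
    by (intro has_derivative_subset[OF has_derivative_from_partials[OF D cont T[OF s]]]) auto
  moreover have "(?p has_derivative (\<lambda>h. h *\<^sub>R w)) (at s within T)"
    by (auto intro!: derivative_eq_intros)
  ultimately have "((\<lambda>t. f (?p t)) has_derivative (\<lambda>h. \<Sum>i\<in>UNIV. (h *\<^sub>R w) $ i * D i (?p s)))
      (at s within T)"
    by (rule has_derivative_in_compose[rotated])
  moreover have "(\<lambda>h. \<Sum>i\<in>UNIV. (h *\<^sub>R w) $ i * D i (?p s)) = (*) (\<Sum>i\<in>UNIV. w $ i * D i (?p s))"
    by (rule ext) (simp add: sum_distrib_left mult_ac)
  ultimately show ?thesis by (simp add: has_field_derivative_def)
qed

primrec hoelder_smooth ::
    "nat \<Rightarrow> real \<Rightarrow> real \<Rightarrow> (real^'d) set \<Rightarrow> (real^'d \<Rightarrow> real) \<Rightarrow> bool" where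
  "hoelder_smooth 0 v c X f \<longleftrightarrow> (\<forall>x\<in>X. \<forall>y\<in>X. \<bar>f x - f y\<bar> \<le> c * norm (x - y) powr v)"
| "hoelder_smooth (Suc u) v c X f \<longleftrightarrow> (\<exists>D. partials_on X f D \<and> (\<forall>i. hoelder_smooth u v c X (D i)))"

lemma hoelder_smooth_cong:
  assumes eq: "\<And>x. x \<in> X \<Longrightarrow> f x = g x" and f: "hoelder_smooth u v c X f"
  shows "hoelder_smooth u v c X g"
proof (cases u)
  case 0
  then show ?thesis using eq f by simp
next
  case (Suc n)
  then obtain D where D: "partials_on X f D" "\<forall>i. hoelder_smooth n v c X (D i)"
    using f by auto
  from partials_on_cong[OF eq D(1)] show ?thesis using D(2) Suc by auto
qed

lemma hoelder_class_imp_smooth: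
  assumes "hoelder_class r c X (f :: real^'d \<Rightarrow> real)"
  obtains u v where "r = real u + v" "0 < v" "hoelder_smooth u v c X f"
proof -
  from assms obtain u v and Df :: "('d \<Rightarrow> nat) \<Rightarrow> real^'d \<Rightarrow> real"
    where r: "r = real u + v" and v: "0 < v" and f: "\<forall>x\<in>X. Df (\<lambda>_. 0) x = f x"
      and partials: "\<And>\<alpha>. sum \<alpha> UNIV < u \<Longrightarrow> partials_on X (Df \<alpha>) (\<lambda>i. Df (\<alpha>(i := \<alpha> i + 1)))"
      and hoelder: "\<And>\<alpha>. sum \<alpha> UNIV = u \<Longrightarrow>
        \<forall>x\<in>X. \<forall>y\<in>X. \<bar>Df \<alpha> x - Df \<alpha> y\<bar> \<le> c * norm (x - y) powr v"
    unfolding hoelder_class_def partials_on_def by blast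
  have "hoelder_smooth n v c X (Df \<alpha>)" if "sum \<alpha> UNIV + n = u" for n \<alpha>
    using that
  proof (induction n arbitrary: \<alpha>)
    case 0
    then show ?case using hoelder by simp
  next
    case (Suc n)
    have "sum (\<alpha>(i := \<alpha> i + 1)) UNIV = Suc (sum \<alpha> UNIV)" for i
    proof -
      have "sum (\<alpha>(i := \<alpha> i + 1)) UNIV = (\<Sum>j\<in>UNIV. \<alpha> j + (if j = i then 1 else 0))"
        by (rule sum.cong) auto
      then show ?thesis by (simp add: sum.distrib)
    qed
    then have "hoelder_smooth n v c X (Df (\<alpha>(i := \<alpha> i + 1)))" for i
      using Suc by (intro Suc.IH) simp
    then show ?case using partials[of \<alpha>] Suc.prems by auto
  qed
  then have "hoelder_smooth u v c X (Df (\<lambda>_. 0))" by simp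
  then have "hoelder_smooth u v c X f"
    by (rule hoelder_smooth_cong[rotated]) (use f in simp)
  then show ?thesis using that r v by blast
qed

lemma hoelder_smooth_continuous_on:
  assumes "hoelder_smooth u v c (cbox a b) f" "0 < v"
  shows "continuous_on (cbox a b) f"
  using assms
proof (induction u arbitrary: f)
  case 0
  show ?case unfolding continuous_on
  proof
    fix x assume x: "x \<in> cbox a b"
    have "((\<lambda>y. c * norm (y - x) powr v) \<longlongrightarrow> c * norm (x - x) powr v) (at x within cbox a b)"
      using 0 by (intro tendsto_intros tendsto_powr2) auto
    then have "((\<lambda>y. f y - f x) \<longlongrightarrow> 0) (at x within cbox a b)"
      using 0 x by (intro Lim_null_comparison[of "\<lambda>y. f y - f x"]) (auto simp: eventually_at_filter)
    then show "(f \<longlongrightarrow> f x) (at x within cbox a b)" by (simp add: LIM_zero_iff)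
  qed
next
  case (Suc u)
  then obtain D where D: "partials_on (cbox a b) f D" "\<And>i. hoelder_smooth u v c (cbox a b) (D i)"
    by auto
  then show ?case
    using has_derivative_from_partials[OF D(1) Suc.IH] Suc.prems has_derivative_continuous
    unfolding continuous_on_eq_continuous_within by blast
qed

primrec fdiff :: "nat \<Rightarrow> ('a::real_vector \<Rightarrow> real) \<Rightarrow> 'a \<Rightarrow> 'a \<Rightarrow> real" where
  "fdiff 0 f w x = f x"
| "fdiff (Suc n) f w x = fdiff n f w (x + w) - fdiff n f w x"

lemma fdiff_eq_binomial_sum:
  "fdiff n f w x = (\<Sum>j\<le>n. (- 1) ^ (n + j) * real (n choose j) * f (x + real j *\<^sub>R w))"
proof (induction n arbitrary: x)
  case (Suc n)
  let ?g = "\<lambda>j. f (x + real j *\<^sub>R w)"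
  have "fdiff n f w x = (\<Sum>j\<le>Suc n. (- 1) ^ (n + j) * real (n choose j) * ?g j)"
    unfolding Suc.IH by simp
  also have "\<dots> = (- 1) ^ n * ?g 0
      + (\<Sum>j\<le>n. (- 1) ^ (n + Suc j) * real (n choose Suc j) * ?g (Suc j))"
    unfolding sum.atMost_Suc_shift by simp
  finally have unshifted: "fdiff n f w x = (- 1) ^ n * ?g 0
      - (\<Sum>j\<le>n. (- 1) ^ (n + j) * real (n choose Suc j) * ?g (Suc j))"
    by (simp add: sum_negf)
  have shifted: "fdiff n f w (x + w) = (\<Sum>j\<le>n. (- 1) ^ (n + j) * real (n choose j) * ?g (Suc j))"
    unfolding Suc.IH by (simp add: algebra_simps)
  have "fdiff (Suc n) f w x = - ((- 1) ^ n * ?g 0)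
      + (\<Sum>j\<le>n. (- 1) ^ (n + j) * real (Suc n choose Suc j) * ?g (Suc j))"
    unfolding fdiff.simps shifted unshifted by (simp add: distrib_left distrib_right sum.distrib)
  then show ?case
    unfolding sum.atMost_Suc_shift by simp
qed simp

lemma fdiff_sum: "fdiff n (\<lambda>x. \<Sum>i\<in>A. c i * g i x) w x = (\<Sum>i\<in>A. c i * fdiff n (g i) w x)"
  by (induction n arbitrary: x) (auto simp: sum_subtractf right_diff_distrib)

lemma abs_fdiff_le:
  assumes "\<And>x. \<bar>f x\<bar> \<le> M"
  shows "\<bar>fdiff n f w x\<bar> \<le> 2 ^ n * M"
proof (induction n arbitrary: x)
  case 0
  then show ?case using assms by simp
next
  case (Suc n)
  show ?case using Suc[of x] Suc[of "x + w"] by simp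
qed

lemma has_real_derivative_fdiff:
  assumes "\<And>j. j \<le> n \<Longrightarrow>
    ((\<lambda>s. f (x + (s + real j) *\<^sub>R w)) has_real_derivative g (x + (s + real j) *\<^sub>R w))
      (at s within T)"
  shows "((\<lambda>s. fdiff n f w (x + s *\<^sub>R w)) has_real_derivative fdiff n g w (x + s *\<^sub>R w))
    (at s within T)"
proof -
  have shift: "x + s *\<^sub>R w + real j *\<^sub>R w = x + (s + real j) *\<^sub>R w" for s j
    by (simp add: algebra_simps)
  show ?thesis
    unfolding fdiff_eq_binomial_sum shift by (intro DERIV_sum DERIV_cmult assms) auto
qed

lemma abs_fdiff_Suc_le_partials:
  fixes f :: "real^'d \<Rightarrow> real"
  assumes D: "partials_on (cbox a b) f D" and cont: "\<And>i. continuous_on (cbox a b) (D i)"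
    and mem: "\<And>s. 0 \<le> s \<Longrightarrow> s \<le> real (Suc n) \<Longrightarrow> x + s *\<^sub>R w \<in> cbox a b"
    and bound: "\<And>s i. 0 \<le> s \<Longrightarrow> s \<le> 1 \<Longrightarrow> \<bar>fdiff n (D i) w (x + s *\<^sub>R w)\<bar> \<le> B"
  shows "\<bar>fdiff (Suc n) f w x\<bar> \<le> real CARD('d) * (norm w * B)"
proof -
  let ?h = "\<lambda>s. fdiff n f w (x + s *\<^sub>R w)" and ?g = "\<lambda>x. \<Sum>i\<in>UNIV. w $ i * D i x"
  have "norm (?h 1 - ?h 0) \<le> (real CARD('d) * (norm w * B)) * norm (1 - 0 :: real)"
  proof (rule field_differentiable_bound[where S = "{0..1}"])
    fix s :: real assume s: "s \<in> {0..1}"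
    show "(?h has_real_derivative fdiff n ?g w (x + s *\<^sub>R w)) (at s within {0..1})"
    proof (rule has_real_derivative_fdiff)
      fix j assume "j \<le> n"
      then have "(x + real j *\<^sub>R w) + t *\<^sub>R w \<in> cbox a b" if "t \<in> {0..1}" for t
        using that mem[of "t + real j"] by (auto simp: algebra_simps)
      from has_real_derivative_along_line[OF D cont this s]
      show "((\<lambda>s. f (x + (s + real j) *\<^sub>R w)) has_real_derivative ?g (x + (s + real j) *\<^sub>R w))
          (at s within {0..1})"
        by (simp add: algebra_simps)
    qed
    have "\<bar>fdiff n ?g w (x + s *\<^sub>R w)\<bar>
        \<le> (\<Sum>i\<in>(UNIV::'d set). \<bar>w $ i * fdiff n (D i) w (x + s *\<^sub>R w)\<bar>)"
      unfolding fdiff_sum by (rule sum_abs)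
    also have "\<dots> \<le> (\<Sum>i\<in>(UNIV::'d set). norm w * B)"
      unfolding abs_mult using s by (intro sum_mono mult_mono component_le_norm_cart bound) auto
    finally show "norm (fdiff n ?g w (x + s *\<^sub>R w)) \<le> real CARD('d) * (norm w * B)" by simp
  qed auto
  then show ?thesis by simp
qed

lemma hoelder_smooth_fdiff_bound:
  fixes f :: "real^'d \<Rightarrow> real"
  assumes "hoelder_smooth u v c (cbox a b) f" "0 < v"
    and "x \<in> cbox a b" "x + real (Suc u) *\<^sub>R w \<in> cbox a b"
  shows "\<bar>fdiff (Suc u) f w x\<bar> \<le> c * real CARD('d) ^ u * norm w powr (real u + v)"
  using assms
proof (induction u arbitrary: f x)
  case 0
  then have "\<bar>f (x + w) - f x\<bar> \<le> c * norm (x + w - x) powr v"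
    unfolding hoelder_smooth.simps by (metis One_nat_def of_nat_1 scaleR_one)
  then show ?case by simp
next
  case (Suc u)
  then obtain D where D: "partials_on (cbox a b) f D" "\<And>i. hoelder_smooth u v c (cbox a b) (D i)"
    by auto
  have mem: "x + s *\<^sub>R w \<in> cbox a b" if "0 \<le> s" "s \<le> real (Suc (Suc u))" for s
    using convex_mem_along_line[OF convex_box(1) Suc.prems(3,4), of s] that
    by (simp add: closed_segment_eq_real_ivl)
  let ?B = "c * real CARD('d) ^ u * norm w powr (real u + v)"
  have "\<bar>fdiff (Suc u) (D i) w (x + s *\<^sub>R w)\<bar> \<le> ?B" if "0 \<le> s" "s \<le> 1" for s i
  proof (rule Suc.IH[OF D(2) \<open>0 < v\<close>])
    show "x + s *\<^sub>R w \<in> cbox a b" "x + s *\<^sub>R w + real (Suc u) *\<^sub>R w \<in> cbox a b"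
      using mem[of s] mem[of "s + real (Suc u)"] that by (simp_all add: algebra_simps)
  qed
  then have "\<bar>fdiff (Suc (Suc u)) f w x\<bar> \<le> real CARD('d) * (norm w * ?B)"
    using D Suc.prems hoelder_smooth_continuous_on mem by (intro abs_fdiff_Suc_le_partials) blast+
  also have "\<dots> = c * real CARD('d) ^ Suc u * (norm w * norm w powr (real u + v))" by simp
  also have "norm w * norm w powr (real u + v) = norm w powr (real (Suc u) + v)"
    by (subst powr_mult_base) (auto simp: add.assoc)
  finally show ?case .
qed

section \<open>Balls of a reproducing kernel Hilbert space\<close>

definition kernel_form :: "('a \<Rightarrow> 'a \<Rightarrow> real) \<Rightarrow> 'a set \<Rightarrow> ('a \<Rightarrow> real) \<Rightarrow> real" where
  "kernel_form K S c = (\<Sum>x\<in>S. \<Sum>y\<in>S. c x * c y * K x y)"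

definition rkhs_ball :: "('a \<Rightarrow> 'a \<Rightarrow> real) \<Rightarrow> 'a set \<Rightarrow> real \<Rightarrow> ('a \<Rightarrow> real) set" where
  "rkhs_ball K X B = {f. rkhs_norm_sq K X f \<le> ereal (B\<^sup>2)}"

lemma sum_fun_upd_add:
  fixes c g :: "'a \<Rightarrow> 'b::comm_semiring_0"
  assumes "finite S" "z \<in> S"
  shows "(\<Sum>x\<in>S. (c(z := c z + t)) x * g x) = (\<Sum>x\<in>S. c x * g x) + t * g z"
proof -
  have "(\<Sum>x\<in>S. (c(z := c z + t)) x * g x) = (\<Sum>x\<in>S. c x * g x + (if x = z then t * g x else 0))"
    by (rule sum.cong) (auto simp: distrib_right)
  then show ?thesis using assms by (simp add: sum.distrib)
qed

lemma rkhs_ballI: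
  assumes "\<And>S c. finite S \<Longrightarrow> S \<subseteq> X \<Longrightarrow> (\<Sum>x\<in>S. c x * f x)\<^sup>2 \<le> B\<^sup>2 * kernel_form K S c"
  shows "f \<in> rkhs_ball K X B"
  unfolding rkhs_ball_def rkhs_norm_sq_def mem_Collect_eq
proof (rule Sup_least)
  fix y assume "y \<in> {0} \<union> {ereal ((\<Sum>x\<in>S. c x * f x)\<^sup>2 / (\<Sum>x\<in>S. \<Sum>y\<in>S. c x * c y * K x y)) | S c.
        finite S \<and> S \<subseteq> X \<and> (\<Sum>x\<in>S. \<Sum>y\<in>S. c x * c y * K x y) > 0}"
  then show "y \<le> ereal (B\<^sup>2)"
    using assms by (auto simp: divide_le_eq kernel_form_def)
qed

lemma rkhs_ball_mono:
  assumes "f \<in> rkhs_ball K X B" "0 \<le> B" "B \<le> C"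
  shows "f \<in> rkhs_ball K X C"
proof -
  have "ereal (B\<^sup>2) \<le> ereal (C\<^sup>2)" using assms by (simp add: power_mono)
  then show ?thesis using assms(1) unfolding rkhs_ball_def by (auto intro: order_trans)
qed

lemma rkhs_norm_sq_nonneg: "0 \<le> rkhs_norm_sq K X f"
  unfolding rkhs_norm_sq_def by (rule Sup_upper) simp

lemma rkhs_norm_sq_zero: "rkhs_norm_sq K X (\<lambda>_. 0) = 0"
  unfolding rkhs_norm_sq_def by (rule antisym[OF Sup_least Sup_upper]) (auto simp: zero_ereal_def)

lemma zero_in_rkhs_ball: "(\<lambda>_. 0) \<in> rkhs_ball K X B"
  by (simp add: rkhs_ball_def rkhs_norm_sq_zero)

lemma rkhs_ball_iff_real_norm_le:
  "f \<in> rkhs_ball K X B \<longleftrightarrow> in_rkhs K X f \<and> real_of_ereal (rkhs_norm_sq K X f) \<le> B\<^sup>2"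
  using rkhs_norm_sq_nonneg[of K X f] unfolding in_rkhs_def rkhs_ball_def
  by (cases "rkhs_norm_sq K X f") auto

locale positive_kernel =
  fixes K :: "'a \<Rightarrow> 'a \<Rightarrow> real" and X :: "'a set"
  assumes kernel_sym: "K x y = K y x"
    and kernel_form_nonneg: "finite S \<Longrightarrow> 0 \<le> kernel_form K S c"
    and kernel_diag_pos: "x \<in> X \<Longrightarrow> 0 < K x x"
begin

lemma kernel_form_fun_upd:
  assumes S: "finite S" "z \<in> S"
  shows "kernel_form K S (c(z := c z + t))
    = kernel_form K S c + 2 * t * (\<Sum>x\<in>S. c x * K x z) + t\<^sup>2 * K z z"
proof -
  have form: "kernel_form K S d = (\<Sum>x\<in>S. d x * (\<Sum>y\<in>S. d y * K x y))" for d
    by (simp add: kernel_form_def sum_distrib_left ac_simps)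
  have "kernel_form K S (c(z := c z + t)) = (\<Sum>x\<in>S. c x * ((\<Sum>y\<in>S. c y * K x y) + t * K x z))
      + t * ((\<Sum>y\<in>S. c y * K z y) + t * K z z)"
    by (simp only: form sum_fun_upd_add[OF S, of c t])
  also have "(\<Sum>x\<in>S. c x * ((\<Sum>y\<in>S. c y * K x y) + t * K x z))
      = kernel_form K S c + t * (\<Sum>x\<in>S. c x * K x z)"
    unfolding form by (simp add: distrib_left sum.distrib sum_distrib_left ac_simps)
  also have "(\<Sum>y\<in>S. c y * K z y) = (\<Sum>x\<in>S. c x * K x z)"
    by (subst kernel_sym) simp
  also have "kernel_form K S c + t * (\<Sum>x\<in>S. c x * K x z) + t * ((\<Sum>x\<in>S. c x * K x z) + t * K z z)
      = kernel_form K S c + 2 * t * (\<Sum>x\<in>S. c x * K x z) + t\<^sup>2 * K z z"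
    by (simp add: power2_eq_square algebra_simps)
  finally show ?thesis .
qed

lemma kernel_form_eq_0_imp_orthogonal:
  assumes S: "finite S" "z \<in> S" "z \<in> X" and c: "kernel_form K S c = 0"
  shows "(\<Sum>x\<in>S. c x * K x z) = 0"
proof -
  let ?b = "\<Sum>x\<in>S. c x * K x z"
  have "0 \<le> kernel_form K S (c(z := c z + (- ?b / K z z)))"
    by (rule kernel_form_nonneg[OF S(1)])
  also have "\<dots> = - (?b\<^sup>2 / K z z)"
    unfolding kernel_form_fun_upd[OF S(1,2)] c using kernel_diag_pos[OF S(3)]
    by (simp add: power2_eq_square)
  finally show ?thesis
    using kernel_diag_pos[OF S(3)] by (simp add: divide_le_0_iff)
qed

lemma rkhs_ball_dual_of_pos:
  assumes f: "f \<in> rkhs_ball K X B" and S: "finite S" "S \<subseteq> X" and pos: "0 < kernel_form K S c"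
  shows "(\<Sum>x\<in>S. c x * f x)\<^sup>2 \<le> B\<^sup>2 * kernel_form K S c"
proof -
  have "ereal ((\<Sum>x\<in>S. c x * f x)\<^sup>2 / kernel_form K S c) \<le> rkhs_norm_sq K X f"
    unfolding rkhs_norm_sq_def kernel_form_def
    by (rule Sup_upper) (use S pos[unfolded kernel_form_def] in blast)
  also have "\<dots> \<le> ereal (B\<^sup>2)"
    using f by (simp add: rkhs_ball_def)
  finally show ?thesis using pos by (simp add: divide_le_eq)
qed

lemma rkhs_ball_dual_perturbed:
  assumes f: "f \<in> rkhs_ball K X B" and S: "finite S" "S \<subseteq> X" and z: "z \<in> S"
    and c: "kernel_form K S c = 0" and t: "t \<noteq> 0"
  shows "((\<Sum>x\<in>S. c x * f x) + t * f z)\<^sup>2 \<le> B\<^sup>2 * (t\<^sup>2 * K z z)"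
proof -
  have "z \<in> X" using S z by blast
  then have "kernel_form K S (c(z := c z + t)) = t\<^sup>2 * K z z"
    using kernel_form_eq_0_imp_orthogonal[OF S(1) z _ c]
    by (simp add: kernel_form_fun_upd[OF S(1) z] c)
  then show ?thesis
    using rkhs_ball_dual_of_pos[OF f S, of "c(z := c z + t)"] kernel_diag_pos[OF \<open>z \<in> X\<close>] t
    by (simp only: sum_fun_upd_add[OF S(1) z]) simp
qed

lemma rkhs_ball_dual:
  assumes f: "f \<in> rkhs_ball K X B" and S: "finite S" "S \<subseteq> X"
  shows "(\<Sum>x\<in>S. c x * f x)\<^sup>2 \<le> B\<^sup>2 * kernel_form K S c"
proof (cases "S = {} \<or> 0 < kernel_form K S c")
  case True
  then show ?thesis
    using rkhs_ball_dual_of_pos[OF f S] by (auto simp: kernel_form_def)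
next
  case False
  then obtain z where z: "z \<in> S" by blast
  have zero: "kernel_form K S c = 0"
    using False kernel_form_nonneg[OF S(1), of c] by simp
  let ?A = "\<Sum>x\<in>S. c x * f x"
  \<comment> \<open>The form becomes positive when \<open>c\<close> moves by \<open>\<plusminus>t\<close> at \<open>z\<close>; average and let \<open>t\<close> tend to 0.\<close>
  have "?A\<^sup>2 \<le> B\<^sup>2 * (t\<^sup>2 * K z z)" if "0 < t" for t
  proof -
    have "(?A + t * f z)\<^sup>2 \<le> B\<^sup>2 * (t\<^sup>2 * K z z)" "(?A - t * f z)\<^sup>2 \<le> B\<^sup>2 * (t\<^sup>2 * K z z)"
      using rkhs_ball_dual_perturbed[OF f S z zero, of t]
        rkhs_ball_dual_perturbed[OF f S z zero, of "- t"] that by auto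
    then show ?thesis
      using zero_le_power2[of "t * f z"] unfolding power2_sum power2_diff by linarith
  qed
  then have "\<forall>\<^sub>F t in at_right 0. ?A\<^sup>2 \<le> B\<^sup>2 * (t\<^sup>2 * K z z)"
    using eventually_at_right_less by (rule eventually_mono[rotated]) simp
  moreover have "((\<lambda>t. B\<^sup>2 * (t\<^sup>2 * K z z)) \<longlongrightarrow> B\<^sup>2 * (0\<^sup>2 * K z z)) (at_right 0)"
    by (intro tendsto_intros)
  ultimately have "?A\<^sup>2 \<le> B\<^sup>2 * (0\<^sup>2 * K z z)"
    using tendsto_lowerbound trivial_limit_at_right_real by blast
  then show ?thesis by (simp add: zero)
qed

lemma rkhs_ball_iff_abs_le:
  assumes B: "0 \<le> B"
  shows "f \<in> rkhs_ball K X B \<longleftrightarrow>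
    (\<forall>S c. finite S \<longrightarrow> S \<subseteq> X \<longrightarrow> \<bar>\<Sum>x\<in>S. c x * f x\<bar> \<le> B * sqrt (kernel_form K S c))"
proof -
  have "s\<^sup>2 \<le> B\<^sup>2 * Q \<longleftrightarrow> \<bar>s\<bar> \<le> B * sqrt Q" if "0 \<le> Q" for s Q
  proof -
    have "s\<^sup>2 \<le> B\<^sup>2 * Q \<longleftrightarrow> s\<^sup>2 \<le> (B * sqrt Q)\<^sup>2"
      using that by (simp add: power_mult_distrib)
    also have "\<dots> \<longleftrightarrow> \<bar>s\<bar> \<le> B * sqrt Q"
      using that B by (simp flip: abs_le_square_iff)
    finally show ?thesis .
  qed
  then have "(\<Sum>x\<in>S. c x * f x)\<^sup>2 \<le> B\<^sup>2 * kernel_form K S c \<longleftrightarrow>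
      \<bar>\<Sum>x\<in>S. c x * f x\<bar> \<le> B * sqrt (kernel_form K S c)" if "finite S" for S c
    using kernel_form_nonneg[OF that] by blast
  then show ?thesis
    using rkhs_ball_dual rkhs_ballI[of X f B K] by metis
qed

lemma rkhs_ball_lincomb:
  assumes f: "\<And>i. i \<in> I \<Longrightarrow> f i \<in> rkhs_ball K X (B i)" and B: "\<And>i. i \<in> I \<Longrightarrow> 0 \<le> B i"
  shows "(\<lambda>x. \<Sum>i\<in>I. a i * f i x) \<in> rkhs_ball K X (\<Sum>i\<in>I. \<bar>a i\<bar> * B i)"
proof -
  have "\<bar>\<Sum>x\<in>S. c x * (\<Sum>i\<in>I. a i * f i x)\<bar> \<le> (\<Sum>i\<in>I. \<bar>a i\<bar> * B i) * sqrt (kernel_form K S c)"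
    if S: "finite S" "S \<subseteq> X" for S c
  proof -
    have "(\<Sum>x\<in>S. c x * (\<Sum>i\<in>I. a i * f i x)) = (\<Sum>i\<in>I. a i * (\<Sum>x\<in>S. c x * f i x))"
      unfolding sum_distrib_left by (subst sum.swap) (simp add: ac_simps)
    also have "\<bar>\<dots>\<bar> \<le> (\<Sum>i\<in>I. \<bar>a i\<bar> * \<bar>\<Sum>x\<in>S. c x * f i x\<bar>)"
      by (rule order_trans[OF sum_abs]) (simp add: abs_mult)
    also have "\<dots> \<le> (\<Sum>i\<in>I. \<bar>a i\<bar> * (B i * sqrt (kernel_form K S c)))"
      using f B S rkhs_ball_iff_abs_le by (intro sum_mono mult_left_mono) auto
    finally show ?thesis by (simp only: sum_distrib_right mult.assoc)
  qed
  then show ?thesis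
    using B by (subst rkhs_ball_iff_abs_le) (auto intro!: sum_nonneg)
qed

lemma rkhs_ball_diff:
  assumes "f \<in> rkhs_ball K X B" "g \<in> rkhs_ball K X C" "0 \<le> B" "0 \<le> C"
  shows "(\<lambda>x. f x - g x) \<in> rkhs_ball K X (B + C)"
  using rkhs_ball_lincomb[of UNIV "\<lambda>b. if b then f else g" "\<lambda>b. if b then B else C"
      "\<lambda>b. if b then 1 else - 1"] assms
  by (simp add: UNIV_bool add.commute)

lemma rkhs_ball_dual_family:
  assumes f: "f \<in> rkhs_ball K X B" and I: "finite I" "p ` I \<subseteq> X"
  shows "(\<Sum>i\<in>I. c i * f (p i))\<^sup>2 \<le> B\<^sup>2 * (\<Sum>i\<in>I. \<Sum>j\<in>I. c i * c j * K (p i) (p j))"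
proof -
  define d where "d x = (\<Sum>i | i \<in> I \<and> p i = x. c i)" for x
  have group: "(\<Sum>i\<in>I. c i * g (p i)) = (\<Sum>x\<in>p ` I. d x * g x)" for g :: "'a \<Rightarrow> real"
    unfolding sum.image_gen[OF I(1), of _ p] d_def sum_distrib_right by (intro sum.cong) auto
  have "(\<Sum>i\<in>I. \<Sum>j\<in>I. c i * c j * K (p i) (p j)) = (\<Sum>i\<in>I. c i * (\<Sum>j\<in>I. c j * K (p i) (p j)))"
    by (simp add: sum_distrib_left ac_simps)
  also have "\<dots> = kernel_form K (p ` I) d"
    unfolding group group[of "\<lambda>x. \<Sum>y\<in>p ` I. d y * K x y"]
    by (simp add: kernel_form_def sum_distrib_left ac_simps)
  finally show ?thesis
    unfolding group using rkhs_ball_dual[OF f _ I(2), of d] I(1) by simp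
qed

lemma rkhs_ball_abs_le:
  assumes "f \<in> rkhs_ball K X B" "0 \<le> B" "x \<in> X"
  shows "\<bar>f x\<bar> \<le> B * sqrt (K x x)"
  using rkhs_ball_iff_abs_le[OF assms(2), of f] assms(1,3)
  by (auto simp: kernel_form_def dest!: spec[of _ "{x}"] spec[of _ "\<lambda>_. 1"])

lemma rkhs_ball_increment_sq_le:
  assumes f: "f \<in> rkhs_ball K X B" and "x \<in> X" "y \<in> X"
  shows "(f y - f x)\<^sup>2 \<le> B\<^sup>2 * (K x x + K y y - 2 * K x y)"
  using assms
    rkhs_ball_dual_family[OF f, of UNIV "\<lambda>b. if b then y else x" "\<lambda>b. if b then 1 else - 1"]
  by (simp add: UNIV_bool kernel_sym[of y x] algebra_simps)

end

lemma rkhs_ball_continuous_on: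
  fixes K :: "'a::topological_space \<Rightarrow> 'a \<Rightarrow> real"
  assumes K: "positive_kernel K X" and diag: "continuous_on X (\<lambda>x. K x x)"
    and section_cont: "\<And>x. x \<in> X \<Longrightarrow> continuous_on X (K x)" and f: "f \<in> rkhs_ball K X B"
  shows "continuous_on X f"
  unfolding continuous_on
proof
  interpret positive_kernel K X by (rule K)
  fix x assume x: "x \<in> X"
  have "((\<lambda>y. B\<^sup>2 * (K x x + K y y - 2 * K x y)) \<longlongrightarrow> B\<^sup>2 * (K x x + K x x - 2 * K x x))
      (at x within X)"
    using diag section_cont[OF x] x unfolding continuous_on by (intro tendsto_intros) auto
  then have "((\<lambda>y. (f y - f x)\<^sup>2) \<longlongrightarrow> 0) (at x within X)"
    by (intro Lim_null_comparison[of "\<lambda>y. (f y - f x)\<^sup>2"])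
      (auto simp: eventually_at_filter rkhs_ball_increment_sq_le[OF f x])
  then show "(f \<longlongrightarrow> f x) (at x within X)"
    using tendsto_real_sqrt[of "\<lambda>y. (f y - f x)\<^sup>2" 0]
    by (simp add: tendsto_rabs_zero_iff LIM_zero_iff)
qed

section \<open>Gaussian measures and Gaussian smoothing\<close>

lemma nn_integral_lborel_affine:
  fixes t :: "'a::euclidean_space"
  assumes [measurable]: "f \<in> borel_measurable borel" and c: "c \<noteq> 0"
  shows "(\<integral>\<^sup>+x. f x \<partial>lborel) = ennreal (\<bar>c\<bar> ^ DIM('a)) * (\<integral>\<^sup>+x. f (t + c *\<^sub>R x) \<partial>lborel)"
  by (subst lborel_affine[OF c, of t])
    (simp add: nn_integral_density nn_integral_distr nn_integral_cmult)

lemma integral_lborel_affine: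
  fixes t :: "'a::euclidean_space" and f :: "'a \<Rightarrow> real"
  assumes [measurable]: "f \<in> borel_measurable borel" and c: "c \<noteq> 0"
  shows "(\<integral>x. f x \<partial>lborel) = \<bar>c\<bar> ^ DIM('a) * (\<integral>x. f (t + c *\<^sub>R x) \<partial>lborel)"
  by (subst lborel_affine[OF c, of t]) (simp add: integral_density integral_distr)

lemma integrable_lborel_affine:
  fixes t :: "'a::euclidean_space" and f :: "'a \<Rightarrow> real"
  assumes f: "integrable lborel f" and c: "c \<noteq> 0"
  shows "integrable lborel (\<lambda>x. f (t + c *\<^sub>R x))"
proof -
  have [measurable]: "f \<in> borel_measurable borel" using f by auto
  have "ennreal (\<bar>c\<bar> ^ DIM('a)) * (\<integral>\<^sup>+x. norm (f (t + c *\<^sub>R x)) \<partial>lborel) < \<infinity>"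
    using f nn_integral_lborel_affine[OF _ c, of "\<lambda>x. ennreal (norm (f x))" t]
    by (simp add: integrable_iff_bounded)
  then show ?thesis
    using c by (auto simp: integrable_iff_bounded ennreal_mult_less_top ennreal_zero_less_mult_iff)
qed

lemma nn_integral_gaussian_real:
  assumes "0 < a"
  shows "(\<integral>\<^sup>+x. ennreal (exp (- a * (x::real)\<^sup>2)) \<partial>lborel) = ennreal (sqrt (pi / a))"
proof -
  let ?s = "sqrt (1 / (2 * a))"
  have s: "0 < ?s" "?s\<^sup>2 = 1 / (2 * a)" using assms by simp_all
  have "exp (- a * x\<^sup>2) = sqrt (pi / a) * normal_density 0 ?s x" for x
    using assms unfolding normal_density_def s(2) by (simp add: real_sqrt_divide field_simps)
  moreover have "(\<integral>\<^sup>+x. ennreal (normal_density 0 ?s x) \<partial>lborel) = 1"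
    using integrable_normal_density[OF s(1)] s(1) by (subst nn_integral_eq_integral) auto
  ultimately show ?thesis
    using assms s(1) by (simp add: ennreal_mult nn_integral_cmult)
qed

lemma nn_integral_gaussian:
  assumes "0 < a"
  shows "(\<integral>\<^sup>+x. ennreal (exp (- a * (norm (x::'a::euclidean_space))\<^sup>2)) \<partial>lborel)
    = ennreal (sqrt (pi / a) ^ DIM('a))" (is "nn_integral lborel ?g = _")
proof -
  have "exp (- a * (norm x)\<^sup>2) = (\<Prod>b\<in>Basis. exp (- a * (x \<bullet> b)\<^sup>2))" for x :: 'a
  proof -
    have "(norm x)\<^sup>2 = (\<Sum>b\<in>Basis. (x \<bullet> b)\<^sup>2)"
      unfolding power2_norm_eq_inner by (subst euclidean_inner) (simp add: power2_eq_square)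
    then show ?thesis by (simp add: exp_sum[symmetric] sum_distrib_left sum_negf)
  qed
  then have "nn_integral lborel ?g
      = (\<integral>\<^sup>+x. (\<Prod>b\<in>Basis. ennreal (exp (- a * ((x::'a) \<bullet> b)\<^sup>2))) \<partial>lborel)"
    by (simp add: prod_ennreal)
  also have "\<dots> = (\<Prod>b\<in>(Basis::'a set). (\<integral>\<^sup>+x. ennreal (exp (- a * x\<^sup>2)) \<partial>lborel))"
    by (rule nn_integral_lborel_prod) auto
  finally show ?thesis
    using assms unfolding nn_integral_gaussian_real[OF assms] by (simp add: ennreal_power)
qed

definition gauss_density :: "real \<Rightarrow> 'a::euclidean_space \<Rightarrow> real" where
  "gauss_density a z = exp (- a * (norm z)\<^sup>2) / sqrt (pi / a) ^ DIM('a)"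

definition gauss_measure :: "real \<Rightarrow> 'a::euclidean_space measure" where
  "gauss_measure a = density lborel (\<lambda>z. ennreal (gauss_density a z))"

lemma gauss_density_measurable [measurable]: "gauss_density a \<in> borel_measurable borel"
  unfolding gauss_density_def[abs_def] by measurable

lemma gauss_density_nonneg: "0 < a \<Longrightarrow> 0 \<le> gauss_density a z"
  by (simp add: gauss_density_def)

lemma gauss_density_minus_commute: "gauss_density a (x - y) = gauss_density a (y - x)"
  by (simp add: gauss_density_def norm_minus_commute)

lemma sets_gauss_measure [simp, measurable_cong]: "sets (gauss_measure a) = sets borel"
  and space_gauss_measure [simp]: "space (gauss_measure a) = UNIV"
  by (auto simp: gauss_measure_def)

lemma nn_integral_gauss_density:
  assumes "0 < a"
  shows "(\<integral>\<^sup>+z. ennreal (gauss_density a (z::'a::euclidean_space)) \<partial>lborel) = 1"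
proof -
  let ?Z = "sqrt (pi / a) ^ DIM('a)"
  have "(\<integral>\<^sup>+z. ennreal (gauss_density a (z::'a)) \<partial>lborel)
      = (\<integral>\<^sup>+z. ennreal (exp (- a * (norm (z::'a))\<^sup>2)) / ?Z \<partial>lborel)"
    using assms by (simp add: gauss_density_def divide_ennreal)
  also have "\<dots> = ennreal ?Z / ennreal ?Z"
    using nn_integral_gaussian[OF assms, where 'a = 'a] by (simp add: nn_integral_divide)
  finally show ?thesis
    using assms by (simp add: divide_ennreal)
qed

lemma prob_space_gauss_measure: "0 < a \<Longrightarrow> prob_space (gauss_measure a)"
  by (rule prob_spaceI) (simp add: gauss_measure_def emeasure_density nn_integral_gauss_density)

lemma gauss_density_completing_square:
  fixes x y :: "'a::euclidean_space"
  assumes a: "0 < a" and b: "0 < b"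
  shows "gauss_density a (x - y) * gauss_density b y
    = gauss_density (a * b / (a + b)) x * gauss_density (a + b) (y - (a / (a + b)) *\<^sub>R x)"
proof -
  let ?s = "a / (a + b)" and ?c = "a * b / (a + b)"
  have s: "(a + b) * ?s = a" using a b by simp
  have "?c + a * ?s = a * (a + b) / (a + b)"
    by (simp add: distrib_left add_divide_distrib)
  also have "\<dots> = a" using a b by simp
  finally have c: "?c + (a + b) * ?s\<^sup>2 = a"
    using s by (simp only: power2_eq_square mult.assoc[symmetric])
  have norm_sq: "(norm (v - t *\<^sub>R w))\<^sup>2 = (norm v)\<^sup>2 - 2 * t * (v \<bullet> w) + t\<^sup>2 * (norm w)\<^sup>2"
    for v w :: 'a and t
    unfolding power2_norm_eq_inner
    by (simp add: inner_diff_left inner_diff_right inner_commute power2_eq_square algebra_simps)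
  have "(a + b) * (norm (y - ?s *\<^sub>R x))\<^sup>2
      = (a + b) * (norm y)\<^sup>2 - 2 * ((a + b) * ?s) * (y \<bullet> x) + ((a + b) * ?s\<^sup>2) * (norm x)\<^sup>2"
    unfolding norm_sq by (simp only: algebra_simps)
  also have "(a + b) * ?s\<^sup>2 = a - ?c" using c by simp
  finally have exponent: "a * (norm (x - y))\<^sup>2 + b * (norm y)\<^sup>2
      = ?c * (norm x)\<^sup>2 + (a + b) * (norm (y - ?s *\<^sub>R x))\<^sup>2"
    unfolding s by (simp add: norm_sq[of x 1 y, simplified] inner_commute left_diff_distrib
        algebra_simps)
  have "(pi / a) * (pi / b) = (pi / ?c) * (pi / (a + b))"
    unfolding times_divide_times_eq using a b by simp
  then have "sqrt (pi / a) ^ DIM('a) * sqrt (pi / b) ^ DIM('a)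
      = sqrt (pi / ?c) ^ DIM('a) * sqrt (pi / (a + b)) ^ DIM('a)"
    by (simp only: real_sqrt_mult[symmetric] power_mult_distrib[symmetric])
  moreover have "exp (- a * (norm (x - y))\<^sup>2) * exp (- b * (norm y)\<^sup>2)
      = exp (- ?c * (norm x)\<^sup>2) * exp (- (a + b) * (norm (y - ?s *\<^sub>R x))\<^sup>2)"
    using exponent by (simp only: exp_add[symmetric] mult_minus_left minus_add_distrib[symmetric])
  ultimately show ?thesis
    unfolding gauss_density_def times_divide_times_eq by presburger
qed

lemma nn_integral_gauss_density_convolution:
  fixes x :: "'a::euclidean_space"
  assumes a: "0 < a" and b: "0 < b"
  shows "(\<integral>\<^sup>+y. ennreal (gauss_density a (x - y) * gauss_density b y) \<partial>lborel)
    = ennreal (gauss_density (a * b / (a + b)) x)"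
proof -
  let ?s = "(a / (a + b)) *\<^sub>R x" and ?c = "a * b / (a + b)"
  have ab: "0 < a + b" "0 < ?c" using a b by simp_all
  have "(\<integral>\<^sup>+y. ennreal (gauss_density a (x - y) * gauss_density b y) \<partial>lborel)
      = (\<integral>\<^sup>+y. ennreal (gauss_density ?c x) * ennreal (gauss_density (a + b) (y - ?s)) \<partial>lborel)"
    unfolding gauss_density_completing_square[OF a b]
    by (simp only: ennreal_mult gauss_density_nonneg ab)
  also have "\<dots> = ennreal (gauss_density ?c x)
      * (\<integral>\<^sup>+y. ennreal (gauss_density (a + b) (y - ?s)) \<partial>lborel)"
    by (rule nn_integral_cmult) simp
  also have "(\<integral>\<^sup>+y. ennreal (gauss_density (a + b) (y - ?s)) \<partial>lborel) = 1"
    using nn_integral_lborel_affine[of "\<lambda>y. ennreal (gauss_density (a + b) (y - ?s))" 1 ?s]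
    by (simp add: nn_integral_gauss_density[OF ab(1)])
  finally show ?thesis by simp
qed

lemma convolution_density_euclidean:
  fixes f g :: "'a::ordered_euclidean_space \<Rightarrow> ennreal"
  assumes [measurable]: "f \<in> borel_measurable borel" "g \<in> borel_measurable borel"
    and finite: "finite_measure (density lborel f)" "finite_measure (density lborel g)"
  shows "density lborel f \<star> density lborel g = density lborel (\<lambda>x. \<integral>\<^sup>+y. f (x - y) * g y \<partial>lborel)"
proof (rule measure_eqI)
  fix A assume "A \<in> sets (density lborel f \<star> density lborel g)"
  then have A [measurable]: "A \<in> sets borel" by simp
  have "emeasure (density lborel f \<star> density lborel g) A
      = (\<integral>\<^sup>+z. indicator A z \<partial>(density lborel f \<star> density lborel g))"
    using A by simp
  also have "\<dots> = (\<integral>\<^sup>+x. f x * (\<integral>\<^sup>+y. g y * indicator A (x + y) \<partial>lborel) \<partial>lborel)"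
    using finite by (subst nn_integral_convolution) (simp_all add: nn_integral_density)
  also have "\<dots> = (\<integral>\<^sup>+x. \<integral>\<^sup>+y. f x * g y * indicator A (x + y) \<partial>lborel \<partial>lborel)"
    by (simp add: nn_integral_cmult[symmetric] mult.assoc)
  also have "\<dots> = (\<integral>\<^sup>+y. \<integral>\<^sup>+x. f x * g y * indicator A (x + y) \<partial>lborel \<partial>lborel)"
    by (rule lborel_pair.Fubini') simp
  also have "\<dots> = (\<integral>\<^sup>+y. \<integral>\<^sup>+x. f (x - y) * g y * indicator A x \<partial>lborel \<partial>lborel)"
    using nn_integral_lborel_affine[of "\<lambda>x. f x * g y * indicator A (x + y)" 1 "- y" for y]
    by simp
  also have "\<dots> = (\<integral>\<^sup>+x. \<integral>\<^sup>+y. f (x - y) * g y * indicator A x \<partial>lborel \<partial>lborel)"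
    by (rule lborel_pair.Fubini') simp
  finally show "emeasure (density lborel f \<star> density lborel g) A
      = emeasure (density lborel (\<lambda>x. \<integral>\<^sup>+y. f (x - y) * g y \<partial>lborel)) A"
    by (simp add: emeasure_density nn_integral_multc)
qed simp

lemma convolution_gauss_measure:
  assumes "0 < a" "0 < b"
  shows "gauss_measure a \<star> gauss_measure b
    = (gauss_measure (a * b / (a + b)) :: 'a::ordered_euclidean_space measure)"
proof -
  have "gauss_measure a \<star> gauss_measure b = density lborel
      (\<lambda>x::'a. \<integral>\<^sup>+y. ennreal (gauss_density a (x - y)) * ennreal (gauss_density b y) \<partial>lborel)"
    unfolding gauss_measure_def using assms
    by (intro convolution_density_euclidean prob_space.finite_measure)
      (simp_all flip: gauss_measure_def add: prob_space_gauss_measure)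
  then show ?thesis
    using nn_integral_gauss_density_convolution[OF assms, where 'a = 'a]
    by (simp add: gauss_measure_def gauss_density_nonneg assms flip: ennreal_mult)
qed

lemma distr_gauss_measure_scaleR:
  assumes a: "0 < a" and t: "0 < t"
  shows "distr (gauss_measure a) borel (\<lambda>z. t *\<^sub>R z)
      = (gauss_measure (a / t\<^sup>2) :: 'a::euclidean_space measure)"
proof (rule measure_eqI)
  fix A assume "A \<in> sets (distr (gauss_measure a) borel (\<lambda>z::'a. t *\<^sub>R z))"
  then have A [measurable]: "A \<in> sets borel" by simp
  have scale: "t ^ DIM('a) * gauss_density (a / t\<^sup>2) (t *\<^sub>R z) = gauss_density a z" for z :: 'a
    using t by (simp add: gauss_density_def real_sqrt_divide real_sqrt_mult power_mult_distrib
        power_divide field_simps)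
  have "emeasure (distr (gauss_measure a) borel (\<lambda>z. t *\<^sub>R z)) A
      = (\<integral>\<^sup>+z. indicator A z \<partial>distr (gauss_measure a) borel (\<lambda>z. t *\<^sub>R z))"
    using A by simp
  also have "\<dots> = (\<integral>\<^sup>+z. ennreal (gauss_density a z) * indicator A (t *\<^sub>R z) \<partial>lborel)"
    by (subst nn_integral_distr) (auto simp: gauss_measure_def nn_integral_density)
  also have "\<dots> = ennreal (t ^ DIM('a)) *
      (\<integral>\<^sup>+z. ennreal (gauss_density (a / t\<^sup>2) (t *\<^sub>R z)) * indicator A (t *\<^sub>R z) \<partial>lborel)"
    using t a unfolding scale[symmetric]
    by (subst nn_integral_cmult[symmetric])
      (simp_all add: ennreal_mult gauss_density_nonneg mult.assoc)
  also have "\<dots> = (\<integral>\<^sup>+z. ennreal (gauss_density (a / t\<^sup>2) z) * indicator A z \<partial>lborel)"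
    using t
      nn_integral_lborel_affine[of "\<lambda>z. ennreal (gauss_density (a / t\<^sup>2) z) * indicator A z" t 0]
    by simp
  also have "\<dots> = emeasure (gauss_measure (a / t\<^sup>2)) A"
    by (simp add: gauss_measure_def emeasure_density)
  finally show "emeasure (distr (gauss_measure a) borel (\<lambda>z. t *\<^sub>R z)) A
      = emeasure (gauss_measure (a / t\<^sup>2)) A" .
qed simp

lemma gauss_measure_tail:
  assumes a: "0 < a" and R: "0 \<le> R"
  shows "measure (gauss_measure a) {z::'a::euclidean_space. R < norm z}
      \<le> sqrt 2 ^ DIM('a) * exp (- (a * R\<^sup>2 / 2))"
proof -
  let ?E = "{z::'a. R < norm z}" and ?c = "sqrt 2 ^ DIM('a) * exp (- (a * R\<^sup>2 / 2))"
  have half: "gauss_density a z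
      = sqrt 2 ^ DIM('a) * exp (- (a * (norm z)\<^sup>2 / 2)) * gauss_density (a / 2) z" for z :: 'a
  proof -
    have "sqrt (pi / (a / 2)) = sqrt 2 * sqrt (pi / a)"
      by (simp flip: real_sqrt_mult add: field_simps)
    then show ?thesis
      by (simp add: gauss_density_def power_mult_distrib flip: exp_add)
  qed
  have le: "gauss_density a z \<le> ?c * gauss_density (a / 2) z" if "z \<in> ?E" for z
  proof -
    have "R\<^sup>2 \<le> (norm z)\<^sup>2" using that R by (intro power_mono) auto
    then show ?thesis
      unfolding half[of z] using a
      by (intro mult_right_mono mult_left_mono gauss_density_nonneg) auto
  qed
  have "emeasure (gauss_measure a) ?E
      = (\<integral>\<^sup>+z. ennreal (gauss_density a z) * indicator ?E z \<partial>lborel)"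
    unfolding gauss_measure_def by (rule emeasure_density) measurable
  also have "\<dots> \<le> (\<integral>\<^sup>+z. ennreal ?c * ennreal (gauss_density (a / 2) (z::'a)) \<partial>lborel)"
    by (intro nn_integral_mono)
      (use le a in \<open>auto simp: indicator_def gauss_density_nonneg simp flip: ennreal_mult
          intro!: ennreal_leI\<close>)
  also have "\<dots> = ennreal ?c"
    using a by (simp add: nn_integral_cmult nn_integral_gauss_density)
  finally show ?thesis
    unfolding measure_def by (intro enn2real_leI) auto
qed

lemma (in prob_space) abs_expectation_le:
  fixes g :: "'a \<Rightarrow> real"
  assumes "\<And>x. \<bar>g x\<bar> \<le> b"
  shows "\<bar>\<integral>x. g x \<partial>M\<bar> \<le> b"
proof (cases "integrable M g")
  case True
  then have "\<bar>\<integral>x. g x \<partial>M\<bar> \<le> (\<integral>x. \<bar>g x\<bar> \<partial>M)" by (intro integral_abs_bound)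
  also have "\<dots> \<le> b" using True assms by (intro integral_le_const) auto
  finally show ?thesis .
next
  case False
  then show ?thesis
    using assms[of undefined] by (simp add: not_integrable_integral_eq)
qed

lemma
  fixes f g :: "'a \<Rightarrow> real"
  assumes [measurable]: "f \<in> borel_measurable M" "g \<in> borel_measurable M"
    and f: "integrable M (\<lambda>x. (f x)\<^sup>2)" and g: "integrable M (\<lambda>x. (g x)\<^sup>2)"
  shows integrable_mult_square: "integrable M (\<lambda>x. f x * g x)"
    and integral_Cauchy_Schwarz: "(\<integral>x. f x * g x \<partial>M)\<^sup>2 \<le> (\<integral>x. (f x)\<^sup>2 \<partial>M) * (\<integral>x. (g x)\<^sup>2 \<partial>M)"
proof -
  let ?A = "\<integral>x. (f x)\<^sup>2 \<partial>M" and ?B = "\<integral>x. (g x)\<^sup>2 \<partial>M"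
  have "(\<integral>\<^sup>+x. ennreal \<bar>f x\<bar> * ennreal \<bar>g x\<bar> \<partial>M)\<^sup>2
      \<le> (\<integral>\<^sup>+x. (ennreal \<bar>f x\<bar>)\<^sup>2 \<partial>M) * (\<integral>\<^sup>+x. (ennreal \<bar>g x\<bar>)\<^sup>2 \<partial>M)"
    by (rule Cauchy_Schwarz_nn_integral) measurable
  also have "\<dots> = ennreal (?A * ?B)"
    using f g by (simp add: ennreal_power nn_integral_eq_integral ennreal_mult)
  finally have nn: "(\<integral>\<^sup>+x. ennreal \<bar>f x * g x\<bar> \<partial>M)\<^sup>2 \<le> ennreal (?A * ?B)"
    by (simp add: abs_mult ennreal_mult)
  also have "\<dots> < \<infinity>" by simp
  finally show int: "integrable M (\<lambda>x. f x * g x)"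
    by (auto intro!: integrableI_bounded simp: power_less_top_ennreal)
  have "(\<integral>x. \<bar>f x * g x\<bar> \<partial>M)\<^sup>2 \<le> ?A * ?B"
    using nn int by (simp add: nn_integral_eq_integral ennreal_power ennreal_le_iff)
  moreover have "\<bar>\<integral>x. f x * g x \<partial>M\<bar> \<le> (\<integral>x. \<bar>f x * g x\<bar> \<partial>M)" by (rule integral_abs_bound)
  ultimately show "(\<integral>x. f x * g x \<partial>M)\<^sup>2 \<le> ?A * ?B"
    using power_mono[OF _ abs_ge_zero, of "\<integral>x. f x * g x \<partial>M" _ 2] by fastforce
qed

definition gauss_smooth :: "real \<Rightarrow> ('a::euclidean_space \<Rightarrow> real) \<Rightarrow> 'a \<Rightarrow> real" where
  "gauss_smooth a p x = (\<integral>z. p (x + z) \<partial>gauss_measure a)"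

lemma gauss_smooth_eq_integral:
  fixes p :: "'a::euclidean_space \<Rightarrow> real"
  assumes a: "0 < a" and [measurable]: "p \<in> borel_measurable borel"
  shows "gauss_smooth a p x = (\<integral>u. p u * gauss_density a (u - x) \<partial>lborel)"
proof -
  have "(\<integral>u. p u * gauss_density a (u - x) \<partial>lborel) = (\<integral>z. p (x + z) * gauss_density a z \<partial>lborel)"
    using integral_lborel_affine[of "\<lambda>u. p u * gauss_density a (u - x)" 1 x] by simp
  then show ?thesis
    unfolding gauss_smooth_def gauss_measure_def
    using a by (subst integral_density) (auto simp: gauss_density_nonneg mult.commute)
qed

lemma
  fixes x x' :: "'a::euclidean_space"
  assumes a: "0 < a"
  shows integrable_gauss_density_mult:
    "integrable lborel (\<lambda>u. gauss_density a (u - x) * gauss_density a (u - x'))"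
    and integral_gauss_density_mult:
      "(\<integral>u. gauss_density a (u - x) * gauss_density a (u - x') \<partial>lborel)
        = gauss_density (a / 2) (x - x')"
proof -
  let ?h = "\<lambda>u. gauss_density a (u - x) * gauss_density a (u - x')"
  have "gauss_density a (y + x' - x) = gauss_density a ((x - x') - y)" for y
    using gauss_density_minus_commute[of a "x - x'" y] by (simp add: algebra_simps)
  then have "(\<integral>\<^sup>+u. ennreal (?h u) \<partial>lborel)
      = (\<integral>\<^sup>+y. ennreal (gauss_density a ((x - x') - y) * gauss_density a y) \<partial>lborel)"
    using nn_integral_lborel_affine[of "\<lambda>u. ennreal (?h u)" 1 x']
    by (simp add: add.commute mult.commute)
  also have "\<dots> = ennreal (gauss_density (a / 2) (x - x'))"
    using nn_integral_gauss_density_convolution[OF a a] a by (simp flip: mult_2)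
  finally have nn: "(\<integral>\<^sup>+u. ennreal (?h u) \<partial>lborel) = ennreal (gauss_density (a / 2) (x - x'))" .
  show "integrable lborel ?h"
    using a nn by (intro integrableI_nonneg) (auto simp: gauss_density_nonneg)
  then show "(\<integral>u. ?h u \<partial>lborel) = gauss_density (a / 2) (x - x')"
    using nn a by (simp add: nn_integral_eq_integral gauss_density_nonneg)
qed

lemma gauss_kernel_eq_density:
  fixes x x' :: "real^'d"
  assumes "0 < \<sigma>"
  shows "gauss_density (1 / \<sigma>\<^sup>2) (x - x') = gauss_kernel \<sigma> x x' / (\<sigma> * sqrt pi) ^ CARD('d)"
  using assms by (simp add: gauss_density_def gauss_kernel_def real_sqrt_mult mult.commute)

lemma
  fixes S :: "(real^'d) set" and c :: "real^'d \<Rightarrow> real"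
  assumes \<sigma>: "0 < \<sigma>" and S: "finite S"
  defines "T \<equiv> \<lambda>u. \<Sum>x\<in>S. c x * gauss_density (2 / \<sigma>\<^sup>2) (u - x)"
  shows integrable_gauss_feature_sq: "integrable lborel (\<lambda>u. (T u)\<^sup>2)"
    and integral_gauss_feature_sq:
      "(\<integral>u. (T u)\<^sup>2 \<partial>lborel) = kernel_form (gauss_kernel \<sigma>) S c / (\<sigma> * sqrt pi) ^ CARD('d)"
proof -
  let ?\<Phi> = "\<lambda>x u. gauss_density (2 / \<sigma>\<^sup>2) (u - x)"
  have a: "0 < 2 / \<sigma>\<^sup>2" using \<sigma> by simp
  note int = integrable_gauss_density_mult[OF a]
  have sq: "(T u)\<^sup>2 = (\<Sum>x\<in>S. \<Sum>y\<in>S. (c x * c y) * (?\<Phi> x u * ?\<Phi> y u))" for u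
    by (simp add: T_def power2_eq_square sum_product ac_simps)
  show "integrable lborel (\<lambda>u. (T u)\<^sup>2)"
    unfolding sq by (intro Bochner_Integration.integrable_sum integrable_mult_right int)
  have "(\<integral>u. (T u)\<^sup>2 \<partial>lborel) = (\<Sum>x\<in>S. \<integral>u. (\<Sum>y\<in>S. (c x * c y) * (?\<Phi> x u * ?\<Phi> y u)) \<partial>lborel)"
    unfolding sq by (intro Bochner_Integration.integral_sum Bochner_Integration.integrable_sum
        integrable_mult_right int)
  also have "\<dots> = (\<Sum>x\<in>S. \<Sum>y\<in>S. (c x * c y) * (\<integral>u. ?\<Phi> x u * ?\<Phi> y u \<partial>lborel))"
    by (rule sum.cong[OF refl], subst Bochner_Integration.integral_sum) (simp_all add: int)
  finally show "(\<integral>u. (T u)\<^sup>2 \<partial>lborel) = kernel_form (gauss_kernel \<sigma>) S c / (\<sigma> * sqrt pi) ^ CARD('d)"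
    using integral_gauss_density_mult[OF a, where 'a = "real^'d"]
      gauss_kernel_eq_density[OF \<sigma>, where 'd = 'd]
    by (simp add: kernel_form_def sum_divide_distrib)
qed

lemma gauss_kernel_diag [simp]: "gauss_kernel \<sigma> x x = 1"
  by (simp add: gauss_kernel_def)

lemma positive_kernel_gauss:
  assumes "0 < \<sigma>"
  shows "positive_kernel (gauss_kernel \<sigma>) (X :: (real^'d) set)"
proof
  show "gauss_kernel \<sigma> x y = gauss_kernel \<sigma> y x" for x y :: "real^'d"
    by (simp add: gauss_kernel_def norm_minus_commute)
  show "0 \<le> kernel_form (gauss_kernel \<sigma>) S c" if "finite S" for S :: "(real^'d) set" and c
  proof -
    have "0 \<le> kernel_form (gauss_kernel \<sigma>) S c / (\<sigma> * sqrt pi) ^ CARD('d)"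
      unfolding integral_gauss_feature_sq[OF assms that, symmetric] by simp
    moreover have "0 < (\<sigma> * sqrt pi) ^ CARD('d)" using assms by simp
    ultimately show ?thesis by (simp add: le_divide_eq)
  qed
qed simp

lemma gauss_rkhs_ball_continuous_on:
  assumes "0 < \<sigma>" "f \<in> rkhs_ball (gauss_kernel \<sigma>) X B"
  shows "continuous_on X f"
proof (rule rkhs_ball_continuous_on[OF positive_kernel_gauss[OF assms(1)] _ _ assms(2)])
  show "continuous_on X (gauss_kernel \<sigma> x)" for x
    using assms(1) unfolding gauss_kernel_def[abs_def] by (intro continuous_intros) auto
qed simp

lemma gauss_smooth_dual_bound:
  fixes p :: "real^'d \<Rightarrow> real"
  assumes \<sigma>: "0 < \<sigma>" and S: "finite S" and [measurable]: "p \<in> borel_measurable borel"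
    and p: "integrable lborel (\<lambda>u. (p u)\<^sup>2)"
  shows "(\<Sum>x\<in>S. c x * gauss_smooth (2 / \<sigma>\<^sup>2) p x)\<^sup>2
    \<le> (\<integral>u. (p u)\<^sup>2 \<partial>lborel) / (\<sigma> * sqrt pi) ^ CARD('d) * kernel_form (gauss_kernel \<sigma>) S c"
proof -
  let ?\<Phi> = "\<lambda>x u. gauss_density (2 / \<sigma>\<^sup>2) (u - x)"
  let ?T = "\<lambda>u. \<Sum>x\<in>S. c x * ?\<Phi> x u"
  have a: "0 < 2 / \<sigma>\<^sup>2" using \<sigma> by simp
  have int: "integrable lborel (\<lambda>u. p u * ?\<Phi> x u)" for x
    using p integrable_gauss_density_mult[OF a, of x x]
    by (intro integrable_mult_square) (auto simp: power2_eq_square)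
  have "(\<Sum>x\<in>S. c x * gauss_smooth (2 / \<sigma>\<^sup>2) p x) = (\<Sum>x\<in>S. \<integral>u. c x * (p u * ?\<Phi> x u) \<partial>lborel)"
    using a by (simp add: gauss_smooth_eq_integral)
  also have "\<dots> = (\<integral>u. p u * ?T u \<partial>lborel)"
    using int by (subst Bochner_Integration.integral_sum[symmetric])
      (auto simp: sum_distrib_left ac_simps)
  finally have "(\<Sum>x\<in>S. c x * gauss_smooth (2 / \<sigma>\<^sup>2) p x)\<^sup>2 = (\<integral>u. p u * ?T u \<partial>lborel)\<^sup>2"
    by simp
  also have "\<dots> \<le> (\<integral>u. (p u)\<^sup>2 \<partial>lborel) * (\<integral>u. (?T u)\<^sup>2 \<partial>lborel)"
    using integrable_gauss_feature_sq[OF \<sigma> S] p by (intro integral_Cauchy_Schwarz) auto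
  finally show ?thesis
    by (simp add: integral_gauss_feature_sq[OF \<sigma> S])
qed

section \<open>Approximation in the Gaussian RKHS\<close>

lemma gauss_measure_scale_split:
  fixes g :: "'a::ordered_euclidean_space \<Rightarrow> real"
  assumes [measurable]: "g \<in> borel_measurable borel" and g: "\<And>x. \<bar>g x\<bar> \<le> M"
    and a: "0 < a" and t: "0 < t" "t < s"
  shows "(\<integral>z. g (s *\<^sub>R z) \<partial>gauss_measure a)
    = (\<integral>w. \<integral>z. g (w + t *\<^sub>R z) \<partial>gauss_measure a \<partial>gauss_measure (a / (s\<^sup>2 - t\<^sup>2)))"
proof -
  let ?b = "a / (s\<^sup>2 - t\<^sup>2)" and ?c = "a / t\<^sup>2"
  have "t\<^sup>2 < s\<^sup>2" using t by (intro power_strict_mono) auto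
  then have b: "0 < ?b" and c: "0 < ?c" using a t by simp_all
  interpret B: prob_space "gauss_measure ?b :: 'a measure" by (rule prob_space_gauss_measure[OF b])
  interpret C: prob_space "gauss_measure ?c :: 'a measure" by (rule prob_space_gauss_measure[OF c])
  interpret BC: pair_prob_space "gauss_measure ?b :: 'a measure" "gauss_measure ?c :: 'a measure" ..
  have "?b * ?c / (?b + ?c) = a / s\<^sup>2"
  proof -
    have "?b + ?c = a * s\<^sup>2 / ((s\<^sup>2 - t\<^sup>2) * t\<^sup>2)"
      using \<open>t\<^sup>2 < s\<^sup>2\<close> t by (simp add: field_simps)
    then show ?thesis using \<open>t\<^sup>2 < s\<^sup>2\<close> t a by simp
  qed
  then have conv: "gauss_measure ?b \<star> gauss_measure ?c = (gauss_measure (a / s\<^sup>2) :: 'a measure)"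
    using convolution_gauss_measure[OF b c, where 'a = 'a] by simp
  have int: "integrable (gauss_measure ?b \<Otimes>\<^sub>M gauss_measure ?c) (\<lambda>(w, y). g (w + y))"
    by (rule BC.P.integrable_const_bound[of _ M]) (use g in auto)
  have "(\<integral>z. g (s *\<^sub>R z) \<partial>gauss_measure a) = (\<integral>y. g y \<partial>distr (gauss_measure a) borel (\<lambda>z. s *\<^sub>R z))"
    by (subst integral_distr) simp_all
  also have "\<dots> = (\<integral>y. g y \<partial>(gauss_measure ?b \<star> gauss_measure ?c))"
    unfolding conv using a t by (subst distr_gauss_measure_scaleR) simp_all
  also have "\<dots> = (\<integral>w. \<integral>y. g (w + y) \<partial>gauss_measure ?c \<partial>gauss_measure ?b)"
    unfolding convolution_def using BC.integral_fst'[OF int]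
    by (subst integral_distr) (simp_all add: case_prod_unfold)
  also have "\<dots> = (\<integral>w. \<integral>z. g (w + t *\<^sub>R z) \<partial>gauss_measure a \<partial>gauss_measure ?b)"
    unfolding distr_gauss_measure_scaleR[OF a t(1), symmetric] by (subst integral_distr) simp_all
  finally show ?thesis .
qed

definition drift_average ::
    "real \<Rightarrow> real^'d \<Rightarrow> real \<Rightarrow> nat \<Rightarrow> (real^'d \<Rightarrow> real) \<Rightarrow> real^'d \<Rightarrow> real" where
  "drift_average \<sigma> c h j g x =
     (\<integral>z. g (x + real j *\<^sub>R (z + h *\<^sub>R (c - x))) \<partial>gauss_measure (2 / \<sigma>\<^sup>2))"

lemma drift_average_measurable [measurable]:
  assumes "0 < \<sigma>" and [measurable]: "g \<in> borel_measurable borel"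
  shows "drift_average \<sigma> c h j g \<in> borel_measurable borel"
proof -
  interpret prob_space "gauss_measure (2 / \<sigma>\<^sup>2) :: (real^'a) measure"
    using assms(1) by (intro prob_space_gauss_measure) simp
  show ?thesis unfolding drift_average_def[abs_def] by measurable
qed

lemma drift_average_abs_le:
  assumes "0 < \<sigma>" "\<And>x. \<bar>g x\<bar> \<le> M"
  shows "\<bar>drift_average \<sigma> c h j g x\<bar> \<le> M"
  unfolding drift_average_def
  using assms by (intro prob_space.abs_expectation_le prob_space_gauss_measure) auto

lemma drift_average_eq_mixture:
  fixes g :: "real^'d \<Rightarrow> real"
  assumes \<sigma>: "0 < \<sigma>" and g: "g \<in> borel_measurable borel" "\<And>x. \<bar>g x\<bar> \<le> M"
    and jh: "1 \<le> j" "0 < h" "real j * h < 1"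
  defines "t \<equiv> 1 - real j * h"
  shows "drift_average \<sigma> c h j g x = (\<integral>w. gauss_smooth (2 / \<sigma>\<^sup>2)
      (\<lambda>u. g ((real j * h) *\<^sub>R c + w + t *\<^sub>R u)) x \<partial>gauss_measure (2 / \<sigma>\<^sup>2 / ((real j)\<^sup>2 - t\<^sup>2)))"
proof -
  let ?y = "t *\<^sub>R x + (real j * h) *\<^sub>R c"
  have [measurable]: "g \<in> borel_measurable borel" by (rule g)
  have "0 < real j * h" "1 \<le> real j" using jh by simp_all
  then have t: "0 < t" "t < real j" using jh unfolding t_def by linarith+
  have point: "x + real j *\<^sub>R (z + h *\<^sub>R (c - x)) = ?y + real j *\<^sub>R z" for z
    by (simp add: t_def algebra_simps)
  have "drift_average \<sigma> c h j g x = (\<integral>w. \<integral>z. g (?y + (w + t *\<^sub>R z))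
      \<partial>gauss_measure (2 / \<sigma>\<^sup>2) \<partial>gauss_measure (2 / \<sigma>\<^sup>2 / ((real j)\<^sup>2 - t\<^sup>2)))"
    unfolding drift_average_def point using \<sigma> t g(2) by (intro gauss_measure_scale_split) auto
  moreover have "?y + (w + t *\<^sub>R z) = (real j * h) *\<^sub>R c + w + t *\<^sub>R (x + z)" for w z
    by (simp add: algebra_simps)
  ultimately show ?thesis by (simp add: gauss_smooth_def)
qed

lemma (in positive_kernel) rkhs_ball_expectation:
  assumes N: "prob_space N" and q: "\<And>w. q w \<in> rkhs_ball K X B" and B: "0 \<le> B"
    and int: "\<And>x. x \<in> X \<Longrightarrow> integrable N (\<lambda>w. q w x)"
  shows "(\<lambda>x. \<integral>w. q w x \<partial>N) \<in> rkhs_ball K X B"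
proof -
  have "\<bar>\<Sum>x\<in>S. c x * (\<integral>w. q w x \<partial>N)\<bar> \<le> B * sqrt (kernel_form K S c)"
    if S: "finite S" "S \<subseteq> X" for S c
  proof -
    have "(\<Sum>x\<in>S. c x * (\<integral>w. q w x \<partial>N)) = (\<integral>w. (\<Sum>x\<in>S. c x * q w x) \<partial>N)"
      using int S by (subst Bochner_Integration.integral_sum) auto
    also have "\<bar>\<dots>\<bar> \<le> B * sqrt (kernel_form K S c)"
      using q S rkhs_ball_iff_abs_le[OF B] by (intro prob_space.abs_expectation_le[OF N]) blast
    finally show ?thesis .
  qed
  then show ?thesis using rkhs_ball_iff_abs_le[OF B] by blast
qed

lemma gauss_smooth_in_rkhs_ball:
  fixes p :: "real^'d \<Rightarrow> real"
  assumes \<sigma>: "0 < \<sigma>" and p: "p \<in> borel_measurable borel" "integrable lborel (\<lambda>u. (p u)\<^sup>2)"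
    and B: "(\<integral>u. (p u)\<^sup>2 \<partial>lborel) / (\<sigma> * sqrt pi) ^ CARD('d) \<le> B\<^sup>2"
  shows "gauss_smooth (2 / \<sigma>\<^sup>2) p \<in> rkhs_ball (gauss_kernel \<sigma>) X B"
proof (rule rkhs_ballI)
  interpret positive_kernel "gauss_kernel \<sigma>" X by (rule positive_kernel_gauss[OF \<sigma>])
  fix S and c :: "real^'d \<Rightarrow> real" assume S: "finite S" "S \<subseteq> X"
  note gauss_smooth_dual_bound[OF \<sigma> S(1) p, of c]
  also have "(\<integral>u. (p u)\<^sup>2 \<partial>lborel) / (\<sigma> * sqrt pi) ^ CARD('d) * kernel_form (gauss_kernel \<sigma>) S c
      \<le> B\<^sup>2 * kernel_form (gauss_kernel \<sigma>) S c"
    using B kernel_form_nonneg[OF S(1)] by (intro mult_right_mono)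
  finally show "(\<Sum>x\<in>S. c x * gauss_smooth (2 / \<sigma>\<^sup>2) p x)\<^sup>2
      \<le> B\<^sup>2 * kernel_form (gauss_kernel \<sigma>) S c" .
qed

lemma integral_sq_affine_le:
  fixes g :: "real^'d \<Rightarrow> real"
  assumes [measurable]: "g \<in> borel_measurable borel" and \<sigma>: "0 < \<sigma>" and t: "1 / 2 \<le> t"
  shows "(\<integral>u. (g (c + t *\<^sub>R u))\<^sup>2 \<partial>lborel) / (\<sigma> * sqrt pi) ^ CARD('d)
    \<le> (\<integral>u. (g u)\<^sup>2 \<partial>lborel) * (2 / \<sigma>) ^ CARD('d)"
proof -
  have "(\<integral>u. (g u)\<^sup>2 \<partial>lborel) = t ^ CARD('d) * (\<integral>u. (g (c + t *\<^sub>R u))\<^sup>2 \<partial>lborel)"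
    using integral_lborel_affine[of "\<lambda>u. (g u)\<^sup>2" t c] t by simp
  then have "(\<integral>u. (g (c + t *\<^sub>R u))\<^sup>2 \<partial>lborel) / (\<sigma> * sqrt pi) ^ CARD('d)
      = (\<integral>u. (g u)\<^sup>2 \<partial>lborel) * (1 / (t * (\<sigma> * sqrt pi))) ^ CARD('d)"
    using t by (simp add: power_mult_distrib power_one_over divide_simps)
  also have "\<dots> \<le> (\<integral>u. (g u)\<^sup>2 \<partial>lborel) * (2 / \<sigma>) ^ CARD('d)"
  proof (intro mult_left_mono power_mono)
    have "1 \<le> sqrt pi" using pi_gt3 by simp
    then have "\<sigma> * (1 / 2) \<le> (\<sigma> * sqrt pi) * t" using t \<sigma> by (intro mult_mono) auto
    then show "1 / (t * (\<sigma> * sqrt pi)) \<le> 2 / \<sigma>" using t \<sigma> by (simp add: field_simps)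
  qed (use t \<sigma> in auto)
  finally show ?thesis .
qed

lemma drift_average_in_rkhs_ball:
  fixes g :: "real^'d \<Rightarrow> real"
  assumes \<sigma>: "0 < \<sigma>" and g [measurable]: "g \<in> borel_measurable borel" and gM: "\<And>x. \<bar>g x\<bar> \<le> M"
    and g2: "integrable lborel (\<lambda>u. (g u)\<^sup>2)"
    and B: "0 \<le> B" "(\<integral>u. (g u)\<^sup>2 \<partial>lborel) * (2 / \<sigma>) ^ CARD('d) \<le> B\<^sup>2"
    and jh: "1 \<le> j" "0 < h" "real j * h \<le> 1 / 2"
  shows "drift_average \<sigma> c h j g \<in> rkhs_ball (gauss_kernel \<sigma>) X B"
proof -
  interpret positive_kernel "gauss_kernel \<sigma>" X by (rule positive_kernel_gauss[OF \<sigma>])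
  define t where "t = 1 - real j * h"
  define p where "p w u = g ((real j * h) *\<^sub>R c + w + t *\<^sub>R u)" for w u
  let ?a = "2 / \<sigma>\<^sup>2"
  let ?b = "?a / ((real j)\<^sup>2 - t\<^sup>2)"
  have "0 < real j * h" "1 \<le> real j" using jh by simp_all
  then have t: "1 / 2 \<le> t" "t < real j" using jh unfolding t_def by linarith+
  then have "t\<^sup>2 < (real j)\<^sup>2" by (intro power_strict_mono) auto
  then have "0 < ?b" using \<sigma> by simp
  interpret A: prob_space "gauss_measure ?a :: (real^'d) measure"
    using \<sigma> by (intro prob_space_gauss_measure) simp
  interpret B: prob_space "gauss_measure ?b :: (real^'d) measure"
    by (rule prob_space_gauss_measure) fact
  have "gauss_smooth ?a (p w) \<in> rkhs_ball (gauss_kernel \<sigma>) X B" for w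
  proof (rule gauss_smooth_in_rkhs_ball[OF \<sigma>])
    show "p w \<in> borel_measurable borel" unfolding p_def by measurable
    show "integrable lborel (\<lambda>u. (p w u)\<^sup>2)"
      unfolding p_def by (rule integrable_lborel_affine[OF g2]) (use t in auto)
    show "(\<integral>u. (p w u)\<^sup>2 \<partial>lborel) / (\<sigma> * sqrt pi) ^ CARD('d) \<le> B\<^sup>2"
      using integral_sq_affine_le[OF g \<sigma> t(1)] B(2) unfolding p_def by (rule order_trans)
  qed
  moreover have "integrable (gauss_measure ?b) (\<lambda>w. gauss_smooth ?a (p w) x)" for x
  proof (rule B.integrable_const_bound[of _ M])
    show "AE w in gauss_measure ?b. norm (gauss_smooth ?a (p w) x) \<le> M"
      unfolding gauss_smooth_def using gM by (auto intro!: A.abs_expectation_le simp: p_def)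
    show "(\<lambda>w. gauss_smooth ?a (p w) x) \<in> borel_measurable (gauss_measure ?b)"
      unfolding gauss_smooth_def p_def by measurable
  qed
  moreover have "drift_average \<sigma> c h j g = (\<lambda>x. \<integral>w. gauss_smooth ?a (p w) x \<partial>gauss_measure ?b)"
    unfolding p_def t_def using jh by (intro ext drift_average_eq_mixture[OF \<sigma> g gM]) auto
  ultimately show ?thesis
    using rkhs_ball_expectation[OF B.prob_space_axioms _ B(1)] by simp
qed

definition gauss_approximant ::
    "real \<Rightarrow> real^'d \<Rightarrow> real \<Rightarrow> nat \<Rightarrow> (real^'d \<Rightarrow> real) \<Rightarrow> real^'d \<Rightarrow> real" where
  "gauss_approximant \<sigma> c h n g x =
     (\<Sum>j=1..n. (- 1) ^ Suc j * real (n choose j) * drift_average \<sigma> c h j g x)"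

lemma sum_binomial_mult_le:
  assumes "0 \<le> B"
  shows "(\<Sum>j=1..n. \<bar>(- 1) ^ Suc j * real (n choose j)\<bar> * B) \<le> 2 ^ n * B"
proof -
  have "(\<Sum>j=1..n. real (n choose j)) \<le> (\<Sum>j\<le>n. real (n choose j))"
    by (rule sum_mono2) auto
  also have "\<dots> = 2 ^ n"
    by (simp flip: of_nat_sum add: choose_row_sum)
  finally show ?thesis
    using assms unfolding sum_distrib_right[symmetric] by (simp add: abs_mult mult_right_mono)
qed

lemma gauss_approximant_measurable:
  "0 < \<sigma> \<Longrightarrow> g \<in> borel_measurable borel \<Longrightarrow> gauss_approximant \<sigma> c h n g \<in> borel_measurable borel"
  unfolding gauss_approximant_def[abs_def] by measurable

lemma gauss_approximant_abs_le:
  assumes "0 < \<sigma>" "\<And>x. \<bar>g x\<bar> \<le> M"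
  shows "\<bar>gauss_approximant \<sigma> c h n g x\<bar> \<le> 2 ^ n * M"
proof -
  have "\<bar>gauss_approximant \<sigma> c h n g x\<bar> \<le> (\<Sum>j=1..n. \<bar>(- 1) ^ Suc j * real (n choose j)\<bar> * M)"
    unfolding gauss_approximant_def
  proof (rule order_trans[OF sum_abs], rule sum_mono)
    fix j
    show "\<bar>(- 1) ^ Suc j * real (n choose j) * drift_average \<sigma> c h j g x\<bar>
        \<le> \<bar>(- 1) ^ Suc j * real (n choose j)\<bar> * M"
      unfolding abs_mult[of _ "drift_average \<sigma> c h j g x"]
      by (intro mult_left_mono drift_average_abs_le assms) auto
  qed
  also have "\<dots> \<le> 2 ^ n * M"
    using assms(2)[of undefined] by (intro sum_binomial_mult_le) linarith
  finally show ?thesis .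
qed

lemma gauss_approximant_in_rkhs_ball:
  fixes g :: "real^'d \<Rightarrow> real"
  assumes \<sigma>: "0 < \<sigma>" and g: "g \<in> borel_measurable borel" "\<And>x. \<bar>g x\<bar> \<le> M"
      "integrable lborel (\<lambda>u. (g u)\<^sup>2)"
    and B: "0 \<le> B" "(\<integral>u. (g u)\<^sup>2 \<partial>lborel) * (2 / \<sigma>) ^ CARD('d) \<le> B\<^sup>2"
    and h: "0 < h" "real n * h \<le> 1 / 2"
  shows "gauss_approximant \<sigma> c h n g \<in> rkhs_ball (gauss_kernel \<sigma>) X (2 ^ n * B)"
proof -
  interpret positive_kernel "gauss_kernel \<sigma>" X by (rule positive_kernel_gauss[OF \<sigma>])
  have "drift_average \<sigma> c h j g \<in> rkhs_ball (gauss_kernel \<sigma>) X B" if j: "j \<in> {1..n}" for j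
  proof -
    have "real j * h \<le> real n * h" using j h by (intro mult_right_mono) auto
    then have "real j * h \<le> 1 / 2" using h by linarith
    then show ?thesis using j h by (intro drift_average_in_rkhs_ball[OF \<sigma> g B]) auto
  qed
  then have "gauss_approximant \<sigma> c h n g \<in> rkhs_ball (gauss_kernel \<sigma>) X
      (\<Sum>j=1..n. \<bar>(- 1) ^ Suc j * real (n choose j)\<bar> * B)"
    unfolding gauss_approximant_def[abs_def] using B(1) by (intro rkhs_ball_lincomb) auto
  then show ?thesis
    by (rule rkhs_ball_mono)
      (use B(1) sum_binomial_mult_le[OF B(1), of n] in \<open>auto intro!: sum_nonneg\<close>)
qed

lemma gauss_approximant_error_eq:
  fixes g :: "real^'d \<Rightarrow> real"
  assumes \<sigma>: "0 < \<sigma>" and [measurable]: "g \<in> borel_measurable borel" and gM: "\<And>x. \<bar>g x\<bar> \<le> M"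
  shows "g x - gauss_approximant \<sigma> c h n g x
    = (- 1) ^ n * (\<integral>z. fdiff n g (z + h *\<^sub>R (c - x)) x \<partial>gauss_measure (2 / \<sigma>\<^sup>2))"
proof -
  let ?\<gamma> = "gauss_measure (2 / \<sigma>\<^sup>2) :: (real^'d) measure"
  interpret prob_space ?\<gamma> using \<sigma> by (intro prob_space_gauss_measure) simp
  let ?b = "\<lambda>j. (- 1) ^ (n + j) * real (n choose j)"
  have int: "integrable ?\<gamma> (\<lambda>z. g (x + real j *\<^sub>R (z + h *\<^sub>R (c - x))))" for j
    by (rule integrable_const_bound[of _ M]) (use gM in auto)
  have "(\<integral>z. fdiff n g (z + h *\<^sub>R (c - x)) x \<partial>?\<gamma>) = (\<Sum>j\<le>n. ?b j * drift_average \<sigma> c h j g x)"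
    unfolding fdiff_eq_binomial_sum drift_average_def using int
    by (subst Bochner_Integration.integral_sum) auto
  also have "{..n} = insert 0 {1..n}" by auto
  also have "(\<Sum>j\<in>insert 0 {1..n}. ?b j * drift_average \<sigma> c h j g x)
      = (- 1) ^ n * g x + (\<Sum>j=1..n. ?b j * drift_average \<sigma> c h j g x)"
    using prob_space by (subst sum.insert) (auto simp: drift_average_def)
  also have "(\<Sum>j=1..n. ?b j * drift_average \<sigma> c h j g x)
      = - ((- 1) ^ n * gauss_approximant \<sigma> c h n g x)"
    unfolding gauss_approximant_def sum_distrib_left sum_negf[symmetric]
    by (intro sum.cong) (auto simp: power_add)
  finally show ?thesis
    by (simp add: right_diff_distrib flip: power_add mult.assoc)
qed

lemma gauss_approximant_error_le:
  fixes g :: "real^'d \<Rightarrow> real"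
  assumes \<sigma>: "0 < \<sigma>" and g [measurable]: "g \<in> borel_measurable borel" and gM: "\<And>x. \<bar>g x\<bar> \<le> M"
    and R: "0 \<le> R" and A: "0 \<le> A" "\<And>z. norm z \<le> R * \<sigma> \<Longrightarrow> \<bar>fdiff n g (z + h *\<^sub>R (c - x)) x\<bar> \<le> A"
  shows "\<bar>gauss_approximant \<sigma> c h n g x - g x\<bar> \<le> A + 2 ^ n * M * sqrt 2 ^ CARD('d) * exp (- R\<^sup>2)"
proof -
  let ?\<gamma> = "gauss_measure (2 / \<sigma>\<^sup>2) :: (real^'d) measure" and ?E = "{z. R * \<sigma> < norm z}"
  let ?d = "\<lambda>z. fdiff n g (z + h *\<^sub>R (c - x)) x"
  have a: "0 < 2 / \<sigma>\<^sup>2" using \<sigma> by simp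
  interpret prob_space ?\<gamma> by (rule prob_space_gauss_measure[OF a])
  have M: "0 \<le> M" using gM[of 0] by linarith
  have d_abs: "\<bar>?d z\<bar> \<le> 2 ^ n * M" for z by (rule abs_fdiff_le[OF gM])
  have d_le: "\<bar>?d z\<bar> \<le> A + 2 ^ n * M * indicator ?E z" for z
    using A(2)[of z] d_abs[of z] A(1) by (cases "norm z \<le> R * \<sigma>") auto
  have [measurable]: "?E \<in> sets borel" by measurable
  have [measurable]: "?d \<in> borel_measurable borel" unfolding fdiff_eq_binomial_sum by measurable
  have E_int: "integrable ?\<gamma> (indicat_real ?E)"
    by (rule integrable_const_bound[of _ 1]) auto
  have "\<bar>gauss_approximant \<sigma> c h n g x - g x\<bar> = \<bar>\<integral>z. ?d z \<partial>?\<gamma>\<bar>"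
    using gauss_approximant_error_eq[OF \<sigma> g gM] by (simp add: abs_minus_commute abs_mult power_abs)
  also have "\<dots> \<le> (\<integral>z. \<bar>?d z\<bar> \<partial>?\<gamma>)" by (rule integral_abs_bound)
  also have "\<dots> \<le> (\<integral>z. A + 2 ^ n * M * indicator ?E z \<partial>?\<gamma>)"
  proof (rule integral_mono)
    show "integrable ?\<gamma> (\<lambda>z. \<bar>?d z\<bar>)"
      by (rule integrable_const_bound[of _ "2 ^ n * M"]) (use d_abs in auto)
  qed (use d_le E_int in auto)
  also have "\<dots> = A + 2 ^ n * M * measure ?\<gamma> ?E"
    using E_int prob_space by (subst Bochner_Integration.integral_add) auto
  also have "measure ?\<gamma> ?E \<le> sqrt 2 ^ CARD('d) * exp (- R\<^sup>2)"
    using gauss_measure_tail[OF a, of "R * \<sigma>", where 'a = "real^'d"] R \<sigma>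
    by (simp add: power_mult_distrib)
  finally show ?thesis
    using M by (simp add: mult_left_mono mult.assoc)
qed

definition cube_center :: "real^'d" where
  "cube_center = (\<chi> i. 1 / 2)"

lemma cube_drift_mem:
  fixes x z :: "real^'d"
  assumes x: "x \<in> unit_cube" and z: "norm z \<le> \<tau>" and j: "real j * (2 * \<tau>) \<le> 1"
  shows "x + real j *\<^sub>R (z + (2 * \<tau>) *\<^sub>R (cube_center - x)) \<in> unit_cube" (is "?y \<in> _")
proof -
  have "0 \<le> ?y $ i \<and> ?y $ i \<le> 1" for i
  proof -
    let ?s = "real j * (2 * \<tau>)"
    have x: "0 \<le> x $ i" "x $ i \<le> 1" using x by (auto simp: unit_cube_def)
    have "\<bar>real j * z $ i\<bar> \<le> real j * \<tau>"
      using component_le_norm_cart[of z i] z by (auto simp: abs_mult intro!: mult_left_mono)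
    then have "\<bar>real j * z $ i\<bar> \<le> ?s / 2" by simp
    moreover have "?y $ i = (1 - ?s) * x $ i + ?s / 2 + real j * z $ i"
      by (simp add: cube_center_def algebra_simps)
    moreover have "0 \<le> (1 - ?s) * x $ i" "(1 - ?s) * x $ i \<le> 1 - ?s"
      using j x by (auto intro!: mult_left_le)
    ultimately show ?thesis unfolding abs_le_iff by linarith
  qed
  then show ?thesis unfolding unit_cube_def by blast
qed

lemma norm_cube_center_diff_le:
  fixes x :: "real^'d"
  assumes "x \<in> unit_cube"
  shows "norm (cube_center - x) \<le> real CARD('d)"
proof -
  have "norm (cube_center - x) \<le> (\<Sum>i\<in>UNIV. \<bar>(cube_center - x) $ i\<bar>)" by (rule norm_le_l1_cart)
  also have "\<dots> \<le> (\<Sum>i\<in>(UNIV::'d set). 1)"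
    using assms by (intro sum_mono)
      (auto simp: cube_center_def unit_cube_def abs_le_iff intro: order_trans[of _ "1/2"])
  finally show ?thesis by simp
qed

lemma hoelder_smooth_cube_fdiff_bound:
  fixes f :: "real^'d \<Rightarrow> real"
  assumes f: "hoelder_smooth u v c0 unit_cube f" "0 < v" "0 \<le> c0"
    and x: "x \<in> unit_cube" and z: "norm z \<le> \<tau>" and \<tau>: "0 \<le> \<tau>" "2 * real (Suc u) * \<tau> \<le> 1"
  shows "\<bar>fdiff (Suc u) f (z + (2 * \<tau>) *\<^sub>R (cube_center - x)) x\<bar>
    \<le> c0 * real CARD('d) ^ u * ((1 + 2 * real CARD('d)) * \<tau>) powr (real u + v)"
proof -
  let ?w = "z + (2 * \<tau>) *\<^sub>R (cube_center - x)"
  have "norm ?w \<le> norm z + 2 * \<tau> * norm (cube_center - x)"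
    using \<tau> by (intro order_trans[OF norm_triangle_ineq]) simp
  also have "\<dots> \<le> \<tau> + 2 * \<tau> * real CARD('d)"
    using z \<tau> norm_cube_center_diff_le[OF x] by (intro add_mono mult_left_mono) auto
  finally have w: "norm ?w \<le> (1 + 2 * real CARD('d)) * \<tau>" by (simp add: algebra_simps)
  have "x + real (Suc u) *\<^sub>R ?w \<in> unit_cube"
    using \<tau> by (intro cube_drift_mem[OF x z]) (simp add: mult_ac)
  then have "\<bar>fdiff (Suc u) f ?w x\<bar> \<le> c0 * real CARD('d) ^ u * norm ?w powr (real u + v)"
    using f x unfolding unit_cube_eq_cbox by (intro hoelder_smooth_fdiff_bound) auto
  also have "\<dots> \<le> c0 * real CARD('d) ^ u * ((1 + 2 * real CARD('d)) * \<tau>) powr (real u + v)"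
    using w f by (intro mult_left_mono powr_mono2) auto
  finally show ?thesis .
qed

lemma measure_lborel_unit_cube: "measure lborel (unit_cube :: (real^'d) set) = 1"
  by (auto simp: unit_cube_eq_cbox content_cbox_if_cart box_ne_empty Basis_vec_def inner_axis)

lemma
  fixes f :: "real^'d \<Rightarrow> real"
  assumes [measurable]: "f \<in> borel_measurable borel" and f: "\<And>x. \<bar>f x\<bar> \<le> indicat_real unit_cube x"
  shows integrable_sq_cube: "integrable lborel (\<lambda>x. (f x)\<^sup>2)"
    and integral_sq_cube_le_1: "(\<integral>x. (f x)\<^sup>2 \<partial>lborel) \<le> 1"
proof -
  have cube: "integrable lborel (indicat_real (unit_cube :: (real^'d) set))"
    by (simp add: unit_cube_eq_cbox emeasure_lborel_cbox_eq)
  have le: "(f x)\<^sup>2 \<le> indicat_real unit_cube x" for x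
    using f[of x] by (auto simp: indicator_def abs_square_le_1 split: if_splits)
  show int: "integrable lborel (\<lambda>x. (f x)\<^sup>2)"
    by (rule Bochner_Integration.integrable_bound[OF cube]) (use le in auto)
  show "(\<integral>x. (f x)\<^sup>2 \<partial>lborel) \<le> 1"
    using integral_mono[OF int cube le] by (simp add: measure_lborel_unit_cube)
qed

lemma gauss_approximant_cube_error:
  fixes f :: "real^'d \<Rightarrow> real"
  assumes f: "hoelder_smooth u v c0 unit_cube f" "0 < v" "0 \<le> c0"
    and f_meas: "f \<in> borel_measurable borel" and f_abs: "\<And>x. \<bar>f x\<bar> \<le> 1"
    and \<sigma>: "0 < \<sigma>" and R: "0 < R" and small: "4 * real (Suc u) * (R * \<sigma>) \<le> 1"
    and x: "x \<in> unit_cube"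
  shows "\<bar>gauss_approximant \<sigma> cube_center (2 * (R * \<sigma>)) (Suc u) f x - f x\<bar>
    \<le> c0 * real CARD('d) ^ u * (1 + 2 * real CARD('d)) powr (real u + v) * (R * \<sigma>) powr (real u + v)
      + 2 ^ Suc u * sqrt 2 ^ CARD('d) * exp (- R\<^sup>2)"
proof -
  let ?A = "c0 * real CARD('d) ^ u * ((1 + 2 * real CARD('d)) * (R * \<sigma>)) powr (real u + v)"
  have "0 \<le> real (Suc u) * (R * \<sigma>)" using R \<sigma> by simp
  then have "2 * real (Suc u) * (R * \<sigma>) \<le> 1" using small by linarith
  then have "\<bar>fdiff (Suc u) f (z + (2 * (R * \<sigma>)) *\<^sub>R (cube_center - x)) x\<bar> \<le> ?A"
    if "norm z \<le> R * \<sigma>" for z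
    using R \<sigma> by (intro hoelder_smooth_cube_fdiff_bound[OF f x that]) auto
  then have "\<bar>gauss_approximant \<sigma> cube_center (2 * (R * \<sigma>)) (Suc u) f x - f x\<bar>
      \<le> ?A + 2 ^ Suc u * 1 * sqrt 2 ^ CARD('d) * exp (- R\<^sup>2)"
    using R f(3) by (intro gauss_approximant_error_le[OF \<sigma> f_meas f_abs]) auto
  then show ?thesis using R \<sigma> by (simp add: powr_mult)
qed

lemma gauss_approximant_cube_in_rkhs_ball:
  fixes f :: "real^'d \<Rightarrow> real"
  assumes f_meas: "f \<in> borel_measurable borel" and f_supp: "\<And>x. \<bar>f x\<bar> \<le> indicat_real unit_cube x"
    and \<sigma>: "0 < \<sigma>" and h: "0 < h" "2 * real n * h \<le> 1"
  shows "gauss_approximant \<sigma> c h n f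
    \<in> rkhs_ball (gauss_kernel \<sigma>) X (2 ^ n * sqrt 2 ^ CARD('d) * sqrt (1 / \<sigma> ^ CARD('d)))"
proof -
  have f_abs: "\<bar>f x\<bar> \<le> 1" for x
    by (rule order_trans[OF f_supp indicator_le_1])
  have half: "real n * h \<le> 1 / 2" using h by simp
  have root: "sqrt 2 ^ CARD('d) * sqrt (1 / \<sigma> ^ CARD('d)) = sqrt ((2 / \<sigma>) ^ CARD('d))"
    by (simp add: real_sqrt_divide real_sqrt_power power_divide)
  have "gauss_approximant \<sigma> c h n f
      \<in> rkhs_ball (gauss_kernel \<sigma>) X (2 ^ n * sqrt ((2 / \<sigma>) ^ CARD('d)))"
    by (rule gauss_approximant_in_rkhs_ball[OF \<sigma> f_meas f_abs
          integrable_sq_cube[OF f_meas f_supp] _ _ h(1) half])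
      (use \<sigma> integral_sq_cube_le_1[OF f_meas f_supp] in \<open>auto intro!: mult_left_le_one_le\<close>)
  then show ?thesis by (simp only: root mult.assoc)
qed

lemma one_le_powr_mult_powr:
  fixes a s r :: real
  assumes "0 \<le> a" "0 \<le> s" "1 \<le> a * s" "0 \<le> r"
  shows "1 \<le> a powr r * s powr r"
  using ge_one_powr_ge_zero[of "a * s" r] assms by (simp add: powr_mult)

lemma gauss_rkhs_approximation:
  fixes f :: "real^'d \<Rightarrow> real"
  assumes f: "hoelder_smooth u v c0 unit_cube f" "0 < v" "0 \<le> c0"
    and f_meas: "f \<in> borel_measurable borel" and f_supp: "\<And>x. \<bar>f x\<bar> \<le> indicat_real unit_cube x"
  obtains C where "1 \<le> C"
    and "\<And>\<sigma> R. 0 < \<sigma> \<Longrightarrow> 0 < R \<Longrightarrow> \<exists>f0 \<in> borel_measurable borel.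
      (\<forall>x. \<bar>f0 x\<bar> \<le> C) \<and>
      (\<forall>x\<in>unit_cube. \<bar>f0 x - f x\<bar> \<le> C * ((R * \<sigma>) powr (real u + v) + exp (- R\<^sup>2))) \<and>
      f0 \<in> rkhs_ball (gauss_kernel \<sigma>) unit_cube (C * sqrt (1 / \<sigma> ^ CARD('d)))"
proof
  let ?r = "real u + v" and ?d = "real CARD('d)" and ?n = "real (Suc u)"
  let ?A = "c0 * ?d ^ u * (1 + 2 * ?d) powr ?r" and ?B = "2 ^ Suc u * sqrt 2 ^ CARD('d)"
  let ?C = "?A + ?B + (4 * ?n) powr ?r"
  have f_abs: "\<bar>f x\<bar> \<le> 1" for x
    by (rule order_trans[OF f_supp indicator_le_1])
  have "(2 :: real) ^ Suc u * 1 \<le> ?B" "1 \<le> (2 :: real) ^ Suc u" "0 \<le> ?A"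
    using f by (intro mult_left_mono one_le_power mult_nonneg_nonneg; simp)+
  then have C: "1 \<le> ?C" "2 ^ Suc u \<le> ?C" "?A \<le> ?C" "?B \<le> ?C" "(4 * ?n) powr ?r \<le> ?C"
    using powr_ge_zero[of "4 * ?n" ?r] by linarith+
  show "1 \<le> ?C" by fact
  show "\<exists>f0 \<in> borel_measurable borel. (\<forall>x. \<bar>f0 x\<bar> \<le> ?C) \<and>
      (\<forall>x\<in>unit_cube. \<bar>f0 x - f x\<bar> \<le> ?C * ((R * \<sigma>) powr ?r + exp (- R\<^sup>2))) \<and>
      f0 \<in> rkhs_ball (gauss_kernel \<sigma>) unit_cube (?C * sqrt (1 / \<sigma> ^ CARD('d)))"
    if \<sigma>: "0 < \<sigma>" and R: "0 < R" for \<sigma> R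
  proof (cases "4 * ?n * (R * \<sigma>) \<le> 1")
    case small: True
    let ?f0 = "gauss_approximant \<sigma> cube_center (2 * (R * \<sigma>)) (Suc u) f"
    show ?thesis
    proof (intro bexI[of _ ?f0] conjI allI ballI gauss_approximant_measurable[OF \<sigma> f_meas])
      show "\<bar>?f0 x\<bar> \<le> ?C" for x
        by (rule order_trans[OF gauss_approximant_abs_le[OF \<sigma> f_abs]]) (use C(2) in simp)
      show "\<bar>?f0 x - f x\<bar> \<le> ?C * ((R * \<sigma>) powr ?r + exp (- R\<^sup>2))" if "x \<in> unit_cube" for x
        unfolding distrib_left using C
        by (intro order_trans[OF gauss_approximant_cube_error[OF f f_meas f_abs \<sigma> R small that]]
            add_mono mult_right_mono) auto
      have "2 * ?n * (2 * (R * \<sigma>)) \<le> 1" using small by linarith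
      then have "?f0 \<in> rkhs_ball (gauss_kernel \<sigma>) unit_cube (?B * sqrt (1 / \<sigma> ^ CARD('d)))"
        using \<sigma> R by (intro gauss_approximant_cube_in_rkhs_ball[OF f_meas f_supp]) simp_all
      then show "?f0 \<in> rkhs_ball (gauss_kernel \<sigma>) unit_cube (?C * sqrt (1 / \<sigma> ^ CARD('d)))"
        by (rule rkhs_ball_mono) (use \<sigma> C(4) in \<open>auto intro!: mult_right_mono\<close>)
    qed
  next
    case False
    have "1 \<le> (4 * ?n) powr ?r * (R * \<sigma>) powr ?r"
      using False R \<sigma> f(2) by (intro one_le_powr_mult_powr) auto
    also have "\<dots> \<le> ?C * ((R * \<sigma>) powr ?r + exp (- R\<^sup>2))" using C by (intro mult_mono) auto
    finally have "\<bar>f x\<bar> \<le> ?C * ((R * \<sigma>) powr ?r + exp (- R\<^sup>2))" for x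
      using f_abs[of x] by simp
    then show ?thesis
      using C(1) zero_in_rkhs_ball by (intro bexI[of _ "\<lambda>_. 0"]) auto
  qed
qed

section \<open>Polynomial interpolation of kernel functions\<close>

definition lagrange_weight :: "(nat \<Rightarrow> 'a::field) \<Rightarrow> nat \<Rightarrow> 'a \<Rightarrow> nat \<Rightarrow> 'a" where
  "lagrange_weight \<xi> N t k = (\<Prod>i\<in>{..<N} - {k}. (t - \<xi> i) / (\<xi> k - \<xi> i))"

lemma lagrange_weight_node:
  assumes "inj_on \<xi> {..<N}" "k < N" "i < N"
  shows "lagrange_weight \<xi> N (\<xi> i) k = (if i = k then 1 else 0)"
proof (cases "i = k")
  case True
  have "lagrange_weight \<xi> N (\<xi> k) k = (\<Prod>i\<in>{..<N} - {k}. 1)"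
    unfolding lagrange_weight_def by (rule prod.cong) (use assms in \<open>auto simp: inj_on_def\<close>)
  then show ?thesis using True by simp
next
  case False
  then show ?thesis
    unfolding lagrange_weight_def using assms by (auto intro!: prod_zero)
qed

lemma poly_eq_lagrange_sum:
  fixes q :: "'a::field poly"
  assumes inj: "inj_on \<xi> {..<N}" and q: "degree q < N"
  shows "poly q t = (\<Sum>k<N. lagrange_weight \<xi> N t k * poly q (\<xi> k))"
proof -
  define b where "b k = (\<Prod>i\<in>{..<N} - {k}. smult (1 / (\<xi> k - \<xi> i)) [:- \<xi> i, 1:])" for k
  define p where "p = (\<Sum>k<N. smult (poly q (\<xi> k)) (b k))"
  have "poly (b k) t = lagrange_weight \<xi> N t k" for k t
    by (simp add: b_def lagrange_weight_def poly_prod diff_divide_distrib)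
  then have poly_p: "poly p t = (\<Sum>k<N. lagrange_weight \<xi> N t k * poly q (\<xi> k))" for t
    by (simp add: p_def poly_sum mult.commute)
  have "degree (b k) \<le> N - 1" if "k < N" for k
  proof -
    have "degree (b k) \<le> (\<Sum>i\<in>{..<N} - {k}. degree (smult (1 / (\<xi> k - \<xi> i)) [:- \<xi> i, 1:]))"
      unfolding b_def by (rule order_trans[OF degree_prod_sum_le]) (simp_all add: o_def)
    also have "\<dots> \<le> (\<Sum>i\<in>{..<N} - {k}. 1)" by (rule sum_mono) (auto simp: degree_smult_eq)
    also have "\<dots> = N - 1" using that by simp
    finally show ?thesis .
  qed
  then have "degree p \<le> N - 1"
    unfolding p_def by (intro degree_sum_le order_trans[OF degree_smult_le]) auto
  then have p: "degree p < N" using q by linarith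
  have "q = p"
  proof (rule poly_eqI_degree)
    fix x assume "x \<in> \<xi> ` {..<N}"
    then obtain i where i: "i < N" "x = \<xi> i" by blast
    have "poly p x = (\<Sum>k<N. if k = i then poly q (\<xi> k) else 0)"
      unfolding poly_p i(2) using i(1) by (intro sum.cong) (auto simp: lagrange_weight_node[OF inj])
    then show "poly q x = poly p x" using i by simp
  qed (use p q inj in \<open>simp_all add: card_image\<close>)
  then have "poly q t = poly p t" by simp
  also note poly_p
  finally show ?thesis .
qed

lemma abs_lagrange_weight_le:
  fixes \<xi> :: "nat \<Rightarrow> real"
  assumes "inj_on \<xi> {..<N}" "k < N"
    and ratio: "\<And>i. i < N \<Longrightarrow> i \<noteq> k \<Longrightarrow> \<bar>t - \<xi> i\<bar> \<le> c * \<bar>\<xi> k - \<xi> i\<bar>"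
  shows "\<bar>lagrange_weight \<xi> N t k\<bar> \<le> c ^ (N - 1)"
proof -
  have "\<bar>lagrange_weight \<xi> N t k\<bar> = (\<Prod>i\<in>{..<N} - {k}. \<bar>(t - \<xi> i) / (\<xi> k - \<xi> i)\<bar>)"
    by (simp add: lagrange_weight_def abs_prod)
  also have "\<dots> \<le> (\<Prod>i\<in>{..<N} - {k}. c)"
  proof (rule prod_mono)
    fix i assume "i \<in> {..<N} - {k}"
    moreover from this have "0 < \<bar>\<xi> k - \<xi> i\<bar>" using assms by (auto simp: inj_on_def)
    ultimately show "0 \<le> \<bar>(t - \<xi> i) / (\<xi> k - \<xi> i)\<bar> \<and> \<bar>(t - \<xi> i) / (\<xi> k - \<xi> i)\<bar> \<le> c"
      using ratio[of i] by (simp add: abs_divide divide_le_eq)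
  qed
  also have "\<dots> = c ^ (N - 1)" using assms by simp
  finally show ?thesis .
qed

locale interpolation_rule =
  fixes N :: nat and \<xi> :: "nat \<Rightarrow> real" and l :: "nat \<Rightarrow> real" and t \<Lambda> :: real
  assumes sum_abs_weights_le: "(\<Sum>k<N. \<bar>l k\<bar>) \<le> \<Lambda>"
    and exact: "degree q < N \<Longrightarrow> poly q t = (\<Sum>k<N. l k * poly q (\<xi> k))"
begin

definition nodes :: "real set" where
  "nodes = insert t (\<xi> ` {..<N})"

definition residual :: "(real \<Rightarrow> real) \<Rightarrow> real" where
  "residual g = g t - (\<Sum>k<N. l k * g (\<xi> k))"

lemma residual_poly: "degree q < N \<Longrightarrow> residual (poly q) = 0"
  by (simp add: residual_def exact)

lemma residual_diff: "residual (\<lambda>s. f s - g s) = residual f - residual g"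
  by (simp add: residual_def right_diff_distrib sum_subtractf)

lemma residual_eq_sum: "residual g = (\<Sum>j<Suc N. case_nat 1 (\<lambda>k. - l k) j * g (case_nat t \<xi> j))"
  unfolding sum.lessThan_Suc_shift by (simp add: residual_def sum_negf)

lemma abs_residual_le:
  assumes "\<And>s. s \<in> nodes \<Longrightarrow> \<bar>g s\<bar> \<le> b"
  shows "\<bar>residual g\<bar> \<le> (1 + \<Lambda>) * b"
proof -
  have b: "0 \<le> b" using assms[of t] by (simp add: nodes_def)
  have "\<bar>\<Sum>k<N. l k * g (\<xi> k)\<bar> \<le> (\<Sum>k<N. \<bar>l k\<bar> * b)"
    using assms by (intro order_trans[OF sum_abs] sum_mono)
      (auto simp: nodes_def abs_mult intro: mult_left_mono)
  also have "\<dots> \<le> \<Lambda> * b"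
    unfolding sum_distrib_right[symmetric] by (intro mult_right_mono sum_abs_weights_le b)
  finally show ?thesis
    using assms[of t] by (simp add: residual_def nodes_def distrib_right)
qed

lemma abs_residual_le_poly_approx:
  assumes "degree q < N" "\<And>s. s \<in> nodes \<Longrightarrow> \<bar>g s - poly q s\<bar> \<le> b"
  shows "\<bar>residual g\<bar> \<le> (1 + \<Lambda>) * b"
  using abs_residual_le[of "\<lambda>s. g s - poly q s" b] assms by (simp add: residual_diff residual_poly)

lemma abs_residual_residual_le:
  assumes "\<And>x. x \<in> nodes \<Longrightarrow> \<exists>q. degree q < N \<and> (\<forall>y\<in>nodes. \<bar>G x y - poly q y\<bar> \<le> b)"
  shows "\<bar>residual (\<lambda>x. residual (G x))\<bar> \<le> (1 + \<Lambda>)\<^sup>2 * b"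
proof -
  have "\<bar>residual (G x)\<bar> \<le> (1 + \<Lambda>) * b" if "x \<in> nodes" for x
    using assms[OF that] abs_residual_le_poly_approx by blast
  then show ?thesis
    using abs_residual_le[of "\<lambda>x. residual (G x)"] by (simp add: power2_eq_square mult.assoc)
qed

lemma residual_residual_eq_sum:
  "residual (\<lambda>x. residual (G x)) = (\<Sum>i<Suc N. \<Sum>j<Suc N.
     case_nat 1 (\<lambda>k. - l k) i * case_nat 1 (\<lambda>k. - l k) j * G (case_nat t \<xi> i) (case_nat t \<xi> j))"
  unfolding residual_eq_sum sum_distrib_left mult.assoc ..

end

lemma abs_exp_minus_taylor_le:
  fixes y :: real
  assumes "\<bar>y\<bar> \<le> 1"
  shows "\<bar>exp y - (\<Sum>m<K. y ^ m / fact m)\<bar> \<le> 3 * \<bar>y\<bar> ^ K"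
proof -
  obtain t where t: "\<bar>t\<bar> \<le> \<bar>y\<bar>" "exp y = (\<Sum>m<K. y ^ m / fact m) + exp t / fact K * y ^ K"
    using Maclaurin_exp_le[of y K] by blast
  have "exp t \<le> exp 1" using t assms by simp
  also have "\<dots> \<le> 3" by (rule exp_le)
  finally have "exp t / fact K \<le> 3 / 1" by (intro frac_le) (auto simp: fact_ge_1)
  then have "\<bar>exp t / fact K\<bar> * \<bar>y ^ K\<bar> \<le> 3 * \<bar>y ^ K\<bar>" by (intro mult_right_mono) auto
  then show ?thesis using t(2) by (simp add: abs_mult power_abs)
qed

lemma gaussian_poly_approx:
  fixes a \<sigma> \<theta> :: real
  assumes \<sigma>: "0 < \<sigma>" and \<theta>: "0 \<le> \<theta>" "\<theta> \<le> 1" and K: "1 \<le> K"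
  obtains q where "degree q < 2 * K"
    "\<And>s. \<bar>a - s\<bar> \<le> \<theta> * \<sigma> \<Longrightarrow> \<bar>exp (- (a - s)\<^sup>2 / \<sigma>\<^sup>2) - poly q s\<bar> \<le> 3 * \<theta> ^ (2 * K)"
proof
  define q where "q = (\<Sum>m<K. smult ((- 1 / \<sigma>\<^sup>2) ^ m / fact m) ([:- a, 1:] ^ (2 * m)))"
  have "degree q \<le> 2 * (K - 1)"
    unfolding q_def by (intro degree_sum_le order_trans[OF degree_smult_le])
      (auto simp: degree_linear_power)
  then show "degree q < 2 * K" using K by simp
  fix s assume s: "\<bar>a - s\<bar> \<le> \<theta> * \<sigma>"
  have "poly q s = (\<Sum>m<K. (- (a - s)\<^sup>2 / \<sigma>\<^sup>2) ^ m / fact m)"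
  proof -
    have "- (a - s)\<^sup>2 / \<sigma>\<^sup>2 = (- 1 / \<sigma>\<^sup>2) * (s - a)\<^sup>2" by (simp add: power2_commute)
    then have "(- 1 / \<sigma>\<^sup>2) ^ m * (s - a) ^ (2 * m) = (- (a - s)\<^sup>2 / \<sigma>\<^sup>2) ^ m" for m
      by (simp only: power_mult_distrib power_mult)
    then show ?thesis by (simp add: q_def poly_sum)
  qed
  moreover have y: "\<bar>- (a - s)\<^sup>2 / \<sigma>\<^sup>2\<bar> \<le> \<theta>\<^sup>2"
  proof -
    have "\<bar>a - s\<bar>\<^sup>2 \<le> (\<theta> * \<sigma>)\<^sup>2" using s by (intro power_mono) auto
    then show ?thesis using \<sigma> by (simp add: power_mult_distrib divide_le_eq)
  qed
  moreover have "\<theta>\<^sup>2 \<le> 1" using \<theta> by (simp add: power_le_one)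
  ultimately have "\<bar>exp (- (a - s)\<^sup>2 / \<sigma>\<^sup>2) - poly q s\<bar> \<le> 3 * \<bar>- (a - s)\<^sup>2 / \<sigma>\<^sup>2\<bar> ^ K"
    using abs_exp_minus_taylor_le[of "- (a - s)\<^sup>2 / \<sigma>\<^sup>2" K] by simp
  also have "\<dots> \<le> 3 * (\<theta>\<^sup>2) ^ K" using y by (intro mult_left_mono power_mono) auto
  finally show "\<bar>exp (- (a - s)\<^sup>2 / \<sigma>\<^sup>2) - poly q s\<bar> \<le> 3 * \<theta> ^ (2 * K)" by (simp add: power_mult)
qed

definition grid :: "nat \<Rightarrow> nat \<Rightarrow> real set" where
  "grid n N = (\<lambda>l. real l / real (n * N)) ` {..<n * N}"

lemma grid_bounds:
  assumes "s \<in> grid n N"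
  shows "0 \<le> s" "s \<le> 1"
  using assms by (auto simp: grid_def divide_le_eq simp flip: of_nat_mult)

lemma finite_grid [simp]: "finite (grid n N)"
  by (simp add: grid_def)

lemma card_grid_le: "card (grid n N) \<le> n * N"
  using card_image_le[of "{..<n * N}" "\<lambda>l. real l / real (n * N)"] by (simp add: grid_def)

lemma unit_interval_cell:
  fixes t :: real
  assumes "0 \<le> t" "t \<le> 1" "1 \<le> n"
  obtains i where "i < n" "real i / real n \<le> t" "t \<le> (real i + 1) / real n"
proof (cases "t = 1")
  case True
  show ?thesis
    using assms True by (intro that[of "n - 1"]) (auto simp: of_nat_diff)
next
  case False
  define i where "i = nat \<lfloor>real n * t\<rfloor>"
  have "0 \<le> real n * t" using assms by simp
  then have i: "real i \<le> real n * t" "real n * t < real i + 1"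
    unfolding i_def by (auto simp: of_nat_nat)
  have "real n * t < real n * 1" using assms False by (intro mult_strict_left_mono) auto
  then have "i < n" using i(1) by simp
  then show ?thesis using that[of i] i assms by (auto simp: field_simps)
qed

lemma equispaced_interpolation_rule:
  fixes x h t :: real
  assumes h: "0 < h" and N: "1 \<le> N" and t: "x \<le> t" "t \<le> x + real N * h"
  defines "\<xi> \<equiv> \<lambda>k. x + real k * h"
  shows "interpolation_rule N \<xi> (lagrange_weight \<xi> N t) t (real N ^ N)"
proof
  have inj: "inj_on \<xi> {..<N}" using h by (auto simp: inj_on_def \<xi>_def)
  have "\<bar>lagrange_weight \<xi> N t k\<bar> \<le> real N ^ (N - 1)" if k: "k < N" for k
  proof (rule abs_lagrange_weight_le[OF inj k])
    fix j assume j: "j < N" "j \<noteq> k"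
    have "0 \<le> real j * h" "real j * h \<le> real N * h" using j h by (auto intro: mult_right_mono)
    then have "\<bar>t - \<xi> j\<bar> \<le> real N * (1 * h)" using t by (simp add: \<xi>_def abs_le_iff)
    also have "\<dots> \<le> real N * (\<bar>real k - real j\<bar> * h)"
      using j h by (intro mult_left_mono mult_right_mono) auto
    also have "\<dots> = real N * \<bar>\<xi> k - \<xi> j\<bar>"
      using h by (simp add: \<xi>_def abs_mult flip: left_diff_distrib)
    finally show "\<bar>t - \<xi> j\<bar> \<le> real N * \<bar>\<xi> k - \<xi> j\<bar>" .
  qed
  then have "(\<Sum>k<N. \<bar>lagrange_weight \<xi> N t k\<bar>) \<le> (\<Sum>k<N. real N ^ (N - 1))"
    by (intro sum_mono) auto
  also have "\<dots> = real N ^ N" using N by (simp flip: power_Suc)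
  finally show "(\<Sum>k<N. \<bar>lagrange_weight \<xi> N t k\<bar>) \<le> real N ^ N" .
  show "poly q t = (\<Sum>k<N. lagrange_weight \<xi> N t k * poly q (\<xi> k))" if "degree q < N" for q
    by (rule poly_eq_lagrange_sum[OF inj that])
qed

lemma grid_interpolation_rule:
  assumes t: "0 \<le> t" "t \<le> 1" and n: "1 \<le> n" and N: "1 \<le> N"
  obtains \<xi> l where "interpolation_rule N \<xi> l t (real N ^ N)" "\<And>k. k < N \<Longrightarrow> \<xi> k \<in> grid n N"
    "\<And>x y. x \<in> interpolation_rule.nodes N \<xi> t \<Longrightarrow> y \<in> interpolation_rule.nodes N \<xi> t \<Longrightarrow>
      \<bar>x - y\<bar> \<le> 1 / real n"
proof -
  obtain i where i: "i < n" "real i / real n \<le> t" "t \<le> (real i + 1) / real n"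
    using unit_interval_cell[OF t n] by blast
  define h where "h = 1 / real (n * N)"
  define \<xi> where "\<xi> k = real i / real n + real k * h" for k
  have h: "0 < h" "real N * h = 1 / real n" using n N by (auto simp: h_def)
  have "interpolation_rule N \<xi> (lagrange_weight \<xi> N t) t (real N ^ N)"
    unfolding \<xi>_def using i h N
    by (intro equispaced_interpolation_rule) (auto simp: add_divide_distrib)
  moreover have "\<xi> k \<in> grid n N" if "k < N" for k
  proof -
    have "\<xi> k = real (i * N + k) / real (n * N)" using n N by (simp add: \<xi>_def h_def field_simps)
    moreover have "i * N + k < n * N"
    proof -
      have "i * N + k < Suc i * N" using that by simp
      also have "\<dots> \<le> n * N" using i by (intro mult_le_mono1) simp
      finally show ?thesis .
    qed
    ultimately show ?thesis unfolding grid_def by (intro image_eqI) auto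
  qed
  moreover have "\<bar>x - y\<bar> \<le> 1 / real n"
    if "x \<in> insert t (\<xi> ` {..<N})" "y \<in> insert t (\<xi> ` {..<N})" for x y
  proof -
    let ?I = "{real i / real n .. real i / real n + 1 / real n}"
    have "\<xi> k \<in> ?I" if "k < N" for k
      using that h mult_right_mono[of "real k" "real N" h] by (simp add: \<xi>_def)
    then have "insert t (\<xi> ` {..<N}) \<subseteq> ?I" using i by (auto simp: add_divide_distrib)
    then have "x \<in> ?I" "y \<in> ?I" using that by blast+
    then show ?thesis by (simp add: abs_le_iff)
  qed
  ultimately show ?thesis
    by (intro that[of \<xi> "lagrange_weight \<xi> N t"]) (auto simp only: interpolation_rule.nodes_def)
qed

section \<open>Covering numbers of Gaussian RKHS balls\<close>

definition set_coord :: "real^'d \<Rightarrow> 'd \<Rightarrow> real \<Rightarrow> real^'d" where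
  "set_coord x i s = (\<chi> j. if j = i then s else x $ j)"

lemma set_coord_mem: "x \<in> unit_cube \<Longrightarrow> 0 \<le> s \<Longrightarrow> s \<le> 1 \<Longrightarrow> set_coord x i s \<in> unit_cube"
  by (auto simp: unit_cube_def set_coord_def)

lemma set_coord_same [simp]: "set_coord x i (x $ i) = x"
  by (simp add: set_coord_def vec_eq_iff)

lemma gauss_kernel_set_coord:
  "gauss_kernel \<sigma> (set_coord x i s) (set_coord x i t) = exp (- (s - t)\<^sup>2 / \<sigma>\<^sup>2)"
proof -
  have "set_coord x i s - set_coord x i t = axis i (s - t)"
    by (auto simp: set_coord_def axis_def vec_eq_iff)
  moreover have "(norm (axis i (s - t)))\<^sup>2 = (s - t)\<^sup>2"
    unfolding power2_norm_eq_inner by (simp add: inner_axis_axis power2_eq_square)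
  ultimately show ?thesis by (simp add: gauss_kernel_def)
qed

lemma (in interpolation_rule) gauss_rkhs_ball_residual_le:
  fixes F :: "real^'d \<Rightarrow> real"
  assumes F: "F \<in> rkhs_ball (gauss_kernel \<sigma>) X B" and B: "0 \<le> B" and \<sigma>: "0 < \<sigma>"
    and \<theta>: "0 \<le> \<theta>" "\<theta> \<le> 1" and K: "1 \<le> K" "N = 2 * K"
    and diam: "\<And>a b. a \<in> nodes \<Longrightarrow> b \<in> nodes \<Longrightarrow> \<bar>a - b\<bar> \<le> \<theta> * \<sigma>"
    and mem: "\<And>s. s \<in> nodes \<Longrightarrow> set_coord x i s \<in> X"
  shows "\<bar>residual (\<lambda>s. F (set_coord x i s))\<bar> \<le> 2 * B * (1 + \<Lambda>) * \<theta> ^ K"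
proof -
  interpret positive_kernel "gauss_kernel \<sigma>" X by (rule positive_kernel_gauss[OF \<sigma>])
  let ?G = "\<lambda>a s. exp (- (a - s)\<^sup>2 / \<sigma>\<^sup>2)"
  let ?c = "case_nat 1 (\<lambda>k. - l k)" and ?p = "\<lambda>j. set_coord x i (case_nat t \<xi> j)"
  have "0 \<le> (\<Sum>k<N. \<bar>l k\<bar>)" by (rule sum_nonneg) simp
  then have \<Lambda>: "0 \<le> \<Lambda>" using sum_abs_weights_le by linarith
  have "case_nat t \<xi> j \<in> nodes" if "j \<in> {..<Suc N}" for j
    using that by (cases j) (auto simp: nodes_def)
  then have "?p ` {..<Suc N} \<subseteq> X" using mem by blast
  from rkhs_ball_dual_family[OF F finite_lessThan this, of ?c]
  have "(residual (\<lambda>s. F (set_coord x i s)))\<^sup>2 \<le> B\<^sup>2 * residual (\<lambda>a. residual (?G a))"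
    unfolding gauss_kernel_set_coord residual_residual_eq_sum
      residual_eq_sum[of "\<lambda>s. F (set_coord x i s)"] .
  also have "\<dots> \<le> B\<^sup>2 * ((1 + \<Lambda>)\<^sup>2 * (3 * \<theta> ^ (2 * K)))"
  proof (rule mult_left_mono[OF order_trans[OF abs_ge_self abs_residual_residual_le]])
    fix a assume a: "a \<in> nodes"
    obtain q where "degree q < 2 * K"
      "\<And>s. \<bar>a - s\<bar> \<le> \<theta> * \<sigma> \<Longrightarrow> \<bar>?G a s - poly q s\<bar> \<le> 3 * \<theta> ^ (2 * K)"
      using gaussian_poly_approx[OF \<sigma> \<theta> K(1), of a] by blast
    then show "\<exists>q. degree q < N \<and> (\<forall>y\<in>nodes. \<bar>?G a y - poly q y\<bar> \<le> 3 * \<theta> ^ (2 * K))"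
      using diam[OF a] K(2) by blast
  qed simp
  also have "\<dots> \<le> B\<^sup>2 * ((1 + \<Lambda>)\<^sup>2 * (4 * \<theta> ^ (2 * K)))"
    using \<theta> by (intro mult_left_mono mult_right_mono) auto
  also have "\<dots> = (2 * B * (1 + \<Lambda>) * \<theta> ^ K)\<^sup>2"
    by (simp add: power_mult_distrib power_even_eq)
  finally show ?thesis
    using B \<Lambda> \<theta> by (simp flip: abs_le_square_iff)
qed

lemma gauss_rkhs_ball_interpolate_coord:
  fixes F :: "real^'d \<Rightarrow> real"
  assumes F: "F \<in> rkhs_ball (gauss_kernel \<sigma>) unit_cube B" and B: "0 \<le> B" and x: "x \<in> unit_cube"
    and n: "1 \<le> n" and K: "1 \<le> K" "N = 2 * K" and \<sigma>: "0 < \<sigma>" "1 \<le> real n * \<sigma>"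
    and b: "0 \<le> b" "\<And>s. s \<in> grid n N \<Longrightarrow> \<bar>F (set_coord x i s)\<bar> \<le> b"
  shows "\<bar>F x\<bar> \<le> real N ^ N * b + 2 * B * (1 + real N ^ N) * (1 / (real n * \<sigma>)) ^ K"
proof -
  have xi: "0 \<le> x $ i" "x $ i \<le> 1" using x by (auto simp: unit_cube_def)
  have N: "1 \<le> N" using K by simp
  obtain \<xi> l where rule: "interpolation_rule N \<xi> l (x $ i) (real N ^ N)"
    and grid: "\<And>k. k < N \<Longrightarrow> \<xi> k \<in> grid n N"
    and diam: "\<And>a b. a \<in> interpolation_rule.nodes N \<xi> (x $ i) \<Longrightarrow>
      b \<in> interpolation_rule.nodes N \<xi> (x $ i) \<Longrightarrow> \<bar>a - b\<bar> \<le> 1 / real n"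
    using grid_interpolation_rule[OF xi n N] by blast
  interpret interpolation_rule N \<xi> l "x $ i" "real N ^ N" by (rule rule)
  have node_bounds: "0 \<le> s" "s \<le> 1" if "s \<in> nodes" for s
    using that xi grid_bounds[OF grid] by (auto simp: nodes_def)
  have "\<bar>residual (\<lambda>s. F (set_coord x i s))\<bar> \<le> 2 * B * (1 + real N ^ N) * (1 / (real n * \<sigma>)) ^ K"
  proof (rule gauss_rkhs_ball_residual_le[OF F B \<sigma>(1) _ _ K])
    show "\<bar>a - b\<bar> \<le> 1 / (real n * \<sigma>) * \<sigma>" if "a \<in> nodes" "b \<in> nodes" for a b
      using diam[OF that] \<sigma> by simp
    show "set_coord x i s \<in> unit_cube" if "s \<in> nodes" for s
      using node_bounds[OF that] x by (intro set_coord_mem)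
  qed (use \<sigma> in auto)
  moreover have "\<bar>\<Sum>k<N. l k * F (set_coord x i (\<xi> k))\<bar> \<le> real N ^ N * b"
  proof -
    have "\<bar>\<Sum>k<N. l k * F (set_coord x i (\<xi> k))\<bar> \<le> (\<Sum>k<N. \<bar>l k\<bar> * b)"
      using grid b(2) by (intro order_trans[OF sum_abs] sum_mono)
        (auto simp: abs_mult intro: mult_left_mono)
    also have "\<dots> \<le> real N ^ N * b"
      unfolding sum_distrib_right[symmetric] by (intro mult_right_mono sum_abs_weights_le b)
    finally show ?thesis .
  qed
  ultimately show ?thesis by (simp add: residual_def)
qed

definition grid_points :: "nat \<Rightarrow> nat \<Rightarrow> (real^'d) set" where
  "grid_points n N = {x. \<forall>i. x $ i \<in> grid n N}"

lemma grid_points_subset: "grid_points n N \<subseteq> unit_cube"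
  by (auto simp: grid_points_def unit_cube_def intro: grid_bounds)

lemma
  shows finite_grid_points: "finite (grid_points n N :: (real^'d) set)"
    and card_grid_points_le: "card (grid_points n N :: (real^'d) set) \<le> (n * N) ^ CARD('d)"
proof -
  let ?P = "PiE (UNIV :: 'd set) (\<lambda>_. grid n N)"
  have eq: "grid_points n N = vec_lambda ` ?P"
  proof (intro set_eqI iffI)
    fix x :: "real^'d" assume "x \<in> grid_points n N"
    then show "x \<in> vec_lambda ` ?P"
      by (intro image_eqI[of _ _ "vec_nth x"]) (auto simp: grid_points_def)
  qed (auto simp: grid_points_def)
  have P: "finite ?P" by (intro finite_PiE) auto
  then show "finite (grid_points n N :: (real^'d) set)" unfolding eq by simp
  have "card (grid_points n N :: (real^'d) set) \<le> card ?P"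
    unfolding eq by (rule card_image_le[OF P])
  also have "\<dots> = card (grid n N) ^ CARD('d)" by (simp add: card_PiE)
  also have "\<dots> \<le> (n * N) ^ CARD('d)" by (intro power_mono card_grid_le) simp
  finally show "card (grid_points n N :: (real^'d) set) \<le> (n * N) ^ CARD('d)" .
qed

lemma gauss_rkhs_ball_grid_bound:
  fixes F :: "real^'d \<Rightarrow> real"
  assumes F: "F \<in> rkhs_ball (gauss_kernel \<sigma>) unit_cube B" and B: "0 \<le> B"
    and n: "1 \<le> n" and K: "1 \<le> K" "N = 2 * K" and \<sigma>: "0 < \<sigma>" "1 \<le> real n * \<sigma>"
    and grid: "\<And>x. x \<in> grid_points n N \<Longrightarrow> \<bar>F x\<bar> \<le> \<epsilon>" and \<epsilon>: "0 \<le> \<epsilon>" and x: "x \<in> unit_cube"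
  shows "\<bar>F x\<bar> \<le> (1 + real N ^ N) ^ CARD('d) *
    (\<epsilon> + real CARD('d) * (2 * B * (1 + real N ^ N) * (1 / (real n * \<sigma>)) ^ K))"
proof -
  let ?\<Lambda> = "real N ^ N"
  define e where "e = 2 * B * (1 + ?\<Lambda>) * (1 / (real n * \<sigma>)) ^ K"
  have e: "0 \<le> e" using B \<sigma> by (simp add: e_def)
  have "\<bar>F x\<bar> \<le> (1 + ?\<Lambda>) ^ card S * (\<epsilon> + real (card S) * e)"
    if "x \<in> unit_cube" "\<forall>i. i \<notin> S \<longrightarrow> x $ i \<in> grid n N" for S x
    using finite[of S] that
  proof (induction S arbitrary: x rule: finite_induct)
    case empty
    then show ?case using grid by (simp add: grid_points_def)
  next
    case (insert i S)
    let ?b = "(1 + ?\<Lambda>) ^ card S * (\<epsilon> + real (card S) * e)"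
    have b: "0 \<le> ?b" using \<epsilon> e by simp
    have "\<bar>F (set_coord x i s)\<bar> \<le> ?b" if "s \<in> grid n N" for s
      using that insert.prems grid_bounds[OF that]
      by (intro insert.IH set_coord_mem) (auto simp: set_coord_def)
    then have "\<bar>F x\<bar> \<le> ?\<Lambda> * ?b + e"
      unfolding e_def using insert.prems(1)
      by (intro gauss_rkhs_ball_interpolate_coord[OF F B _ n K \<sigma>]) (use b in \<open>auto simp: e_def\<close>)
    also have "\<dots> \<le> (1 + ?\<Lambda>) * ?b + (1 + ?\<Lambda>) ^ Suc (card S) * e"
    proof (rule add_mono)
      show "?\<Lambda> * ?b \<le> (1 + ?\<Lambda>) * ?b" using b by (intro mult_right_mono) auto
      show "e \<le> (1 + ?\<Lambda>) ^ Suc (card S) * e"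
        using mult_right_mono[OF one_le_power[of "1 + ?\<Lambda>" "Suc (card S)"] e] by simp
    qed
    also have "\<dots> = (1 + ?\<Lambda>) ^ Suc (card S) * (\<epsilon> + real (Suc (card S)) * e)"
      by (simp add: algebra_simps)
    finally show ?case using insert.hyps by simp
  qed
  from this[of x UNIV] x show ?thesis by (simp add: e_def)
qed

definition uniform_net :: "'a set \<Rightarrow> real \<Rightarrow> ('a \<Rightarrow> real) set \<Rightarrow> ('a \<Rightarrow> real) set \<Rightarrow> bool" where
  "uniform_net X e H T \<longleftrightarrow> finite T \<and> T \<subseteq> H \<and> (\<forall>f\<in>H. \<exists>g\<in>T. \<forall>x\<in>X. \<bar>f x - g x\<bar> \<le> e)"

lemma uniform_net_card_ge_1: "uniform_net X e H T \<Longrightarrow> f \<in> H \<Longrightarrow> 1 \<le> card T"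
  by (auto simp: uniform_net_def Suc_le_eq card_gt_0_iff)

lemma floor_divide_mem_range:
  fixes y B \<epsilon> :: real
  assumes "0 < \<epsilon>" "\<bar>y\<bar> \<le> B"
  shows "\<lfloor>y / \<epsilon>\<rfloor> \<in> {- \<lfloor>B / \<epsilon>\<rfloor> - 1 .. \<lfloor>B / \<epsilon>\<rfloor>}"
proof -
  have "y / \<epsilon> \<le> B / \<epsilon>" "- (B / \<epsilon>) \<le> y / \<epsilon>"
    using assms by (auto simp: field_simps abs_le_iff)
  then show ?thesis by (auto intro: floor_mono) linarith
qed

lemma uniform_net_on_finite_set:
  fixes H :: "('a \<Rightarrow> real) set"
  assumes G: "finite G" and \<epsilon>: "0 < \<epsilon>" and B: "0 \<le> B"
    and bounded: "\<And>f x. f \<in> H \<Longrightarrow> x \<in> G \<Longrightarrow> \<bar>f x\<bar> \<le> B"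
  obtains T where "uniform_net G \<epsilon> H T" "real (card T) \<le> (2 * B / \<epsilon> + 3) ^ card G"
proof
  define code where "code f = restrict (\<lambda>x. \<lfloor>f x / \<epsilon>\<rfloor>) G" for f
  let ?R = "{- \<lfloor>B / \<epsilon>\<rfloor> - 1 .. \<lfloor>B / \<epsilon>\<rfloor>}" and ?T = "inv_into H code ` (code ` H)"
  let ?C = "PiE G (\<lambda>_. ?R)"
  have C: "finite ?C" "card ?C = card ?R ^ card G" using G by (auto simp: finite_PiE card_PiE)
  have sub: "code ` H \<subseteq> ?C"
    unfolding code_def using floor_divide_mem_range[OF \<epsilon> bounded] by (auto simp: PiE_iff)
  then have fin: "finite (code ` H)" using C(1) by (rule finite_subset)
  have "card ?T \<le> card (code ` H)" by (rule card_image_le[OF fin])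
  also have "\<dots> \<le> card ?R ^ card G" using card_mono[OF C(1) sub] by (simp only: C(2))
  finally have "real (card ?T) \<le> real (card ?R) ^ card G"
    by (simp only: of_nat_le_iff flip: of_nat_power)
  also have "\<dots> \<le> (2 * B / \<epsilon> + 3) ^ card G"
  proof (rule power_mono)
    have "0 \<le> B / \<epsilon>" using B \<epsilon> by simp
    then show "real (card ?R) \<le> 2 * B / \<epsilon> + 3" by (simp add: of_nat_nat) linarith
  qed simp
  finally show "real (card ?T) \<le> (2 * B / \<epsilon> + 3) ^ card G" .
  have "\<bar>f x - inv_into H code (code f) x\<bar> \<le> \<epsilon>" if f: "f \<in> H" and x: "x \<in> G" for f x
  proof -
    let ?g = "inv_into H code (code f)"
    have "code ?g = code f" by (rule f_inv_into_f[of _ code]) (use f in blast)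
    then have "\<lfloor>f x / \<epsilon>\<rfloor> = \<lfloor>?g x / \<epsilon>\<rfloor>" using x by (auto simp: code_def dest: fun_cong[of _ _ x])
    then have "\<bar>f x / \<epsilon> - ?g x / \<epsilon>\<bar> \<le> 1" by linarith
    then show ?thesis using \<epsilon> by (simp add: abs_divide flip: diff_divide_distrib)
  qed
  then show "uniform_net G \<epsilon> H ?T"
    unfolding uniform_net_def using fin by (auto intro: inv_into_into)
qed

lemma gauss_rkhs_ball_covering:
  assumes B: "0 \<le> B" and n: "1 \<le> n" and K: "1 \<le> K" "N = 2 * K" and \<sigma>: "0 < \<sigma>" "1 \<le> real n * \<sigma>"
    and \<epsilon>: "0 < \<epsilon>"
  defines "H \<equiv> rkhs_ball (gauss_kernel \<sigma>) (unit_cube :: (real^'d) set) B"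
    and "e \<equiv> (1 + real N ^ N) ^ CARD('d) *
      (\<epsilon> + real CARD('d) * (4 * B * (1 + real N ^ N) * (1 / (real n * \<sigma>)) ^ K))"
  obtains T where "uniform_net unit_cube e H T"
    "real (card T) \<le> (2 * B / \<epsilon> + 3) ^ ((n * N) ^ CARD('d))"
proof -
  let ?G = "grid_points n N :: (real^'d) set"
  interpret positive_kernel "gauss_kernel \<sigma>" "unit_cube :: (real^'d) set"
    by (rule positive_kernel_gauss[OF \<sigma>(1)])
  have "\<bar>f x\<bar> \<le> B" if "f \<in> H" "x \<in> ?G" for f x
    using rkhs_ball_abs_le[OF that(1)[unfolded H_def] B] that(2) grid_points_subset
    by (auto simp: subset_iff)
  then obtain T where T: "uniform_net ?G \<epsilon> H T" "real (card T) \<le> (2 * B / \<epsilon> + 3) ^ card ?G"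
    using uniform_net_on_finite_set[OF finite_grid_points \<epsilon> B] by metis
  note T(2)
  also have "(2 * B / \<epsilon> + 3) ^ card ?G \<le> (2 * B / \<epsilon> + 3) ^ ((n * N) ^ CARD('d))"
    using B \<epsilon> by (intro power_increasing card_grid_points_le) (simp add: add_increasing)
  finally have card: "real (card T) \<le> (2 * B / \<epsilon> + 3) ^ ((n * N) ^ CARD('d))" .
  have "\<bar>f x - g x\<bar> \<le> e"
    if f: "f \<in> H" and g: "g \<in> H" and close: "\<forall>x\<in>?G. \<bar>f x - g x\<bar> \<le> \<epsilon>" and x: "x \<in> unit_cube"
      for f g x
  proof -
    have "(\<lambda>x. f x - g x) \<in> rkhs_ball (gauss_kernel \<sigma>) unit_cube (B + B)"
      using f g B unfolding H_def by (intro rkhs_ball_diff)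
    from gauss_rkhs_ball_grid_bound[OF this _ n K \<sigma> _ _ x, of \<epsilon>] show ?thesis
      using close B \<epsilon> by (simp add: e_def mult_2[symmetric])
  qed
  then have "uniform_net unit_cube e H T"
    using T(1) unfolding uniform_net_def by (meson subsetD)
  then show ?thesis using card by (rule that)
qed

section \<open>Uniform concentration over a finite class\<close>

definition holds_with_prob :: "'a measure \<Rightarrow> real \<Rightarrow> ('a \<Rightarrow> bool) \<Rightarrow> bool" where
  "holds_with_prob M p Q \<longleftrightarrow> (\<exists>E\<in>sets M. p \<le> measure M E \<and> (\<forall>x\<in>E. Q x))"

lemma holds_with_prob_mono:
  "holds_with_prob M p Q \<Longrightarrow> p' \<le> p \<Longrightarrow> (\<And>x. Q x \<Longrightarrow> Q' x) \<Longrightarrow> holds_with_prob M p' Q'"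
  unfolding holds_with_prob_def by (meson order_trans)

context prob_space
begin

lemma holds_with_prob_compl:
  assumes "{x \<in> space M. \<not> Q x} \<in> events" "prob {x \<in> space M. \<not> Q x} \<le> \<delta>"
  shows "holds_with_prob M (1 - \<delta>) Q"
  unfolding holds_with_prob_def
proof (intro bexI conjI ballI)
  let ?E = "space M - {x \<in> space M. \<not> Q x}"
  show "?E \<in> events" using assms by auto
  show "1 - \<delta> \<le> prob ?E" using assms by (simp add: prob_compl)
  show "Q x" if "x \<in> ?E" for x using that by blast
qed

lemma holds_with_prob_conj:
  assumes "holds_with_prob M (1 - a) Q" "holds_with_prob M (1 - b) R"
  shows "holds_with_prob M (1 - (a + b)) (\<lambda>x. Q x \<and> R x)"
proof -
  obtain E F where E: "E \<in> events" "1 - a \<le> prob E" "\<forall>x\<in>E. Q x"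
    and F: "F \<in> events" "1 - b \<le> prob F" "\<forall>x\<in>F. R x"
    using assms unfolding holds_with_prob_def by blast
  have "prob (E \<union> F) = prob E + prob F - prob (E \<inter> F)"
    using E F by (intro measure_Un3) (auto simp: fmeasurable_eq_sets)
  then have "1 - (a + b) \<le> prob (E \<inter> F)"
    using prob_le_1[of "E \<union> F"] E F by linarith
  then show ?thesis
    unfolding holds_with_prob_def using E F by (intro bexI[of _ "E \<inter> F"]) auto
qed

lemma holds_with_prob_ball:
  assumes "finite T" "\<And>t. t \<in> T \<Longrightarrow> holds_with_prob M (1 - a) (Q t)"
  shows "holds_with_prob M (1 - real (card T) * a) (\<lambda>x. \<forall>t\<in>T. Q t x)"
  using assms
proof (induction T rule: finite_induct)
  case empty
  show ?case
    unfolding holds_with_prob_def by (intro bexI[of _ "space M"]) (auto simp: prob_space)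
next
  case (insert t T)
  then have "holds_with_prob M (1 - (a + real (card T) * a)) (\<lambda>x. Q t x \<and> (\<forall>t\<in>T. Q t x))"
    by (intro holds_with_prob_conj) auto
  then show ?case
    by (rule holds_with_prob_mono) (use insert.hyps in \<open>auto simp: distrib_right\<close>)
qed

lemma holds_with_prob_AE:
  assumes "holds_with_prob M p Q" "AE x in M. R x"
  shows "holds_with_prob M p (\<lambda>x. Q x \<and> R x)"
proof -
  obtain E where E: "E \<in> events" "p \<le> prob E" "\<forall>x\<in>E. Q x"
    using assms(1) unfolding holds_with_prob_def by blast
  obtain N where N: "{x \<in> space M. \<not> R x} \<subseteq> N" "N \<in> null_sets M"
    using assms(2) by (auto elim!: AE_E simp: null_sets_def)
  have "prob (E - N) = prob E"
    using E N by (simp add: measure_Diff_null_set)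
  then show ?thesis
    unfolding holds_with_prob_def using E N sets.sets_into_space[OF E(1)]
    by (intro bexI[of _ "E - N"]) auto
qed

end

definition sample_mean :: "nat \<Rightarrow> (nat \<Rightarrow> 'a) \<Rightarrow> ('a \<Rightarrow> real) \<Rightarrow> real" where
  "sample_mean m D h = (\<Sum>i<m. h (D i)) / real m"

context prob_space
begin

lemma product_exp_tail_bound:
  assumes [measurable]: "h \<in> borel_measurable M"
    and mgf: "(\<integral>\<^sup>+z. ennreal (exp (h z)) \<partial>M) \<le> ennreal (exp b)"
  shows "measure (PiM {..<m} (\<lambda>_. M))
      {D \<in> space (PiM {..<m} (\<lambda>_. M)). real m * b + t \<le> (\<Sum>i<m. h (D i))}
    \<le> exp (- t)"
proof -
  interpret P: product_sigma_finite "\<lambda>_::nat. M" ..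
  let ?P = "PiM {..<m} (\<lambda>_. M)"
  let ?B = "{D \<in> space ?P. real m * b + t \<le> (\<Sum>i<m. h (D i))}"
  let ?w = "ennreal (exp (- (real m * b + t)))"
  have B [measurable]: "?B \<in> sets ?P" by measurable
  have markov: "indicator ?B D \<le> ?w * (\<Prod>i<m. ennreal (exp (h (D i))))" for D
  proof (cases "D \<in> ?B")
    case True
    have "1 \<le> exp (- (real m * b + t) + (\<Sum>i<m. h (D i)))" using True by simp
    also have "\<dots> = exp (- (real m * b + t)) * (\<Prod>i<m. exp (h (D i)))" by (simp add: exp_add exp_sum)
    finally have "ennreal 1 \<le> ennreal (exp (- (real m * b + t)) * (\<Prod>i<m. exp (h (D i))))"
      by (rule ennreal_leI)
    then show ?thesis using True by (simp add: ennreal_mult prod_nonneg prod_ennreal)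
  qed simp
  have "emeasure ?P ?B = (\<integral>\<^sup>+D. indicator ?B D \<partial>?P)" by simp
  also have "\<dots> \<le> (\<integral>\<^sup>+D. ?w * (\<Prod>i<m. ennreal (exp (h (D i)))) \<partial>?P)"
    by (intro nn_integral_mono markov)
  also have "\<dots> = ?w * (\<integral>\<^sup>+D. (\<Prod>i<m. ennreal (exp (h (D i)))) \<partial>?P)"
    by (rule nn_integral_cmult) measurable
  also have "(\<integral>\<^sup>+D. (\<Prod>i<m. ennreal (exp (h (D i)))) \<partial>?P) = (\<Prod>i<m. (\<integral>\<^sup>+z. ennreal (exp (h z)) \<partial>M))"
    by (rule P.product_nn_integral_prod) auto
  also have "?w * \<dots> \<le> ?w * (\<Prod>i<m. ennreal (exp b))"
    by (intro mult_left_mono prod_mono_ennreal mgf) simp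
  also have "\<dots> = ennreal (exp (- t))"
    by (simp add: ennreal_power flip: ennreal_mult exp_of_nat_mult exp_add)
  finally show ?thesis
    unfolding measure_def by (intro enn2real_leI) auto
qed

definition bernstein_cond :: "real \<Rightarrow> ('a \<Rightarrow> real) \<Rightarrow> bool" where
  "bernstein_cond s h \<longleftrightarrow> h \<in> borel_measurable M \<and>
     (AE z in M. s * \<bar>h z\<bar> \<le> 1) \<and> 6 * s * expectation (\<lambda>z. (h z)\<^sup>2) \<le> expectation h"

lemma bernstein_cond_mgf_le:
  assumes h: "bernstein_cond s h" and s: "0 < s" and r: "\<bar>r\<bar> = s"
  shows "(\<integral>\<^sup>+z. ennreal (exp (r * h z)) \<partial>M)
      \<le> ennreal (exp (r * expectation h + s * expectation h / 2))"
proof -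
  have [measurable]: "h \<in> borel_measurable M"
    and bounded: "AE z in M. s * \<bar>h z\<bar> \<le> 1"
    and variance: "6 * s * expectation (\<lambda>z. (h z)\<^sup>2) \<le> expectation h"
    using h unfolding bernstein_cond_def by auto
  have abs_le: "AE z in M. \<bar>h z\<bar> \<le> 1 / s"
    using bounded by eventually_elim (use s in \<open>simp add: field_simps\<close>)
  have int: "integrable M h" by (rule integrable_const_bound[of _ "1 / s"]) (use abs_le in auto)
  have int_sq: "integrable M (\<lambda>z. (h z)\<^sup>2)"
  proof (rule integrable_const_bound[of _ "(1 / s)\<^sup>2"])
    show "AE z in M. norm ((h z)\<^sup>2) \<le> (1 / s)\<^sup>2"
      using abs_le by eventually_elim (use s in \<open>simp add: abs_le_square_iff[symmetric]\<close>)
  qed simp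
  have pointwise: "AE z in M. exp (r * h z) \<le> 1 + r * h z + 3 * s\<^sup>2 * (h z)\<^sup>2"
    using bounded
  proof eventually_elim
    case (elim z)
    have sq: "(r * h z)\<^sup>2 = s\<^sup>2 * (h z)\<^sup>2" using r by (auto simp: power_mult_distrib)
    have "\<bar>r * h z\<bar> \<le> 1" using elim r by (simp add: abs_mult)
    then have "\<bar>exp (r * h z) - (\<Sum>m<2. (r * h z) ^ m / fact m)\<bar> \<le> 3 * \<bar>r * h z\<bar>\<^sup>2"
      by (rule abs_exp_minus_taylor_le)
    moreover have "(\<Sum>m<2. (r * h z) ^ m / fact m) = 1 + r * h z" by (simp add: numeral_2_eq_2)
    ultimately show ?case unfolding power2_abs sq abs_le_iff by linarith
  qed
  have "(\<integral>\<^sup>+z. ennreal (exp (r * h z)) \<partial>M) \<le> (\<integral>\<^sup>+z. ennreal (1 + r * h z + 3 * s\<^sup>2 * (h z)\<^sup>2) \<partial>M)"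
    using pointwise by (intro nn_integral_mono_AE) (auto elim!: eventually_mono intro: ennreal_leI)
  also have "\<dots> = ennreal (expectation (\<lambda>z. 1 + r * h z + 3 * s\<^sup>2 * (h z)\<^sup>2))"
    using int int_sq pointwise
    by (intro nn_integral_eq_integral)
      (auto elim!: eventually_mono intro: order_trans[OF exp_ge_zero])
  also have "expectation (\<lambda>z. 1 + r * h z + 3 * s\<^sup>2 * (h z)\<^sup>2)
      = 1 + (r * expectation h + 3 * s\<^sup>2 * expectation (\<lambda>z. (h z)\<^sup>2))"
    using int int_sq by (simp add: prob_space)
  also have "\<dots> \<le> 1 + (r * expectation h + s * expectation h / 2)"
    using mult_left_mono[OF variance, of s] s by (simp add: power2_eq_square)
  also have "\<dots> \<le> exp (r * expectation h + s * expectation h / 2)" by (rule exp_ge_add_one_self)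
  finally show ?thesis by (simp add: ennreal_leI)
qed

lemma bernstein_sample_mean_tail:
  assumes h: "bernstein_cond s h" and s: "0 < s" and r: "\<bar>r\<bar> = s" and \<delta>: "0 < \<delta>"
  shows "holds_with_prob (PiM {..<m} (\<lambda>_. M)) (1 - \<delta>)
    (\<lambda>D. (\<Sum>i<m. r * h (D i)) < real m * (r * expectation h + s * expectation h / 2) + ln (1 / \<delta>))"
proof -
  let ?P = "PiM {..<m} (\<lambda>_. M)" and ?b = "r * expectation h + s * expectation h / 2"
  interpret P: prob_space ?P by (intro prob_space_PiM prob_space_axioms)
  have [measurable]: "h \<in> borel_measurable M" using h by (simp add: bernstein_cond_def)
  have "measure ?P {D \<in> space ?P. real m * ?b + ln (1 / \<delta>) \<le> (\<Sum>i<m. r * h (D i))}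
      \<le> exp (- ln (1 / \<delta>))"
    by (rule product_exp_tail_bound[OF _ bernstein_cond_mgf_le[OF h s r]]) measurable
  also have "\<dots> = \<delta>" using \<delta> by (simp add: exp_minus)
  finally show ?thesis
    by (intro P.holds_with_prob_compl) (simp_all add: not_less)
qed

lemma bernstein_lower_tail:
  assumes h: "bernstein_cond s h" and s: "0 < s" and \<delta>: "0 < \<delta>" and m: "1 \<le> m"
  shows "holds_with_prob (PiM {..<m} (\<lambda>_. M)) (1 - \<delta>)
    (\<lambda>D. expectation h \<le> 2 * sample_mean m D h + 2 * ln (1 / \<delta>) / (s * real m))"
proof (rule holds_with_prob_mono[OF bernstein_sample_mean_tail[OF h s _ \<delta>, of "- s"] order_refl])
  fix D
  assume "(\<Sum>i<m. - s * h (D i))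
      < real m * (- s * expectation h + s * expectation h / 2) + ln (1 / \<delta>)"
  then have "expectation h * (s * real m) \<le> 2 * s * (\<Sum>i<m. h (D i)) + 2 * ln (1 / \<delta>)"
    by (simp add: sum_negf algebra_simps flip: sum_distrib_left)
  then have "expectation h \<le> (2 * s * (\<Sum>i<m. h (D i)) + 2 * ln (1 / \<delta>)) / (s * real m)"
    using s m by (simp add: le_divide_eq)
  also have "\<dots> = 2 * sample_mean m D h + 2 * ln (1 / \<delta>) / (s * real m)"
    using s m by (simp add: sample_mean_def add_divide_distrib)
  finally show "expectation h \<le> 2 * sample_mean m D h + 2 * ln (1 / \<delta>) / (s * real m)" .
qed (use s in simp)

lemma bernstein_upper_tail:
  assumes h: "bernstein_cond s h" and s: "0 < s" and \<delta>: "0 < \<delta>" and m: "1 \<le> m"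
  shows "holds_with_prob (PiM {..<m} (\<lambda>_. M)) (1 - \<delta>)
    (\<lambda>D. sample_mean m D h \<le> 3 / 2 * expectation h + ln (1 / \<delta>) / (s * real m))"
proof (rule holds_with_prob_mono[OF bernstein_sample_mean_tail[OF h s _ \<delta>, of s] order_refl])
  fix D
  assume "(\<Sum>i<m. s * h (D i)) < real m * (s * expectation h + s * expectation h / 2) + ln (1 / \<delta>)"
  then have "s * (\<Sum>i<m. h (D i)) \<le> 3 / 2 * expectation h * (s * real m) + ln (1 / \<delta>)"
    by (simp add: algebra_simps flip: sum_distrib_left)
  then have "s * (\<Sum>i<m. h (D i)) / (s * real m)
      \<le> (3 / 2 * expectation h * (s * real m) + ln (1 / \<delta>)) / (s * real m)"
    using s m by (intro divide_right_mono) auto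
  then show "sample_mean m D h \<le> 3 / 2 * expectation h + ln (1 / \<delta>) / (s * real m)"
    using s m by (simp add: sample_mean_def add_divide_distrib)
qed (use s in simp)

lemma uniform_bernstein:
  assumes T: "finite T" "T \<noteq> {}" "\<And>t. t \<in> T \<Longrightarrow> bernstein_cond s (h t)" and h0: "bernstein_cond s h0"
    and s: "0 < s" and \<delta>: "0 < \<delta>" and m: "1 \<le> m"
  shows "holds_with_prob (PiM {..<m} (\<lambda>_. M)) (1 - \<delta>) (\<lambda>D.
    (\<forall>t\<in>T. expectation (h t)
      \<le> 2 * sample_mean m D (h t) + 2 * ln (2 * real (card T) / \<delta>) / (s * real m)) \<and>
    sample_mean m D h0 \<le> 3 / 2 * expectation h0 + ln (2 / \<delta>) / (s * real m))"
proof -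
  let ?P = "PiM {..<m} (\<lambda>_. M)" and ?a = "\<delta> / (2 * real (card T))"
  interpret P: prob_space ?P by (intro prob_space_PiM prob_space_axioms)
  have T_pos: "0 < card T" using T by (simp add: card_gt_0_iff)
  then have a: "0 < ?a" using \<delta> by simp
  have "holds_with_prob ?P (1 - (real (card T) * ?a + \<delta> / 2)) (\<lambda>D.
      (\<forall>t\<in>T. expectation (h t) \<le> 2 * sample_mean m D (h t) + 2 * ln (1 / ?a) / (s * real m)) \<and>
      sample_mean m D h0 \<le> 3 / 2 * expectation h0 + ln (1 / (\<delta> / 2)) / (s * real m))"
    using \<delta> by (intro P.holds_with_prob_conj P.holds_with_prob_ball T(1)
        bernstein_lower_tail[OF T(3) s a m] bernstein_upper_tail[OF h0 s _ m]) auto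
  then show ?thesis using T_pos by simp
qed

end

section \<open>The data distribution\<close>

lemma sets_unit_cube [measurable]: "unit_cube \<in> sets (borel :: (real^'d) measure)"
  by (simp add: unit_cube_eq_cbox)

lemma borel_measurable_cube_extension:
  fixes f :: "real^'d \<Rightarrow> real"
  assumes "continuous_on unit_cube f"
  shows "(\<lambda>x. indicat_real unit_cube x * f x) \<in> borel_measurable borel"
  using borel_measurable_continuous_on_indicator[OF sets_unit_cube assms] by simp

lemma hoelder_class_cube_extension:
  fixes f :: "real^'d \<Rightarrow> real"
  assumes "hoelder_class r c unit_cube f"
  defines "g \<equiv> \<lambda>x. indicat_real unit_cube x * f x"
  obtains u v where "r = real u + v" "0 < v" "hoelder_smooth u v c unit_cube g"
    "g \<in> borel_measurable borel"
proof -
  obtain u v where r: "r = real u + v" "0 < v" and f: "hoelder_smooth u v c unit_cube f"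
    using assms(1) by (rule hoelder_class_imp_smooth)
  have "hoelder_smooth u v c unit_cube g"
    by (rule hoelder_smooth_cong[OF _ f]) (simp add: g_def)
  moreover have "g \<in> borel_measurable borel"
    using hoelder_smooth_continuous_on[OF f[unfolded unit_cube_eq_cbox] r(2)]
    unfolding g_def by (intro borel_measurable_cube_extension) (simp add: unit_cube_eq_cbox)
  ultimately show ?thesis using r that by blast
qed

definition labelled_sample :: "nat \<Rightarrow> (nat \<Rightarrow> (real^'d) \<times> real) \<Rightarrow> bool" where
  "labelled_sample m D \<longleftrightarrow> (\<forall>i<m. fst (D i) \<in> unit_cube \<and> snd (D i) \<in> {- 1, 1})"

locale classification =
  fixes \<rho>X :: "(real^'d) measure" and \<eta> :: "real^'d \<Rightarrow> real"
  assumes prob_\<rho>X: "prob_space \<rho>X"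
    and sets_\<rho>X [measurable_cong]: "sets \<rho>X = sets borel"
    and cube_full: "measure \<rho>X unit_cube = 1"
    and eta_measurable [measurable]: "\<eta> \<in> borel_measurable borel"
    and eta_nonneg: "x \<in> unit_cube \<Longrightarrow> 0 \<le> \<eta> x"
    and eta_le_1: "x \<in> unit_cube \<Longrightarrow> \<eta> x \<le> 1"
begin

sublocale X: prob_space \<rho>X by (rule prob_\<rho>X)

abbreviation Y :: "real measure" where "Y \<equiv> count_space {- 1, 1}"

abbreviation \<rho> :: "((real^'d) \<times> real) measure" where "\<rho> \<equiv> rho_meas \<rho>X \<eta>"

lemma space_\<rho>X [simp]: "space \<rho>X = UNIV"
  using sets_eq_imp_space_eq[OF sets_\<rho>X] by simp

lemma AE_cubeI: "(\<And>x. x \<in> unit_cube \<Longrightarrow> P x) \<Longrightarrow> AE x in \<rho>X. P x"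
  using X.AE_in_set_eq_1[of unit_cube] cube_full by (auto simp: sets_\<rho>X elim: eventually_mono)

lemma sets_\<rho> [measurable_cong]: "sets \<rho> = sets (borel \<Otimes>\<^sub>M Y)"
  unfolding rho_meas_def sets_density by (rule sets_pair_measure_cong[OF sets_\<rho>X refl])

lemma space_\<rho>: "space \<rho> = UNIV \<times> {- 1, 1}"
  using sets_eq_imp_space_eq[OF sets_\<rho>] by (simp add: space_pair_measure)

lemma label_measurable [measurable]: "snd \<in> borel_measurable (borel \<Otimes>\<^sub>M Y)"
  by (rule measurable_compose[OF measurable_snd]) simp

definition label_weight :: "(real^'d) \<times> real \<Rightarrow> real" where
  "label_weight z = max 0 (if snd z = 1 then \<eta> (fst z) else 1 - \<eta> (fst z))"

lemma label_weight_measurable [measurable]: "label_weight \<in> borel_measurable (borel \<Otimes>\<^sub>M Y)"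
  unfolding label_weight_def[abs_def] by measurable

lemma label_weight_nonneg: "0 \<le> label_weight z"
  by (simp add: label_weight_def)

lemma label_weight_cube:
  "x \<in> unit_cube \<Longrightarrow> label_weight (x, 1) = \<eta> x"
  "x \<in> unit_cube \<Longrightarrow> label_weight (x, - 1) = 1 - \<eta> x"
  using eta_nonneg[of x] eta_le_1[of x] by (auto simp: label_weight_def)

lemma \<rho>_eq_density: "\<rho> = density (\<rho>X \<Otimes>\<^sub>M Y) (\<lambda>z. ennreal (label_weight z))"
  by (simp add: rho_meas_def label_weight_def[abs_def] ennreal_max_0' max.commute)

lemma finite_measure_Y: "finite_measure Y"
  by (rule finite_measure_count_space) simp

lemma pair_sigma_finite_\<rho>X_Y: "pair_sigma_finite \<rho>X Y"
  by (intro pair_sigma_finite.intro X.sigma_finite_measure_axioms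
      finite_measure.axioms(1)[OF finite_measure_Y])

sublocale Z: prob_space \<rho>
proof (rule prob_spaceI)
  interpret pair_sigma_finite \<rho>X Y by (rule pair_sigma_finite_\<rho>X_Y)
  have "emeasure \<rho> (space \<rho>) = (\<integral>\<^sup>+z. ennreal (label_weight z) \<partial>(\<rho>X \<Otimes>\<^sub>M Y))"
    unfolding \<rho>_eq_density by (subst emeasure_density) (auto intro!: nn_integral_cong)
  also have "\<dots> = (\<integral>\<^sup>+x. \<integral>\<^sup>+y. ennreal (label_weight (x, y)) \<partial>Y \<partial>\<rho>X)"
    by (rule M2.nn_integral_fst[symmetric]) measurable
  also have "\<dots> = (\<integral>\<^sup>+x. 1 \<partial>\<rho>X)"
  proof (intro nn_integral_cong_AE AE_cubeI)
    fix x :: "real^'d" assume x: "x \<in> unit_cube"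
    show "(\<integral>\<^sup>+y. ennreal (label_weight (x, y)) \<partial>Y) = 1"
      using eta_nonneg[OF x] eta_le_1[OF x]
      by (subst nn_integral_count_space_finite)
        (auto simp: label_weight_cube[OF x] simp flip: ennreal_plus)
  qed
  finally show "emeasure \<rho> (space \<rho>) = 1" using X.emeasure_space_1 by simp
qed

lemma AE_\<rho>_cube: "AE z in \<rho>. fst z \<in> unit_cube"
proof -
  interpret pair_sigma_finite \<rho>X Y by (rule pair_sigma_finite_\<rho>X_Y)
  have "AE z in \<rho>X \<Otimes>\<^sub>M Y. fst z \<in> unit_cube"
    by (rule AE_pair_measure) (measurable, auto intro: AE_cubeI)
  then show ?thesis
    unfolding \<rho>_eq_density by (subst AE_density) auto
qed

lemma AE_\<rho>_cubeI:
  assumes "\<And>x y. x \<in> unit_cube \<Longrightarrow> y \<in> {- 1, 1} \<Longrightarrow> P (x, y)"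
  shows "AE z in \<rho>. P z"
  using AE_\<rho>_cube AE_space by eventually_elim (use assms in \<open>auto simp: space_\<rho>\<close>)

lemma section_measurable:
  assumes "g \<in> borel_measurable (borel \<Otimes>\<^sub>M Y)" "y \<in> {- 1, 1}"
  shows "(\<lambda>x. g (x, y)) \<in> borel_measurable borel"
  by (rule measurable_compose[OF measurable_Pair assms(1)]) (use assms(2) in auto)

lemma integral_\<rho>:
  fixes g :: "(real^'d) \<times> real \<Rightarrow> real"
  assumes g: "integrable \<rho> g"
  shows "(\<integral>z. g z \<partial>\<rho>) = (\<integral>x. \<eta> x * g (x, 1) + (1 - \<eta> x) * g (x, - 1) \<partial>\<rho>X)"
proof -
  interpret pair_sigma_finite \<rho>X Y by (rule pair_sigma_finite_\<rho>X_Y)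
  have [measurable]: "g \<in> borel_measurable (borel \<Otimes>\<^sub>M Y)"
    using borel_measurable_integrable[OF g] by measurable
  note [measurable] = section_measurable[of g 1] section_measurable[of g "- 1"]
    section_measurable[OF label_weight_measurable, of 1]
    section_measurable[OF label_weight_measurable, of "- 1"]
  have int: "integrable (\<rho>X \<Otimes>\<^sub>M Y) (\<lambda>z. label_weight z * g z)"
    using g unfolding \<rho>_eq_density
    by (subst (asm) integrable_density) (auto simp: label_weight_nonneg)
  have "(\<integral>z. g z \<partial>\<rho>) = (\<integral>z. label_weight z * g z \<partial>(\<rho>X \<Otimes>\<^sub>M Y))"
    unfolding \<rho>_eq_density by (subst integral_density) (auto simp: label_weight_nonneg)
  also have "\<dots> = (\<integral>x. \<integral>y. label_weight (x, y) * g (x, y) \<partial>Y \<partial>\<rho>X)"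
    by (rule integral_fst'[OF int, symmetric])
  also have "\<dots> = (\<integral>x. label_weight (x, 1) * g (x, 1) + label_weight (x, - 1) * g (x, - 1) \<partial>\<rho>X)"
    by (subst lebesgue_integral_count_space_finite) (auto simp: add.commute)
  also have "\<dots> = (\<integral>x. \<eta> x * g (x, 1) + (1 - \<eta> x) * g (x, - 1) \<partial>\<rho>X)"
  proof (rule Bochner_Integration.integral_cong_AE)
    show "AE x in \<rho>X. label_weight (x, 1) * g (x, 1) + label_weight (x, - 1) * g (x, - 1)
        = \<eta> x * g (x, 1) + (1 - \<eta> x) * g (x, - 1)"
      by (rule AE_cubeI) (simp add: label_weight_cube)
  qed (auto intro!: borel_measurable_times borel_measurable_add)
  finally show ?thesis .
qed

lemma AE_labelled_sample: "AE D in PiM {..<m} (\<lambda>_. \<rho>). labelled_sample m D"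
proof -
  have "AE D in PiM {..<m} (\<lambda>_. \<rho>). \<forall>i\<in>{..<m}. fst (D i) \<in> unit_cube \<and> snd (D i) \<in> {- 1, 1}"
    by (intro AE_finite_allI finite_lessThan AE_PiM_component[OF Z.prob_space_axioms])
      (auto intro!: AE_\<rho>_cubeI)
  then show ?thesis by (rule eventually_mono) (simp add: labelled_sample_def)
qed

end

section \<open>Excess risk and squared distance to the target\<close>

locale learning_problem = smooth_loss \<phi> \<phi>' L \<mu> + classification \<rho>X \<eta>
  for \<phi> \<phi>' :: "real \<Rightarrow> real" and L \<mu> :: real and \<rho>X :: "(real^'d) measure"
    and \<eta> :: "real^'d \<Rightarrow> real" +
  fixes f :: "real^'d \<Rightarrow> real"
  assumes f_measurable [measurable]: "f \<in> borel_measurable borel"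
    and f_minimizer: "x \<in> unit_cube \<Longrightarrow> phi_minimizer \<phi> (\<eta> x) (f x)"
    and f_outside: "x \<notin> unit_cube \<Longrightarrow> f x = 0"
begin

lemma f_abs_le: "\<bar>f x\<bar> \<le> indicat_real unit_cube x"
  using phi_minimizer_abs_le_1[OF eta_nonneg eta_le_1 f_minimizer] f_outside
  by (cases "x \<in> unit_cube") auto

lemma f_abs_le_1: "\<bar>f x\<bar> \<le> 1"
  by (rule order_trans[OF f_abs_le indicator_le_1])

definition excess_loss :: "(real^'d \<Rightarrow> real) \<Rightarrow> (real^'d) \<times> real \<Rightarrow> real" where
  "excess_loss g z = \<phi> (snd z * g (fst z)) - \<phi> (snd z * f (fst z))"

definition sq_dist :: "(real^'d \<Rightarrow> real) \<Rightarrow> real" where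
  "sq_dist g = (\<integral>x. (g x - f x)\<^sup>2 \<partial>\<rho>X)"

lemma excess_loss_measurable [measurable]:
  assumes [measurable]: "g \<in> borel_measurable borel"
  shows "excess_loss g \<in> borel_measurable (borel \<Otimes>\<^sub>M Y)"
  unfolding excess_loss_def[abs_def] by measurable

lemma excess_loss_diff_le:
  assumes y: "y \<in> {- 1, 1}" and M: "0 \<le> M" "\<bar>g x\<bar> \<le> M" "\<bar>h x\<bar> \<le> M"
  shows "\<bar>excess_loss g (x, y) - excess_loss h (x, y)\<bar> \<le> lip_const M * \<bar>g x - h x\<bar>"
proof -
  have "\<bar>\<phi> (y * g x) - \<phi> (y * h x)\<bar> \<le> lip_const M * \<bar>y * g x - y * h x\<bar>"
    by (rule loss_lipschitz) (use y M in auto)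
  also have "\<bar>y * g x - y * h x\<bar> = \<bar>g x - h x\<bar>" using y by auto
  finally show ?thesis by (simp add: excess_loss_def)
qed

context
  fixes g :: "real^'d \<Rightarrow> real" and M :: real
  assumes g_measurable [measurable]: "g \<in> borel_measurable borel"
    and M: "1 \<le> M" and g_abs_le: "\<And>x. \<bar>g x\<bar> \<le> M"
begin

lemma excess_loss_abs_le_distance:
  assumes "y \<in> {- 1, 1}"
  shows "\<bar>excess_loss g (x, y)\<bar> \<le> lip_const M * \<bar>g x - f x\<bar>"
proof -
  have "\<bar>f x\<bar> \<le> M" using f_abs_le_1[of x] M by linarith
  then have "\<bar>excess_loss g (x, y) - excess_loss f (x, y)\<bar> \<le> lip_const M * \<bar>g x - f x\<bar>"
    using assms M g_abs_le by (intro excess_loss_diff_le) auto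
  then show ?thesis by (simp add: excess_loss_def)
qed

lemma distance_le: "\<bar>g x - f x\<bar> \<le> 2 * M"
  using g_abs_le[of x] f_abs_le_1[of x] M by linarith

lemma excess_loss_abs_le: "y \<in> {- 1, 1} \<Longrightarrow> \<bar>excess_loss g (x, y)\<bar> \<le> lip_const M * (2 * M)"
  using excess_loss_abs_le_distance[of y x] mult_left_mono[OF distance_le[of x], of "lip_const M"]
    lip_const_pos[of M] M by linarith

lemma integrable_sq_distance: "integrable \<rho>X (\<lambda>x. (g x - f x)\<^sup>2)"
proof (rule X.integrable_const_bound[of _ "(2 * M)\<^sup>2"])
  have "(g x - f x)\<^sup>2 \<le> (2 * M)\<^sup>2" for x
    using power_mono[OF distance_le abs_ge_zero, of x 2] by simp
  then show "AE x in \<rho>X. norm ((g x - f x)\<^sup>2) \<le> (2 * M)\<^sup>2" by simp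
qed measurable

lemma integrable_excess_loss: "integrable \<rho> (excess_loss g)"
proof (rule Z.integrable_const_bound)
  show "AE z in \<rho>. norm (excess_loss g z) \<le> lip_const M * (2 * M)"
    by (rule AE_\<rho>_cubeI) (use excess_loss_abs_le in auto)
qed measurable

lemma integrable_excess_loss_sq: "integrable \<rho> (\<lambda>z. (excess_loss g z)\<^sup>2)"
proof (rule Z.integrable_const_bound[of _ "(lip_const M * (2 * M))\<^sup>2"])
  show "AE z in \<rho>. norm ((excess_loss g z)\<^sup>2) \<le> (lip_const M * (2 * M))\<^sup>2"
  proof (rule AE_\<rho>_cubeI)
    fix x :: "real^'d" and y :: real assume "y \<in> {- 1, 1}"
    from power_mono[OF excess_loss_abs_le[OF this] abs_ge_zero, of x 2]
    show "norm ((excess_loss g (x, y))\<^sup>2) \<le> (lip_const M * (2 * M))\<^sup>2" by simp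
  qed
qed measurable

lemma expectation_excess_loss:
  "Z.expectation (excess_loss g) = (\<integral>x. cond_risk (\<eta> x) (g x) - cond_risk (\<eta> x) (f x) \<partial>\<rho>X)"
  unfolding integral_\<rho>[OF integrable_excess_loss]
  by (intro Bochner_Integration.integral_cong)
    (auto simp: excess_loss_def cond_risk_def algebra_simps)

lemma
  shows expectation_excess_loss_ge: "2 * \<mu> * sq_dist g \<le> Z.expectation (excess_loss g)"
    and expectation_excess_loss_le: "Z.expectation (excess_loss g) \<le> L * sq_dist g"
proof -
  let ?e = "\<lambda>x. cond_risk (\<eta> x) (g x) - cond_risk (\<eta> x) (f x)" and ?d = "\<lambda>x. (g x - f x)\<^sup>2"
  have [measurable]: "?e \<in> borel_measurable borel" unfolding cond_risk_def by measurable
  have lower: "2 * \<mu> * ?d x \<le> ?e x" and upper: "?e x \<le> L * ?d x" if "x \<in> unit_cube" for x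
    using cond_excess_risk_ge cond_excess_risk_le eta_nonneg eta_le_1 f_minimizer that by auto
  have d: "integrable \<rho>X (\<lambda>x. c * ?d x)" for c
    using integrable_sq_distance by (rule integrable_mult_right)
  have e: "integrable \<rho>X ?e"
  proof (rule Bochner_Integration.integrable_bound[OF d[of L]])
    show "AE x in \<rho>X. norm (?e x) \<le> norm (L * ?d x)"
    proof (rule AE_cubeI)
      fix x :: "real^'d" assume x: "x \<in> unit_cube"
      have "0 \<le> 2 * \<mu> * ?d x" using \<mu>_pos by simp
      then show "norm (?e x) \<le> norm (L * ?d x)"
        using lower[OF x] upper[OF x] unfolding real_norm_def by linarith
    qed
  qed measurable
  have "(\<integral>x. 2 * \<mu> * ?d x \<partial>\<rho>X) \<le> (\<integral>x. ?e x \<partial>\<rho>X)"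
    by (rule integral_mono_AE[OF d e]) (rule AE_cubeI[OF lower])
  then show "2 * \<mu> * sq_dist g \<le> Z.expectation (excess_loss g)"
    unfolding expectation_excess_loss sq_dist_def by simp
  have "(\<integral>x. ?e x \<partial>\<rho>X) \<le> (\<integral>x. L * ?d x \<partial>\<rho>X)"
    by (rule integral_mono_AE[OF e d]) (rule AE_cubeI[OF upper])
  then show "Z.expectation (excess_loss g) \<le> L * sq_dist g"
    unfolding expectation_excess_loss sq_dist_def by simp
qed

lemma expectation_excess_loss_nonneg: "0 \<le> Z.expectation (excess_loss g)"
proof -
  have "0 \<le> 2 * \<mu> * sq_dist g" using \<mu>_pos by (simp add: sq_dist_def)
  then show ?thesis using expectation_excess_loss_ge by linarith
qed

lemma expectation_excess_loss_sq_le: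
  "Z.expectation (\<lambda>z. (excess_loss g z)\<^sup>2)
    \<le> (lip_const M)\<^sup>2 / (2 * \<mu>) * Z.expectation (excess_loss g)"
proof -
  let ?v = "\<lambda>x. \<eta> x * (excess_loss g (x, 1))\<^sup>2 + (1 - \<eta> x) * (excess_loss g (x, - 1))\<^sup>2"
  let ?d = "\<lambda>x. (lip_const M)\<^sup>2 * (g x - f x)\<^sup>2"
  note [measurable] = section_measurable[OF excess_loss_measurable[OF g_measurable], of 1]
    section_measurable[OF excess_loss_measurable[OF g_measurable], of "- 1"]
  have sq: "(excess_loss g (x, y))\<^sup>2 \<le> ?d x" if "y \<in> {- 1, 1}" for x y
    using power_mono[OF excess_loss_abs_le_distance[OF that] abs_ge_zero, of x 2]
    by (simp add: power_mult_distrib)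
  have v: "0 \<le> ?v x" "?v x \<le> ?d x" if x: "x \<in> unit_cube" for x
  proof -
    have "?v x \<le> \<eta> x * ?d x + (1 - \<eta> x) * ?d x"
      using eta_nonneg[OF x] eta_le_1[OF x] by (intro add_mono mult_left_mono sq) auto
    then show "?v x \<le> ?d x" by (simp add: left_diff_distrib)
    show "0 \<le> ?v x" using eta_nonneg[OF x] eta_le_1[OF x] by simp
  qed
  have d: "integrable \<rho>X ?d" using integrable_sq_distance by (rule integrable_mult_right)
  have int: "integrable \<rho>X ?v"
  proof (rule Bochner_Integration.integrable_bound[OF d])
    show "AE x in \<rho>X. norm (?v x) \<le> norm (?d x)" by (rule AE_cubeI) (use v in fastforce)
  qed (auto intro!: borel_measurable_add borel_measurable_times)
  have "Z.expectation (\<lambda>z. (excess_loss g z)\<^sup>2) = (\<integral>x. ?v x \<partial>\<rho>X)"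
    by (rule integral_\<rho>[OF integrable_excess_loss_sq])
  also have "\<dots> \<le> (\<integral>x. ?d x \<partial>\<rho>X)"
    by (rule integral_mono_AE[OF int d]) (rule AE_cubeI[OF v(2)])
  also have "\<dots> = (lip_const M)\<^sup>2 * sq_dist g" by (simp add: sq_dist_def)
  also have "\<dots> \<le> (lip_const M)\<^sup>2 * (Z.expectation (excess_loss g) / (2 * \<mu>))"
    using expectation_excess_loss_ge \<mu>_pos by (intro mult_left_mono) (auto simp: field_simps)
  finally show ?thesis by simp
qed

end

definition bernstein_rate :: "real \<Rightarrow> real" where
  "bernstein_rate M = min (1 / (lip_const M * (2 * M))) (\<mu> / (3 * (lip_const M)\<^sup>2))"

lemma bernstein_rate_pos: "1 \<le> M \<Longrightarrow> 0 < bernstein_rate M"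
  using lip_const_pos[of M] \<mu>_pos by (simp add: bernstein_rate_def)

lemma bernstein_cond_excess_loss:
  assumes g [measurable]: "g \<in> borel_measurable borel" and M: "1 \<le> M" and g_abs: "\<And>x. \<bar>g x\<bar> \<le> M"
    and s: "0 < s" "s \<le> bernstein_rate M"
  shows "Z.bernstein_cond s (excess_loss g)"
  unfolding Z.bernstein_cond_def
proof (intro conjI)
  have C: "0 < lip_const M" using lip_const_pos[of M] M by simp
  have s_bounded: "s * (lip_const M * (2 * M)) \<le> 1"
    using s C M by (simp add: bernstein_rate_def field_simps)
  show "AE z in \<rho>. s * \<bar>excess_loss g z\<bar> \<le> 1"
  proof (rule AE_\<rho>_cubeI)
    fix x :: "real^'d" and y :: real assume "y \<in> {- 1, 1}"
    then have "s * \<bar>excess_loss g (x, y)\<bar> \<le> s * (lip_const M * (2 * M))"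
      using s by (intro mult_left_mono excess_loss_abs_le[OF g M g_abs]) auto
    also note s_bounded
    finally show "s * \<bar>excess_loss g (x, y)\<bar> \<le> 1" .
  qed
  have "6 * s * Z.expectation (\<lambda>z. (excess_loss g z)\<^sup>2)
      \<le> 6 * s * ((lip_const M)\<^sup>2 / (2 * \<mu>) * Z.expectation (excess_loss g))"
    using s by (intro mult_left_mono expectation_excess_loss_sq_le[OF g M g_abs]) auto
  also have "\<dots> = (s * (3 * (lip_const M)\<^sup>2) / \<mu>) * Z.expectation (excess_loss g)" by simp
  also have "\<dots> \<le> 1 * Z.expectation (excess_loss g)"
    using s C \<mu>_pos expectation_excess_loss_nonneg[OF g M g_abs]
    by (intro mult_right_mono) (auto simp: bernstein_rate_def field_simps)
  finally show "6 * s * Z.expectation (\<lambda>z. (excess_loss g z)\<^sup>2) \<le> Z.expectation (excess_loss g)"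
    by simp
qed measurable

end

context classification
begin

lemma misclassified_sets:
  assumes [measurable]: "C \<in> borel_measurable borel"
  shows "{z \<in> space \<rho>. C (fst z) \<noteq> snd z} \<in> sets \<rho>"
proof -
  have "(\<lambda>z. C (fst z)) \<in> borel_measurable (borel \<Otimes>\<^sub>M Y)" by measurable
  from borel_measurable_neq[OF this label_measurable] show ?thesis
    unfolding sets_\<rho> sets_eq_imp_space_eq[OF sets_\<rho>] .
qed

lemma risk_eq_integral:
  assumes C: "C \<in> borel_measurable borel"
  shows "risk \<rho> C = (\<integral>x. \<eta> x * of_bool (C x \<noteq> 1) + (1 - \<eta> x) * of_bool (C x \<noteq> - 1) \<partial>\<rho>X)"
proof -
  let ?E = "{z \<in> space \<rho>. C (fst z) \<noteq> snd z}"
  have int: "integrable \<rho> (indicat_real ?E)"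
    using misclassified_sets[OF C] by (simp add: Z.emeasure_finite less_top[symmetric])
  have "risk \<rho> C = Z.expectation (indicat_real ?E)"
    using misclassified_sets[OF C] by (simp add: risk_def)
  also have "\<dots> = (\<integral>x. \<eta> x * of_bool (C x \<noteq> 1) + (1 - \<eta> x) * of_bool (C x \<noteq> - 1) \<partial>\<rho>X)"
    unfolding integral_\<rho>[OF int]
    by (intro Bochner_Integration.integral_cong) (auto simp: indicator_def space_\<rho>)
  finally show ?thesis .
qed

lemma sign_fun_measurable: "g \<in> borel_measurable borel \<Longrightarrow> sign_fun g \<in> borel_measurable borel"
  unfolding sign_fun_def[abs_def] by measurable

lemma bayes_rule_measurable: "bayes_rule \<eta> \<in> borel_measurable borel"
  unfolding bayes_rule_def[abs_def] by measurable

abbreviation excess_risk :: "(real^'d \<Rightarrow> real) \<Rightarrow> real" where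
  "excess_risk g \<equiv> risk \<rho> (sign_fun g) - risk \<rho> (bayes_rule \<eta>)"

lemma excess_risk_eq_integral:
  assumes [measurable]: "g \<in> borel_measurable borel"
  shows "excess_risk g
    = (\<integral>x. \<bar>2 * \<eta> x - 1\<bar> * of_bool ((0 \<le> g x) \<noteq> (1 / 2 \<le> \<eta> x)) \<partial>\<rho>X)"
proof -
  let ?r = "\<lambda>C x. \<eta> x * of_bool (C x \<noteq> (1 :: real)) + (1 - \<eta> x) * of_bool (C x \<noteq> - 1)"
  note [measurable] = sign_fun_measurable[of g] bayes_rule_measurable
  have int: "integrable \<rho>X (?r C)" if [measurable]: "C \<in> borel_measurable borel" for C
  proof (rule X.integrable_const_bound[of _ 1])
    show "AE x in \<rho>X. norm (?r C x) \<le> 1"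
      by (rule AE_cubeI) (use eta_nonneg eta_le_1 in auto)
  qed measurable
  have "excess_risk g = (\<integral>x. ?r (sign_fun g) x - ?r (bayes_rule \<eta>) x \<partial>\<rho>X)"
    using int by (simp add: risk_eq_integral Bochner_Integration.integral_diff)
  also have "\<dots> = (\<integral>x. \<bar>2 * \<eta> x - 1\<bar> * of_bool ((0 \<le> g x) \<noteq> (1 / 2 \<le> \<eta> x)) \<partial>\<rho>X)"
    by (intro Bochner_Integration.integral_cong) (auto simp: sign_fun_def bayes_rule_def)
  finally show ?thesis .
qed

text \<open>The sign of a non-measurable \<open>g\<close> may have the junk risk 0, hence only one inequality.\<close>
lemma risk_sign_fun_le:
  assumes h: "h \<in> borel_measurable borel" and eq: "\<And>x. x \<in> unit_cube \<Longrightarrow> 0 \<le> h x \<longleftrightarrow> 0 \<le> g x"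
  shows "risk \<rho> (sign_fun g) \<le> risk \<rho> (sign_fun h)"
proof (cases "{z \<in> space \<rho>. sign_fun g (fst z) \<noteq> snd z} \<in> sets \<rho>")
  case True
  show ?thesis unfolding risk_def
  proof (rule Z.finite_measure_mono_AE[OF _ misclassified_sets[OF sign_fun_measurable[OF h]]])
    show "AE z in \<rho>. z \<in> {z \<in> space \<rho>. sign_fun g (fst z) \<noteq> snd z} \<longrightarrow>
        z \<in> {z \<in> space \<rho>. sign_fun h (fst z) \<noteq> snd z}"
      by (rule AE_\<rho>_cubeI) (auto simp: sign_fun_def eq)
  qed
next
  case False
  then show ?thesis by (simp add: risk_def measure_notin_sets)
qed

end

context learning_problem
begin

lemma misclassification_margin_le:
  assumes x: "x \<in> unit_cube" and a: "0 < a"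
  shows "\<bar>2 * \<eta> x - 1\<bar> * of_bool ((0 \<le> g x) \<noteq> (1 / 2 \<le> \<eta> x))
    \<le> a * of_bool (\<bar>2 * \<eta> x - 1\<bar> \<le> a) + margin_const\<^sup>2 / a * (g x - f x)\<^sup>2"
proof -
  let ?t = "\<bar>2 * \<eta> x - 1\<bar>" and ?d = "margin_const\<^sup>2 / a * (g x - f x)\<^sup>2"
  have d: "0 \<le> ?d" using a by simp
  consider (correct) "(0 \<le> g x) = (1 / 2 \<le> \<eta> x)"
    | (small_margin) "(0 \<le> g x) \<noteq> (1 / 2 \<le> \<eta> x)" "?t \<le> a"
    | (large_margin) "(0 \<le> g x) \<noteq> (1 / 2 \<le> \<eta> x)" "a < ?t" by linarith
  then show ?thesis
  proof cases
    case correct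
    then show ?thesis using d a by simp
  next
    case small_margin
    then have "?t \<le> a + ?d" using d by linarith
    then show ?thesis using small_margin by simp
  next
    case large_margin
    have "?t \<le> margin_const * \<bar>g x - f x\<bar>"
      by (rule margin_le_distance[OF eta_nonneg[OF x] eta_le_1[OF x] f_minimizer[OF x]
          large_margin(1)])
    then have "?t\<^sup>2 \<le> margin_const\<^sup>2 * (g x - f x)\<^sup>2"
      using power_mono[of ?t "margin_const * \<bar>g x - f x\<bar>" 2] by (simp add: power_mult_distrib)
    moreover have "?t * a \<le> ?t\<^sup>2"
      unfolding power2_eq_square using large_margin(2) by (intro mult_left_mono) auto
    ultimately have "?t \<le> ?d" using a by (simp add: field_simps)
    then show ?thesis using large_margin by simp
  qed
qed

lemma excess_risk_le_margin_split:
  assumes g [measurable]: "g \<in> borel_measurable borel" and g_abs: "\<And>x. \<bar>g x\<bar> \<le> 1" and a: "0 < a"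
  shows "excess_risk g
    \<le> a * X.prob {x \<in> space \<rho>X. \<bar>2 * \<eta> x - 1\<bar> \<le> a} + margin_const\<^sup>2 / a * sq_dist g"
proof -
  let ?S = "{x \<in> space \<rho>X. \<bar>2 * \<eta> x - 1\<bar> \<le> a}" and ?d = "\<lambda>x. margin_const\<^sup>2 / a * (g x - f x)\<^sup>2"
  have S: "?S \<in> X.events" by measurable
  have d: "integrable \<rho>X ?d"
    using integrable_sq_distance[OF g order_refl g_abs] by (rule integrable_mult_right)
  have ind: "integrable \<rho>X (\<lambda>x. a * indicat_real ?S x)"
    using S by (intro integrable_mult_right) (simp add: X.emeasure_finite less_top[symmetric])
  have "excess_risk g
      = (\<integral>x. \<bar>2 * \<eta> x - 1\<bar> * of_bool ((0 \<le> g x) \<noteq> (1 / 2 \<le> \<eta> x)) \<partial>\<rho>X)"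
    by (rule excess_risk_eq_integral[OF g])
  also have "\<dots> \<le> (\<integral>x. a * indicat_real ?S x + ?d x \<partial>\<rho>X)"
  proof (rule integral_mono_AE)
    show "integrable \<rho>X (\<lambda>x. \<bar>2 * \<eta> x - 1\<bar> * of_bool ((0 \<le> g x) \<noteq> (1 / 2 \<le> \<eta> x)))"
    proof (rule X.integrable_const_bound[of _ 1])
      show "AE x in \<rho>X. norm (\<bar>2 * \<eta> x - 1\<bar> * of_bool ((0 \<le> g x) \<noteq> (1 / 2 \<le> \<eta> x))) \<le> 1"
        by (rule AE_cubeI) (use eta_nonneg eta_le_1 in \<open>auto simp: abs_le_iff\<close>)
    qed measurable
    show "AE x in \<rho>X. \<bar>2 * \<eta> x - 1\<bar> * of_bool ((0 \<le> g x) \<noteq> (1 / 2 \<le> \<eta> x))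
        \<le> a * indicat_real ?S x + ?d x"
      by (rule AE_cubeI, rule order_trans[OF misclassification_margin_le[OF _ a]])
        (auto simp: indicator_def)
  qed (use ind d in auto)
  also have "\<dots> = a * X.prob ?S + margin_const\<^sup>2 / a * sq_dist g"
    using ind d S by (subst Bochner_Integration.integral_add) (auto simp: sq_dist_def)
  finally show ?thesis .
qed

lemma excess_risk_le_sq_dist_powr:
  assumes q: "0 \<le> q" and noise: "tsybakov \<rho>X \<eta> q"
  obtains K where "0 < K"
    and "\<And>g A. g \<in> borel_measurable borel \<Longrightarrow> (\<And>x. \<bar>g x\<bar> \<le> 1) \<Longrightarrow> 0 < A \<Longrightarrow> sq_dist g \<le> A \<Longrightarrow>
      excess_risk g \<le> K * A powr ((q + 1) / (q + 2))"
proof -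
  obtain c where c: "0 < c"
    and margin: "\<And>t. 0 < t \<Longrightarrow> X.prob {x \<in> space \<rho>X. \<bar>2 * \<eta> x - 1\<bar> \<le> c * t} \<le> t powr q"
    using noise unfolding tsybakov_def by blast
  let ?K = "c + margin_const\<^sup>2 / c"
  show ?thesis
  proof (rule that[of ?K])
    show "0 < ?K" using c by (simp add: add_pos_nonneg)
    fix g A assume g: "g \<in> borel_measurable borel" "\<And>x. \<bar>g x\<bar> \<le> 1" and A: "0 < A" "sq_dist g \<le> A"
    define t where "t = A powr (1 / (q + 2))"
    have t: "0 < t" using A by (simp add: t_def)
    have "A = t powr (q + 2)" using A q by (simp add: t_def powr_powr)
    then have balance: "A / t = t powr (q + 1)"
      using t powr_diff[of t "q + 2" 1] by (simp add: add.commute)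
    have "excess_risk g
        \<le> c * t * X.prob {x \<in> space \<rho>X. \<bar>2 * \<eta> x - 1\<bar> \<le> c * t}
          + margin_const\<^sup>2 / (c * t) * sq_dist g"
      using c t by (intro excess_risk_le_margin_split[OF g]) simp
    also have "\<dots> \<le> c * t * t powr q + margin_const\<^sup>2 / (c * t) * A"
      using c t A(2) margin[OF t] by (intro add_mono mult_left_mono) auto
    also have "\<dots> = c * (t * t powr q) + margin_const\<^sup>2 / c * (A / t)" by simp
    also have "t * t powr q = t powr (q + 1)"
      using t by (subst powr_mult_base) (simp_all add: add.commute)
    also have "c * t powr (q + 1) + margin_const\<^sup>2 / c * (A / t) = ?K * t powr (q + 1)"
      unfolding balance by (simp add: distrib_right)
    also have "t powr (q + 1) = A powr ((q + 1) / (q + 2))" by (simp add: t_def powr_powr)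
    finally show "excess_risk g \<le> ?K * A powr ((q + 1) / (q + 2))" .
  qed
qed

end

section \<open>Oracle inequality for the truncated estimator\<close>

definition truncate :: "(real^'d \<Rightarrow> real) \<Rightarrow> real^'d \<Rightarrow> real" where
  "truncate g x = indicat_real unit_cube x * clip (g x)"

lemma truncate_cube: "x \<in> unit_cube \<Longrightarrow> truncate g x = clip (g x)"
  by (simp add: truncate_def)

lemma truncate_abs_le: "\<bar>truncate g x\<bar> \<le> 1"
  using abs_clip_le[of "g x"] by (auto simp: truncate_def indicator_def)

lemma truncate_diff_le: "x \<in> unit_cube \<Longrightarrow> \<bar>truncate g x - truncate h x\<bar> \<le> \<bar>g x - h x\<bar>"
  by (simp add: truncate_cube clip_diff_le)

lemma truncate_measurable: "continuous_on unit_cube g \<Longrightarrow> truncate g \<in> borel_measurable borel"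
  unfolding truncate_def[abs_def] by (intro borel_measurable_cube_extension continuous_on_clip)

lemma gauss_rkhs_ball_truncate_measurable:
  "0 < \<sigma> \<Longrightarrow> g \<in> rkhs_ball (gauss_kernel \<sigma>) unit_cube B \<Longrightarrow> truncate g \<in> borel_measurable borel"
  by (intro truncate_measurable gauss_rkhs_ball_continuous_on)

context learning_problem
begin

lemma erm_in_rkhs_ball:
  assumes erm: "erm_solution \<phi> K X lam m D g" and lam: "0 < lam" and m: "1 \<le> m"
  shows "g \<in> rkhs_ball K X (sqrt (\<phi> 0 / lam))"
proof -
  have "in_rkhs K X (\<lambda>_. 0)" by (simp add: in_rkhs_def rkhs_norm_sq_zero)
  then have "reg_objective \<phi> K X lam m D g \<le> reg_objective \<phi> K X lam m D (\<lambda>_. 0)"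
    using erm by (simp add: erm_solution_def)
  also have "\<dots> = \<phi> 0" using m by (simp add: reg_objective_def rkhs_norm_sq_zero)
  finally have objective: "reg_objective \<phi> K X lam m D g \<le> \<phi> 0" .
  have "0 \<le> 1 / real m * (\<Sum>i<m. \<phi> (snd (D i) * g (fst (D i))))"
    using loss_nonneg by (simp add: sum_nonneg)
  then have "lam * real_of_ereal (rkhs_norm_sq K X g) \<le> \<phi> 0"
    using objective unfolding reg_objective_def by linarith
  then show ?thesis
    using erm lam loss_nonneg[of 0]
    by (simp add: rkhs_ball_iff_real_norm_le erm_solution_def le_divide_eq mult.commute)
qed

lemma erm_truncate_sample_mean_le:
  assumes erm: "erm_solution \<phi> K X lam m D g" and lam: "0 < lam"
    and D: "labelled_sample m D" and f0: "f0 \<in> rkhs_ball K X B"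
  shows "sample_mean m D (excess_loss (truncate g)) \<le> sample_mean m D (excess_loss f0) + lam * B\<^sup>2"
proof -
  let ?S = "\<lambda>h. (\<Sum>i<m. \<phi> (snd (D i) * h (fst (D i)))) / real m"
  let ?n = "\<lambda>h. real_of_ereal (rkhs_norm_sq K X h)"
  have sample_mean: "sample_mean m D (excess_loss h) = ?S h - ?S f" for h
    by (simp add: sample_mean_def excess_loss_def sum_subtractf diff_divide_distrib)
  have f0: "in_rkhs K X f0" "?n f0 \<le> B\<^sup>2" using f0 by (simp_all add: rkhs_ball_iff_real_norm_le)
  have "?S (truncate g) \<le> ?S g"
  proof (intro divide_right_mono sum_mono)
    fix i assume "i \<in> {..<m}"
    then show "\<phi> (snd (D i) * truncate g (fst (D i))) \<le> \<phi> (snd (D i) * g (fst (D i)))"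
      using D by (simp add: labelled_sample_def truncate_cube mult_clip loss_clip_le)
  qed simp
  also have "\<dots> \<le> ?S g + lam * ?n g"
    using lam by (simp add: real_of_ereal_pos rkhs_norm_sq_nonneg)
  also have "\<dots> \<le> ?S f0 + lam * ?n f0"
    using erm f0(1) by (simp add: erm_solution_def reg_objective_def)
  also have "\<dots> \<le> ?S f0 + lam * B\<^sup>2"
    using f0(2) lam by simp
  finally show ?thesis unfolding sample_mean by simp
qed

lemma expectation_excess_loss_net_le:
  assumes g: "g \<in> borel_measurable borel" "\<And>x. \<bar>g x\<bar> \<le> 1"
    and h: "h \<in> borel_measurable borel" "\<And>x. \<bar>h x\<bar> \<le> 1"
    and close: "\<And>x. x \<in> unit_cube \<Longrightarrow> \<bar>g x - h x\<bar> \<le> e"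
  shows "Z.expectation (excess_loss g) \<le> Z.expectation (excess_loss h) + lip_const 1 * e"
proof -
  note int = integrable_excess_loss[OF g(1) order_refl g(2)]
      integrable_excess_loss[OF h(1) order_refl h(2)]
  have "Z.expectation (excess_loss g) \<le> Z.expectation (\<lambda>z. excess_loss h z + lip_const 1 * e)"
  proof (rule integral_mono_AE)
    show "AE z in \<rho>. excess_loss g z \<le> excess_loss h z + lip_const 1 * e"
    proof (rule AE_\<rho>_cubeI)
      fix x :: "real^'d" and y :: real assume x: "x \<in> unit_cube" and y: "y \<in> {- 1, 1}"
      have "lip_const 1 * \<bar>g x - h x\<bar> \<le> lip_const 1 * e"
        using close[OF x] lip_const_pos[of 1] by simp
      then show "excess_loss g (x, y) \<le> excess_loss h (x, y) + lip_const 1 * e"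
        using excess_loss_diff_le[OF y, of 1 g x h] g h by simp
    qed
  qed (use int in auto)
  also have "\<dots> = Z.expectation (excess_loss h) + lip_const 1 * e"
    using int(2) Z.prob_space by simp
  finally show ?thesis .
qed

lemma sample_mean_excess_loss_net_le:
  assumes g: "\<And>x. \<bar>g x\<bar> \<le> 1" and h: "\<And>x. \<bar>h x\<bar> \<le> 1" and m: "1 \<le> m"
    and D: "labelled_sample m D"
    and close: "\<And>x. x \<in> unit_cube \<Longrightarrow> \<bar>g x - h x\<bar> \<le> e"
  shows "sample_mean m D (excess_loss h) \<le> sample_mean m D (excess_loss g) + lip_const 1 * e"
proof -
  have "excess_loss h (D i) \<le> excess_loss g (D i) + lip_const 1 * e" if i: "i < m" for i
  proof -
    have sample: "fst (D i) \<in> unit_cube" "snd (D i) \<in> {- 1, 1}"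
      using D i by (auto simp: labelled_sample_def)
    have "lip_const 1 * \<bar>g (fst (D i)) - h (fst (D i))\<bar> \<le> lip_const 1 * e"
      using close sample lip_const_pos[of 1] by simp
    then show ?thesis
      using excess_loss_diff_le[of "snd (D i)" 1 g "fst (D i)" h] g h sample by simp
  qed
  then have "(\<Sum>i<m. excess_loss h (D i)) \<le> (\<Sum>i<m. excess_loss g (D i) + lip_const 1 * e)"
    by (intro sum_mono) simp
  then show ?thesis
    using m by (simp add: sample_mean_def sum.distrib field_simps)
qed

lemma sq_dist_le:
  assumes g: "g \<in> borel_measurable borel" "1 \<le> M" "\<And>x. \<bar>g x\<bar> \<le> M"
    and close: "\<And>x. x \<in> unit_cube \<Longrightarrow> \<bar>g x - f x\<bar> \<le> e"
  shows "sq_dist g \<le> e\<^sup>2"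
  unfolding sq_dist_def
proof (rule X.integral_le_const[OF integrable_sq_distance[OF g]])
  show "AE x in \<rho>X. (g x - f x)\<^sup>2 \<le> e\<^sup>2"
    by (rule AE_cubeI) (use power_mono[OF close abs_ge_zero, of _ 2] in simp)
qed

end

lemma one_le_ln_4_div:
  fixes \<delta> :: real
  assumes "0 < \<delta>" "\<delta> < 1"
  shows "1 \<le> ln (4 / \<delta>)"
proof -
  have "exp 1 \<le> (3 :: real)" by (rule exp_le)
  also have "3 \<le> 4 / \<delta>" using assms by (simp add: field_simps)
  finally show ?thesis using assms by (subst ln_ge_iff) auto
qed

lemma confidence_terms_le:
  fixes N \<delta> :: real
  assumes N: "1 \<le> N" and \<delta>: "0 < \<delta>" "\<delta> < 1"
  shows "2 * ln (2 * N / \<delta>) + 2 * ln (2 / \<delta>) \<le> (2 * ln N + 4) * ln (4 / \<delta>)"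
proof -
  have "ln (2 * N / \<delta>) = ln N + ln (2 / \<delta>)"
    using N \<delta> ln_mult[of N "2 / \<delta>"] by (simp add: mult.commute)
  moreover have "ln (2 / \<delta>) \<le> ln (4 / \<delta>)"
    using \<delta> by (intro ln_mono) (auto simp: divide_right_mono)
  moreover have "ln N * 1 \<le> ln N * ln (4 / \<delta>)"
    using N \<delta> by (intro mult_left_mono one_le_ln_4_div) auto
  ultimately show ?thesis by (simp add: distrib_right)
qed

context learning_problem
begin

lemma sample_space_eq: "sample_space \<rho>X \<eta> m = PiM {..<m} (\<lambda>_. \<rho>)"
  by (simp add: sample_space_def)

definition small_deviations ::
    "nat \<Rightarrow> (real^'d \<Rightarrow> real) set \<Rightarrow> (real^'d \<Rightarrow> real) \<Rightarrow> real \<Rightarrow> real \<Rightarrow>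
      (nat \<Rightarrow> (real^'d) \<times> real) \<Rightarrow> bool" where
  "small_deviations m T f0 a b D \<longleftrightarrow>
    (\<forall>h\<in>T. Z.expectation (excess_loss (truncate h))
      \<le> 2 * sample_mean m D (excess_loss (truncate h)) + a) \<and>
    sample_mean m D (excess_loss f0) \<le> 3 / 2 * Z.expectation (excess_loss f0) + b \<and>
    labelled_sample m D"

lemma small_deviations_with_prob:
  fixes T :: "(real^'d \<Rightarrow> real) set" and \<delta> :: real
  assumes T: "finite T" "T \<noteq> {}" "\<And>h. h \<in> T \<Longrightarrow> truncate h \<in> borel_measurable borel"
    and f0: "f0 \<in> borel_measurable borel" "1 \<le> M" "\<And>x. \<bar>f0 x\<bar> \<le> M"
    and s: "0 < s" "s \<le> bernstein_rate 1" "s \<le> bernstein_rate M"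
    and m: "1 \<le> m" and \<delta>: "0 < \<delta>" "\<delta> < 1"
  shows "holds_with_prob (sample_space \<rho>X \<eta> m) (1 - \<delta>)
    (small_deviations m T f0 (2 * ln (2 * real (card T) / \<delta>) / (s * real m))
        (ln (2 / \<delta>) / (s * real m)))"
proof -
  interpret P: prob_space "PiM {..<m} (\<lambda>_. \<rho>)" by (intro prob_space_PiM Z.prob_space_axioms)
  show ?thesis
    unfolding sample_space_eq small_deviations_def conj_assoc[symmetric]
    using T s \<delta> m f0
    by (intro P.holds_with_prob_AE Z.uniform_bernstein AE_labelled_sample
        bernstein_cond_excess_loss[OF _ order_refl truncate_abs_le]
        bernstein_cond_excess_loss[OF f0]) auto
qed

lemma oracle_inequality_of_deviations:
  assumes g: "truncate g \<in> borel_measurable borel" and h: "truncate h \<in> borel_measurable borel"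
    and f0: "f0 \<in> borel_measurable borel" "1 \<le> M" "\<And>x. \<bar>f0 x\<bar> \<le> M"
    and erm: "erm_solution \<phi> K unit_cube lam m D g" "0 < lam" "1 \<le> m"
    and D: "small_deviations m T f0 a b D" "h \<in> T"
    and f0_ball: "f0 \<in> rkhs_ball K unit_cube B0"
    and f0_close: "\<And>x. x \<in> unit_cube \<Longrightarrow> \<bar>f0 x - f x\<bar> \<le> e0"
    and h_close: "\<And>x. x \<in> unit_cube \<Longrightarrow> \<bar>g x - h x\<bar> \<le> e"
  shows "2 * \<mu> * sq_dist (truncate g)
      \<le> 3 * L * e0\<^sup>2 + 2 * lam * B0\<^sup>2 + 3 * lip_const 1 * e + a + 2 * b"
proof -
  have sample: "labelled_sample m D"
    and f0_dev: "sample_mean m D (excess_loss f0) \<le> 3 / 2 * Z.expectation (excess_loss f0) + b"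
    and h_dev: "Z.expectation (excess_loss (truncate h))
        \<le> 2 * sample_mean m D (excess_loss (truncate h)) + a"
    using D by (auto simp: small_deviations_def)
  have close: "\<bar>truncate g x - truncate h x\<bar> \<le> e" if "x \<in> unit_cube" for x
    using truncate_diff_le[OF that] h_close[OF that] by (rule order_trans)
  have "2 * \<mu> * sq_dist (truncate g) \<le> Z.expectation (excess_loss (truncate g))"
    by (rule expectation_excess_loss_ge[OF g order_refl truncate_abs_le])
  also have "\<dots> \<le> Z.expectation (excess_loss (truncate h)) + lip_const 1 * e"
    by (rule expectation_excess_loss_net_le[OF g truncate_abs_le h truncate_abs_le close])
  also note h_dev
  also have "sample_mean m D (excess_loss (truncate h))
      \<le> sample_mean m D (excess_loss (truncate g)) + lip_const 1 * e"
    by (rule sample_mean_excess_loss_net_le[OF truncate_abs_le truncate_abs_le erm(3) sample close])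
  also have "sample_mean m D (excess_loss (truncate g))
      \<le> sample_mean m D (excess_loss f0) + lam * B0\<^sup>2"
    by (rule erm_truncate_sample_mean_le[OF erm(1,2) sample f0_ball])
  also note f0_dev
  also have "Z.expectation (excess_loss f0) \<le> L * e0\<^sup>2"
    using expectation_excess_loss_le[OF f0] sq_dist_le[OF f0 f0_close] L_pos
    by (meson mult_left_mono less_imp_le order_trans)
  finally show ?thesis by (simp add: algebra_simps)
qed

lemma oracle_inequality:
  fixes f0 :: "real^'d \<Rightarrow> real" and T :: "(real^'d \<Rightarrow> real) set"
  assumes \<sigma>: "0 < \<sigma>" and lam: "0 < lam" and m: "1 \<le> m" and \<delta>: "0 < \<delta>" "\<delta> < 1"
    and f0: "f0 \<in> borel_measurable borel" "1 \<le> M" "\<And>x. \<bar>f0 x\<bar> \<le> M"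
    and f0_ball: "f0 \<in> rkhs_ball (gauss_kernel \<sigma>) unit_cube B0"
    and f0_close: "\<And>x. x \<in> unit_cube \<Longrightarrow> \<bar>f0 x - f x\<bar> \<le> e0"
    and net: "uniform_net unit_cube e (rkhs_ball (gauss_kernel \<sigma>) unit_cube (sqrt (\<phi> 0 / lam))) T"
  defines "s \<equiv> min (bernstein_rate 1) (bernstein_rate M)"
  shows "holds_with_prob (sample_space \<rho>X \<eta> m) (1 - \<delta>) (\<lambda>D. \<forall>g.
    erm_solution \<phi> (gauss_kernel \<sigma>) unit_cube lam m D g \<longrightarrow>
    2 * \<mu> * sq_dist (truncate g) \<le> (3 * L * e0\<^sup>2 + 2 * lam * B0\<^sup>2 + 3 * lip_const 1 * e
      + (2 * ln (real (card T)) + 4) / (s * real m)) * ln (4 / \<delta>))"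
proof -
  let ?H = "rkhs_ball (gauss_kernel \<sigma>) (unit_cube :: (real^'d) set) (sqrt (\<phi> 0 / lam))"
  let ?a = "2 * ln (2 * real (card T) / \<delta>) / (s * real m)" and ?b = "ln (2 / \<delta>) / (s * real m)"
  let ?A = "3 * L * e0\<^sup>2 + 2 * lam * B0\<^sup>2 + 3 * lip_const 1 * e"
  have s: "0 < s" "s \<le> bernstein_rate 1" "s \<le> bernstein_rate M"
    using bernstein_rate_pos f0(2) by (auto simp: s_def)
  have meas: "truncate h \<in> borel_measurable borel" if "h \<in> ?H" for h
    using gauss_rkhs_ball_truncate_measurable[OF \<sigma> that] .
  have T: "finite T" "T \<subseteq> ?H" and net_close: "\<And>g. g \<in> ?H \<Longrightarrow> \<exists>h\<in>T. \<forall>x\<in>unit_cube. \<bar>g x - h x\<bar> \<le> e"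
    using net by (auto simp: uniform_net_def)
  have card: "1 \<le> real (card T)"
    using uniform_net_card_ge_1[OF net zero_in_rkhs_ball] by simp
  have "(0 :: real^'d) \<in> unit_cube" by (simp add: unit_cube_def)
  then have e: "0 \<le> e" using net_close[OF zero_in_rkhs_ball] by (meson abs_ge_zero order_trans)
  have A: "0 \<le> ?A" using L_pos lam lip_const_pos[of 1] e by simp
  have "holds_with_prob (sample_space \<rho>X \<eta> m) (1 - \<delta>) (small_deviations m T f0 ?a ?b)"
    using T card by (intro small_deviations_with_prob[OF T(1) _ meas f0 s m \<delta>]) auto
  then show ?thesis
  proof (rule holds_with_prob_mono[OF _ order_refl], intro allI impI)
    fix D g assume D: "small_deviations m T f0 ?a ?b D"
      and erm: "erm_solution \<phi> (gauss_kernel \<sigma>) unit_cube lam m D g"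
    have g: "g \<in> ?H" by (rule erm_in_rkhs_ball[OF erm lam m])
    then obtain h where h: "h \<in> T" "\<And>x. x \<in> unit_cube \<Longrightarrow> \<bar>g x - h x\<bar> \<le> e" using net_close by blast
    have "2 * \<mu> * sq_dist (truncate g) \<le> ?A + ?a + 2 * ?b"
      using h(1) T(2)
      by (intro oracle_inequality_of_deviations[OF meas[OF g] meas f0 erm lam m D _
          f0_ball f0_close h(2)]) auto
    also have "?A + ?a + 2 * ?b
        = ?A * 1 + (2 * ln (2 * real (card T) / \<delta>) + 2 * ln (2 / \<delta>)) / (s * real m)"
      by (simp add: add_divide_distrib)
    also have "\<dots> \<le> ?A * ln (4 / \<delta>) + (2 * ln (real (card T)) + 4) * ln (4 / \<delta>) / (s * real m)"
      using A s by (intro add_mono mult_left_mono divide_right_mono one_le_ln_4_div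
          confidence_terms_le \<delta> card) auto
    finally show "2 * \<mu> * sq_dist (truncate g)
        \<le> (?A + (2 * ln (real (card T)) + 4) / (s * real m)) * ln (4 / \<delta>)"
      by (simp add: distrib_right)
  qed
qed

end

section \<open>The choice of bandwidth\<close>

locale bandwidth_schedule =
  fixes x r \<kappa> \<nu> :: real and d K :: nat
  assumes x_ge_1: "1 \<le> x" and r_pos: "0 < r" and \<kappa>_pos: "0 < \<kappa>"
    and \<kappa>_small: "\<kappa> * (2 * r + real d + 1) \<le> \<nu>" and K_large: "2 \<le> \<kappa> * real K"
begin

definition \<sigma> :: real where "\<sigma> = x powr (- 1 / (2 * r + real d))"

definition R :: real where "R = x powr \<kappa>"

definition n :: nat where "n = nat \<lceil>R / \<sigma>\<rceil>"

definition rate :: real where "rate = x powr (- (2 * r / (2 * r + real d)) + \<nu>)"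

lemma x_pos: "0 < x"
  using x_ge_1 by simp

lemma K_ge_1: "1 \<le> K"
  using K_large \<kappa>_pos by (cases K) auto

lemma denominator_pos: "0 < 2 * r + real d"
  using r_pos by (simp add: add_pos_nonneg)

lemma \<kappa>_le: "\<kappa> * (2 * r) \<le> \<nu>" "\<kappa> * (real d + 1) \<le> \<nu>" "0 \<le> \<nu>"
proof -
  have "0 \<le> \<kappa> * (2 * r)" "0 \<le> \<kappa> * (real d + 1)" using \<kappa>_pos r_pos by auto
  then show "\<kappa> * (2 * r) \<le> \<nu>" "\<kappa> * (real d + 1) \<le> \<nu>" "0 \<le> \<nu>"
    using \<kappa>_small by (auto simp: distrib_left)
qed

lemma \<sigma>_pos: "0 < \<sigma>"
  using x_pos by (simp add: \<sigma>_def)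

lemma \<sigma>_le_1: "\<sigma> \<le> 1"
  using powr_mono[of "- 1 / (2 * r + real d)" 0 x] denominator_pos x_ge_1 by (simp add: \<sigma>_def)

lemma R_ge_1: "1 \<le> R"
  using x_ge_1 \<kappa>_pos by (simp add: R_def ge_one_powr_ge_zero)

lemma powr_le_rate: "a \<le> - (2 * r / (2 * r + real d)) + \<nu> \<Longrightarrow> x powr a \<le> rate"
  unfolding rate_def by (rule powr_mono[OF _ x_ge_1])

lemma inverse_le_rate: "1 / x \<le> rate"
proof -
  have "2 * r / (2 * r + real d) \<le> 1" using denominator_pos by (simp add: divide_le_eq)
  then have "- 1 \<le> - (2 * r / (2 * r + real d)) + \<nu>" using \<kappa>_le(3) by linarith
  from powr_le_rate[OF this] show ?thesis using x_pos by (simp add: powr_minus_divide)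
qed

lemma inverse_volume_eq: "1 / \<sigma> ^ d / x = x powr (- (2 * r / (2 * r + real d)))"
proof -
  have "\<sigma> ^ d = x powr (- (real d / (2 * r + real d)))"
    using x_pos by (simp add: \<sigma>_def powr_realpow[symmetric] powr_powr)
  then have "1 / \<sigma> ^ d / x = x powr (real d / (2 * r + real d) - 1)"
    using x_pos by (simp add: powr_minus powr_diff inverse_eq_divide)
  also have "real d / (2 * r + real d) - 1 = - (2 * r / (2 * r + real d))"
    using denominator_pos by (simp add: field_simps)
  finally show ?thesis .
qed

lemma inverse_volume_le_rate: "1 / \<sigma> ^ d / x \<le> rate"
  unfolding inverse_volume_eq by (rule powr_le_rate) (use \<kappa>_le in simp)

lemma smoothing_bias_sq_le_rate: "((R * \<sigma>) powr r)\<^sup>2 \<le> rate"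
proof -
  have "R * \<sigma> = x powr (\<kappa> - 1 / (2 * r + real d))"
    by (simp add: R_def \<sigma>_def flip: powr_add)
  then have "((R * \<sigma>) powr r)\<^sup>2 = x powr (\<kappa> * (2 * r) - 2 * r / (2 * r + real d))"
    unfolding power2_eq_square by (simp add: powr_powr algebra_simps flip: powr_add)
  also have "\<dots> \<le> rate" by (rule powr_le_rate) (use \<kappa>_le in simp)
  finally show ?thesis .
qed

lemma gaussian_tail_le_rate: "exp (- R\<^sup>2) \<le> real K ^ K * rate"
proof -
  have "x powr 1 \<le> x powr (\<kappa> * real K * 2)" by (rule powr_mono) (use K_large x_ge_1 in auto)
  also have "\<dots> = (R\<^sup>2) ^ K"
    using x_pos by (simp add: R_def powr_powr power_mult[symmetric] powr_realpow[symmetric] mult_ac)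
  finally have "x / real K ^ K \<le> (R\<^sup>2 / real K) ^ K"
    using x_pos by (simp add: power_divide divide_right_mono)
  also have "\<dots> \<le> exp (R\<^sup>2 / real K) ^ K"
  proof (rule power_mono)
    show "R\<^sup>2 / real K \<le> exp (R\<^sup>2 / real K)"
      using exp_ge_add_one_self[of "R\<^sup>2 / real K"] by linarith
  qed (use K_ge_1 in simp)
  also have "\<dots> = exp (R\<^sup>2)" using K_ge_1 by (simp flip: exp_of_nat_mult)
  finally have "exp (- R\<^sup>2) \<le> real K ^ K * (1 / x)"
    using x_pos K_ge_1 by (simp add: exp_minus field_simps)
  also have "\<dots> \<le> real K ^ K * rate" using inverse_le_rate by (intro mult_left_mono) auto
  finally show ?thesis .
qed

lemma approximation_error_sq_le_rate:
  "((R * \<sigma>) powr r + exp (- R\<^sup>2))\<^sup>2 \<le> 2 * (1 + real K ^ K) * rate"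
proof -
  let ?p = "(R * \<sigma>) powr r" and ?q = "exp (- R\<^sup>2)"
  have "(?p + ?q)\<^sup>2 \<le> 2 * ?p\<^sup>2 + 2 * ?q\<^sup>2"
    using zero_le_power2[of "?p - ?q"] by (simp add: power2_sum power2_diff)
  also have "?q\<^sup>2 \<le> ?q" by (simp add: power2_eq_square mult_le_cancel_left1)
  finally show ?thesis
    using smoothing_bias_sq_le_rate gaussian_tail_le_rate by (simp add: algebra_simps)
qed

lemma R_div_\<sigma>_ge_1: "1 \<le> R / \<sigma>"
  using R_ge_1 \<sigma>_pos \<sigma>_le_1 by (simp add: le_divide_eq)

lemma R_le_n: "R \<le> real n * \<sigma>"
  using real_nat_ceiling_ge[of "R / \<sigma>"] \<sigma>_pos by (simp add: n_def field_simps)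

lemma n_ge_1: "1 \<le> n"
  using real_nat_ceiling_ge[of "R / \<sigma>"] R_div_\<sigma>_ge_1 unfolding n_def by linarith

lemma n_le: "real n \<le> 2 * (R / \<sigma>)"
proof -
  have "real n \<le> R / \<sigma> + 1" unfolding n_def using R_div_\<sigma>_ge_1 by (simp add: of_nat_nat)
  then show ?thesis using R_div_\<sigma>_ge_1 by simp
qed

lemma interpolation_error_le: "(1 / (real n * \<sigma>)) ^ K \<le> 1 / x\<^sup>2"
proof -
  have "(1 / (real n * \<sigma>)) ^ K \<le> (1 / R) ^ K"
    using R_ge_1 R_le_n by (intro power_mono divide_left_mono) auto
  also have "\<dots> = 1 / x powr (\<kappa> * real K)"
    using x_pos by (simp add: R_def power_divide powr_powr powr_realpow[symmetric])
  also have "\<dots> \<le> 1 / x powr 2"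
    using powr_mono[OF K_large x_ge_1] x_pos by (intro divide_left_mono) auto
  finally show ?thesis using x_pos by simp
qed

lemma node_count_le_rate: "real n ^ d * R / x \<le> 2 ^ d * rate"
proof -
  have "real n ^ d * R / x \<le> (2 * (R / \<sigma>)) ^ d * R / x"
    using n_le R_ge_1 x_pos by (intro divide_right_mono mult_right_mono power_mono) auto
  also have "\<dots> = 2 ^ d * (R ^ d * R * (1 / \<sigma> ^ d / x))"
    by (simp add: power_mult_distrib power_divide)
  also have "R ^ d * R = x powr (\<kappa> * (real d + 1))"
    using x_pos by (simp add: R_def powr_realpow[symmetric] powr_powr powr_add[symmetric]
        distrib_left mult_ac add_ac)
  also have "\<dots> * (1 / \<sigma> ^ d / x) = x powr (\<kappa> * (real d + 1) - 2 * r / (2 * r + real d))"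
    unfolding inverse_volume_eq by (simp flip: powr_add)
  also have "2 ^ d * \<dots> \<le> 2 ^ d * rate" by (intro mult_left_mono powr_le_rate) (use \<kappa>_le in auto)
  finally show ?thesis .
qed

lemma sqrt_mult_le:
  assumes "0 \<le> F"
  shows "sqrt (F\<^sup>2 * x) \<le> F * x"
proof (rule real_le_lsqrt)
  have "x * 1 \<le> x * x" using x_ge_1 by (intro mult_left_mono) auto
  then show "F\<^sup>2 * x \<le> (F * x)\<^sup>2"
    unfolding power_mult_distrib by (intro mult_left_mono) (auto simp: power2_eq_square)
qed (use assms x_pos in simp)

lemma net_radius_le_rate:
  assumes F: "0 \<le> F" and \<Lambda>: "0 \<le> \<Lambda>"
  shows "\<Lambda> ^ d * (1 / x + real d * (4 * sqrt (F\<^sup>2 * x) * \<Lambda> * (1 / (real n * \<sigma>)) ^ K))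
    \<le> \<Lambda> ^ d * (1 + 4 * real d * F * \<Lambda>) * rate"
proof -
  have "4 * sqrt (F\<^sup>2 * x) * \<Lambda> * (1 / (real n * \<sigma>)) ^ K \<le> 4 * (F * x) * \<Lambda> * (1 / x\<^sup>2)"
    using sqrt_mult_le[OF F] F \<Lambda> x_pos \<sigma>_pos interpolation_error_le by (intro mult_mono) auto
  also have "\<dots> = 4 * F * \<Lambda> * (1 / x)" using x_pos by (simp add: power2_eq_square)
  finally have "\<Lambda> ^ d * (1 / x + real d * (4 * sqrt (F\<^sup>2 * x) * \<Lambda> * (1 / (real n * \<sigma>)) ^ K))
      \<le> \<Lambda> ^ d * (1 / x + real d * (4 * F * \<Lambda> * (1 / x)))"
    using \<Lambda> by (intro mult_left_mono[OF add_left_mono] mult_left_mono) auto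
  also have "\<dots> = \<Lambda> ^ d * (1 + 4 * real d * F * \<Lambda>) * (1 / x)"
    by (simp add: distrib_right distrib_left add_divide_distrib)
  also have "\<dots> \<le> \<Lambda> ^ d * (1 + 4 * real d * F * \<Lambda>) * rate"
    using F \<Lambda> inverse_le_rate by (intro mult_left_mono) auto
  finally show ?thesis .
qed

lemma ln_net_card_le_rate:
  assumes F: "0 \<le> F"
  shows "ln ((2 * sqrt (F\<^sup>2 * x) / (1 / x) + 3) ^ ((n * N) ^ d)) / x
    \<le> real N ^ d * (ln (2 * F + 3) + 2 / \<kappa>) * 2 ^ d * rate"
proof -
  let ?y = "2 * sqrt (F\<^sup>2 * x) / (1 / x) + 3" and ?c = "ln (2 * F + 3) + 2 / \<kappa>"
  have y: "0 < ?y" using x_pos by (simp add: add_nonneg_pos)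
  have ln_F: "0 \<le> ln (2 * F + 3)" using F by (intro ln_ge_zero) auto
  have "2 * sqrt (F\<^sup>2 * x) * x \<le> 2 * (F * x) * x"
    using sqrt_mult_le[OF F] x_pos by (intro mult_right_mono) auto
  moreover have "3 \<le> 3 * x\<^sup>2" using x_ge_1 by (simp add: one_le_power)
  ultimately have "?y \<le> (2 * F + 3) * x\<^sup>2" by (simp add: power2_eq_square algebra_simps)
  then have "ln ?y \<le> ln ((2 * F + 3) * x\<^sup>2)" using y by (intro ln_mono) auto
  also have "\<dots> = ln (2 * F + 3) * 1 + 2 * ln x" using F x_pos by (simp add: ln_mult ln_realpow)
  also have "\<dots> \<le> ln (2 * F + 3) * R + 2 * (R / \<kappa>)"
    using ln_powr_bound[OF x_ge_1 \<kappa>_pos] R_ge_1 ln_F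
    by (intro add_mono mult_left_mono) (auto simp: R_def)
  finally have ln_y: "ln ?y \<le> ?c * R" by (simp add: distrib_right)
  have "ln (?y ^ ((n * N) ^ d)) = real ((n * N) ^ d) * ln ?y" by (rule ln_realpow)
  also have "\<dots> \<le> real ((n * N) ^ d) * (?c * R)" by (intro mult_left_mono ln_y) auto
  finally have "ln (?y ^ ((n * N) ^ d)) / x \<le> real N ^ d * ?c * (real n ^ d * R / x)"
    using x_pos by (simp add: divide_right_mono power_mult_distrib mult_ac)
  also have "\<dots> \<le> real N ^ d * ?c * (2 ^ d * rate)"
    using node_count_le_rate ln_F \<kappa>_pos by (intro mult_left_mono) auto
  finally show ?thesis by (simp add: mult.assoc)
qed

end

context bandwidth_schedule
begin

lemma oracle_bound_le_rate:
  fixes C F L b s \<Lambda> k :: real and N :: nat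
  defines "B \<equiv> sqrt (F\<^sup>2 * x)"
  assumes nonneg: "0 \<le> F" "0 \<le> \<Lambda>" "0 \<le> L" "0 \<le> b" and s: "0 < s"
    and k: "1 \<le> k" "k \<le> (2 * B / (1 / x) + 3) ^ ((n * N) ^ d)"
  shows "3 * L * (C * ((R * \<sigma>) powr r + exp (- R\<^sup>2)))\<^sup>2 + 2 * (1 / x) * (C * sqrt (1 / \<sigma> ^ d))\<^sup>2
      + 3 * b * (\<Lambda> ^ d * (1 / x + real d * (4 * B * \<Lambda> * (1 / (real n * \<sigma>)) ^ K)))
      + (2 * ln k + 4) / (s * x)
    \<le> (3 * L * (C\<^sup>2 * (2 * (1 + real K ^ K))) + 2 * C\<^sup>2 + 3 * b * (\<Lambda> ^ d * (1 + 4 * real d * F * \<Lambda>))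
      + (2 * (real N ^ d * (ln (2 * F + 3) + 2 / \<kappa>) * 2 ^ d) + 4) / s) * rate"
proof -
  have "3 * L * (C * ((R * \<sigma>) powr r + exp (- R\<^sup>2)))\<^sup>2
      \<le> 3 * L * (C\<^sup>2 * (2 * (1 + real K ^ K) * rate))"
    unfolding power_mult_distrib
    using nonneg by (intro mult_left_mono approximation_error_sq_le_rate) auto
  moreover have "2 * (1 / x) * (C * sqrt (1 / \<sigma> ^ d))\<^sup>2 \<le> 2 * C\<^sup>2 * rate"
  proof -
    have "2 * (1 / x) * (C * sqrt (1 / \<sigma> ^ d))\<^sup>2 = 2 * C\<^sup>2 * (1 / \<sigma> ^ d / x)"
      using \<sigma>_pos by (simp add: power_mult_distrib)
    also have "\<dots> \<le> 2 * C\<^sup>2 * rate" by (intro mult_left_mono inverse_volume_le_rate) auto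
    finally show ?thesis .
  qed
  moreover have "3 * b * (\<Lambda> ^ d * (1 / x + real d * (4 * B * \<Lambda> * (1 / (real n * \<sigma>)) ^ K)))
      \<le> 3 * b * (\<Lambda> ^ d * (1 + 4 * real d * F * \<Lambda>) * rate)"
    unfolding B_def using nonneg by (intro mult_left_mono net_radius_le_rate) auto
  moreover have "(2 * ln k + 4) / (s * x)
      \<le> (2 * (real N ^ d * (ln (2 * F + 3) + 2 / \<kappa>) * 2 ^ d) + 4) / s * rate"
  proof -
    have "ln k / x \<le> ln ((2 * B / (1 / x) + 3) ^ ((n * N) ^ d)) / x"
      using k x_pos by (intro divide_right_mono ln_mono) auto
    also note ln_net_card_le_rate[OF nonneg(1), of N, folded B_def]
    finally have "(2 * (ln k / x) + 4 * (1 / x)) / s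
        \<le> (2 * (real N ^ d * (ln (2 * F + 3) + 2 / \<kappa>) * 2 ^ d * rate) + 4 * rate) / s"
      using s inverse_le_rate by (intro divide_right_mono add_mono mult_left_mono) auto
    moreover have "(2 * ln k + 4) / (s * x) = (2 * (ln k / x) + 4 * (1 / x)) / s"
      using x_pos by (simp add: add_divide_distrib mult.commute)
    ultimately show ?thesis by (simp add: distrib_right mult.assoc)
  qed
  ultimately show ?thesis by (simp add: distrib_right mult.assoc)
qed

end

section \<open>The learning rate\<close>

lemma powr_rate_le:
  fixes x l a \<nu> \<theta> C :: real
  assumes x: "1 \<le> x" and l: "1 \<le> l" and \<theta>: "0 \<le> \<theta>" "\<theta> \<le> 1" and \<nu>: "0 \<le> \<nu>" and C: "0 \<le> C"
  shows "(C * x powr (- a + \<nu>) * l) powr \<theta> \<le> C powr \<theta> * x powr (- (a * \<theta>) + \<nu>) * l"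
proof -
  have "(C * x powr (- a + \<nu>) * l) powr \<theta> = C powr \<theta> * x powr ((- a + \<nu>) * \<theta>) * l powr \<theta>"
    using x l C by (simp add: powr_mult powr_powr)
  also have "\<dots> \<le> C powr \<theta> * x powr (- (a * \<theta>) + \<nu>) * l powr 1"
  proof (intro mult_mono order_refl powr_mono)
    show "(- a + \<nu>) * \<theta> \<le> - (a * \<theta>) + \<nu>"
      using mult_left_le[OF \<theta>(2) \<nu>] by (simp add: left_diff_distrib)
  qed (use x l \<theta> in auto)
  finally show ?thesis using l by simp
qed

context learning_problem
begin

definition rate_const :: "real \<Rightarrow> real \<Rightarrow> nat \<Rightarrow> real" where
  "rate_const M \<kappa> K = 3 * L * (M\<^sup>2 * (2 * (1 + real K ^ K))) + 2 * M\<^sup>2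
    + 3 * lip_const 1 * ((1 + real (2 * K) ^ (2 * K)) ^ CARD('d)
      * (1 + 4 * real CARD('d) * sqrt (\<phi> 0) * (1 + real (2 * K) ^ (2 * K))))
    + (2 * (real (2 * K) ^ CARD('d) * (ln (2 * sqrt (\<phi> 0) + 3) + 2 / \<kappa>) * 2 ^ CARD('d)) + 4)
      / min (bernstein_rate 1) (bernstein_rate M)"

lemma rate_const_pos: "1 \<le> M \<Longrightarrow> 0 < \<kappa> \<Longrightarrow> 0 < rate_const M \<kappa> K"
  unfolding rate_const_def
  using L_pos loss_nonneg[of 0] bernstein_rate_pos lip_const_pos[of 1]
  by (intro add_nonneg_pos divide_pos_pos) auto

lemma erm_sq_dist_schedule:
  fixes f0 :: "real^'d \<Rightarrow> real"
  assumes schedule: "bandwidth_schedule (real m) r \<kappa> \<nu> CARD('d) K"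
  defines "\<sigma> \<equiv> bandwidth_schedule.\<sigma> (real m) r CARD('d)" and "R \<equiv> bandwidth_schedule.R (real m) \<kappa>"
  assumes f0: "f0 \<in> borel_measurable borel" "1 \<le> M" "\<And>x. \<bar>f0 x\<bar> \<le> M"
    and f0_close: "\<And>x. x \<in> unit_cube \<Longrightarrow> \<bar>f0 x - f x\<bar> \<le> M * ((R * \<sigma>) powr r + exp (- R\<^sup>2))"
    and f0_ball: "f0 \<in> rkhs_ball (gauss_kernel \<sigma>) unit_cube (M * sqrt (1 / \<sigma> ^ CARD('d)))"
    and m: "1 \<le> m" and \<delta>: "0 < \<delta>" "\<delta> < 1"
  shows "holds_with_prob (sample_space \<rho>X \<eta> m) (1 - \<delta>) (\<lambda>D. \<forall>g.
    erm_solution \<phi> (gauss_kernel \<sigma>) unit_cube (1 / real m) m D g \<longrightarrow>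
    2 * \<mu> * sq_dist (truncate g)
      \<le> rate_const M \<kappa> K * bandwidth_schedule.rate (real m) r \<nu> CARD('d) * ln (4 / \<delta>))"
proof -
  interpret S: bandwidth_schedule "real m" r \<kappa> \<nu> "CARD('d)" K by (rule schedule)
  let ?B = "sqrt ((sqrt (\<phi> 0))\<^sup>2 * real m)" and ?d = "CARD('d)" and ?N = "2 * K"
  let ?\<Lambda> = "1 + real ?N ^ ?N" and ?s = "min (bernstein_rate 1) (bernstein_rate M)"
  let ?e = "?\<Lambda> ^ ?d * (1 / real m + real ?d * (4 * ?B * ?\<Lambda> * (1 / (real S.n * \<sigma>)) ^ K))"
  have B: "sqrt (\<phi> 0 / (1 / real m)) = ?B" using loss_nonneg[of 0] by simp
  have \<sigma>: "0 < \<sigma>" "1 \<le> real S.n * \<sigma>"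
    using S.\<sigma>_pos S.R_ge_1 S.R_le_n by (auto simp: \<sigma>_def)
  have radius: "0 \<le> ?B" "0 < 1 / real m" using loss_nonneg[of 0] m by auto
  obtain T :: "(real^'d \<Rightarrow> real) set"
    where net: "uniform_net unit_cube ?e (rkhs_ball (gauss_kernel \<sigma>) unit_cube ?B) T"
      and card: "real (card T) \<le> (2 * ?B / (1 / real m) + 3) ^ ((S.n * ?N) ^ ?d)"
    by (rule gauss_rkhs_ball_covering[OF radius(1) S.n_ge_1 S.K_ge_1 refl \<sigma> radius(2)]) blast
  have card_ge_1: "1 \<le> real (card T)"
    using uniform_net_card_ge_1[OF net zero_in_rkhs_ball] by simp
  let ?bound = "3 * L * (M * ((R * \<sigma>) powr r + exp (- R\<^sup>2)))\<^sup>2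
      + 2 * (1 / real m) * (M * sqrt (1 / \<sigma> ^ ?d))\<^sup>2 + 3 * lip_const 1 * ?e
      + (2 * ln (real (card T)) + 4) / (?s * real m)"
  have "?bound \<le> rate_const M \<kappa> K * S.rate"
    unfolding rate_const_def R_def \<sigma>_def
    using L_pos loss_nonneg[of 0] lip_const_pos[of 1] bernstein_rate_pos f0(2) card_ge_1 card
    by (intro S.oracle_bound_le_rate) auto
  then have bound: "?bound * ln (4 / \<delta>) \<le> rate_const M \<kappa> K * S.rate * ln (4 / \<delta>)"
    using one_le_ln_4_div[OF \<delta>] by (intro mult_right_mono) auto
  have "holds_with_prob (sample_space \<rho>X \<eta> m) (1 - \<delta>) (\<lambda>D. \<forall>g.
      erm_solution \<phi> (gauss_kernel \<sigma>) unit_cube (1 / real m) m D g \<longrightarrow>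
      2 * \<mu> * sq_dist (truncate g) \<le> ?bound * ln (4 / \<delta>))"
    by (rule oracle_inequality[OF \<sigma>(1) radius(2) m \<delta> f0 f0_ball f0_close, unfolded B, OF _ net])
  then show ?thesis
    by (rule holds_with_prob_mono[OF _ order_refl]) (use bound order_trans in blast)
qed

abbreviation svm_solution :: "real \<Rightarrow> nat \<Rightarrow> (nat \<Rightarrow> (real^'d) \<times> real) \<Rightarrow> (real^'d \<Rightarrow> real) \<Rightarrow> bool" where
  "svm_solution r m D g \<equiv>
     erm_solution \<phi> (gauss_kernel (real m powr (- 1 / (2 * r + CARD('d)))))
       unit_cube (1 / real m) m D g"

lemma svm_sq_dist_rate:
  assumes f: "hoelder_smooth u v c0 unit_cube f" "0 < v" "0 \<le> c0" and r: "r = real u + v"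
    and \<nu>: "0 < \<nu>"
  obtains C where "0 < C"
    and "\<And>m \<delta>. 1 \<le> m \<Longrightarrow> 0 < \<delta> \<Longrightarrow> \<delta> < 1 \<Longrightarrow>
      holds_with_prob (sample_space \<rho>X \<eta> m) (1 - \<delta>) (\<lambda>D. \<forall>g.
        svm_solution r m D g \<longrightarrow>
        sq_dist (truncate g) \<le> C * real m powr (- (2 * r / (2 * r + CARD('d))) + \<nu>) * ln (4 / \<delta>))"
proof -
  have r_pos: "0 < r" using r f(2) by simp
  define \<kappa> where "\<kappa> = \<nu> / (2 * r + real CARD('d) + 1)"
  have \<kappa>: "0 < \<kappa>" "\<kappa> * (2 * r + real CARD('d) + 1) = \<nu>"
    using \<nu> r_pos by (auto simp: \<kappa>_def add_pos_pos less_imp_neq[symmetric])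
  define K where "K = nat \<lceil>2 / \<kappa>\<rceil>"
  have K: "2 \<le> \<kappa> * real K"
    using real_nat_ceiling_ge[of "2 / \<kappa>"] \<kappa>(1) unfolding K_def
    by (simp only: pos_divide_le_eq mult.commute)
  obtain M where M: "1 \<le> M"
    and approximation: "\<And>\<sigma> R. 0 < \<sigma> \<Longrightarrow> 0 < R \<Longrightarrow> \<exists>f0 \<in> borel_measurable borel.
      (\<forall>x. \<bar>f0 x\<bar> \<le> M) \<and>
      (\<forall>x\<in>unit_cube. \<bar>f0 x - f x\<bar> \<le> M * ((R * \<sigma>) powr r + exp (- R\<^sup>2))) \<and>
      f0 \<in> rkhs_ball (gauss_kernel \<sigma>) unit_cube (M * sqrt (1 / \<sigma> ^ CARD('d)))"
    by (rule gauss_rkhs_approximation[OF f f_measurable f_abs_le, folded r]) blast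
  show ?thesis
  proof (rule that[of "rate_const M \<kappa> K / (2 * \<mu>)"])
    show "0 < rate_const M \<kappa> K / (2 * \<mu>)" using rate_const_pos[OF M \<kappa>(1)] \<mu>_pos by simp
    fix m :: nat and \<delta> :: real
    assume m: "1 \<le> m" and \<delta>: "0 < \<delta>" "\<delta> < 1"
    interpret S: bandwidth_schedule "real m" r \<kappa> \<nu> "CARD('d)" K
      by unfold_locales (use m r_pos \<kappa> K in auto)
    obtain f0 where f0: "f0 \<in> borel_measurable borel" "\<And>x. \<bar>f0 x\<bar> \<le> M"
      "\<And>x. x \<in> unit_cube \<Longrightarrow> \<bar>f0 x - f x\<bar> \<le> M * ((S.R * S.\<sigma>) powr r + exp (- S.R\<^sup>2))"
      "f0 \<in> rkhs_ball (gauss_kernel S.\<sigma>) unit_cube (M * sqrt (1 / S.\<sigma> ^ CARD('d)))"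
      using approximation[of S.\<sigma> S.R] S.\<sigma>_pos S.R_ge_1 by auto
    have "holds_with_prob (sample_space \<rho>X \<eta> m) (1 - \<delta>) (\<lambda>D. \<forall>g.
        erm_solution \<phi> (gauss_kernel S.\<sigma>) unit_cube (1 / real m) m D g \<longrightarrow>
        2 * \<mu> * sq_dist (truncate g) \<le> rate_const M \<kappa> K * S.rate * ln (4 / \<delta>))"
      by (rule erm_sq_dist_schedule[OF S.bandwidth_schedule_axioms f0(1) M f0(2-4) m \<delta>])
    then show "holds_with_prob (sample_space \<rho>X \<eta> m) (1 - \<delta>) (\<lambda>D. \<forall>g.
        svm_solution r m D g \<longrightarrow>
        sq_dist (truncate g)
          \<le> rate_const M \<kappa> K / (2 * \<mu>) * real m powr (- (2 * r / (2 * r + CARD('d))) + \<nu>)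
            * ln (4 / \<delta>))"
      using \<mu>_pos unfolding S.\<sigma>_def S.rate_def
      by (elim holds_with_prob_mono[OF _ order_refl]) (simp add: field_simps)
  qed
qed

lemma svm_excess_risk_le_truncate:
  assumes svm: "svm_solution r m D g" and m: "1 \<le> m"
  shows "truncate g \<in> borel_measurable borel" "excess_risk g \<le> excess_risk (truncate g)"
proof -
  have "g \<in> rkhs_ball (gauss_kernel (real m powr (- 1 / (2 * r + CARD('d))))) unit_cube
      (sqrt (\<phi> 0 / (1 / real m)))"
    using m by (intro erm_in_rkhs_ball[OF svm]) auto
  then show meas: "truncate g \<in> borel_measurable borel"
    using m by (intro gauss_rkhs_ball_truncate_measurable) auto
  have "risk \<rho> (sign_fun g) \<le> risk \<rho> (sign_fun (truncate g))"
    by (rule risk_sign_fun_le[OF meas]) (simp add: truncate_cube clip_nonneg_iff)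
  then show "excess_risk g \<le> excess_risk (truncate g)" by simp
qed

lemma excess_risk_le_rate:
  assumes noise: "0 \<le> q" "tsybakov \<rho>X \<eta> q" and C: "0 < C" and \<nu>: "0 \<le> \<nu>"
  obtains K where "\<And>g x l a. g \<in> borel_measurable borel \<Longrightarrow> (\<And>x. \<bar>g x\<bar> \<le> 1) \<Longrightarrow> 1 \<le> x \<Longrightarrow> 1 \<le> l \<Longrightarrow>
    sq_dist g \<le> C * x powr (- a + \<nu>) * l \<Longrightarrow>
    excess_risk g \<le> K * x powr (- (a * ((q + 1) / (q + 2))) + \<nu>) * l"
proof -
  let ?\<theta> = "(q + 1) / (q + 2)"
  obtain K where K: "0 < K" and risk_le:
    "\<And>g A. g \<in> borel_measurable borel \<Longrightarrow> (\<And>x. \<bar>g x\<bar> \<le> 1) \<Longrightarrow> 0 < A \<Longrightarrow> sq_dist g \<le> A \<Longrightarrow>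
      excess_risk g \<le> K * A powr ?\<theta>"
    by (rule excess_risk_le_sq_dist_powr[OF noise]) blast
  show ?thesis
  proof (rule that[of "K * C powr ?\<theta>"])
    fix g :: "real^'d \<Rightarrow> real" and x l a :: real
    assume g: "g \<in> borel_measurable borel" "\<And>x. \<bar>g x\<bar> \<le> 1" and x: "1 \<le> x" and l: "1 \<le> l"
      and sq_dist: "sq_dist g \<le> C * x powr (- a + \<nu>) * l"
    have "excess_risk g \<le> K * (C * x powr (- a + \<nu>) * l) powr ?\<theta>"
      using C x l by (intro risk_le[OF g _ sq_dist] mult_pos_pos) auto
    also have "\<dots> \<le> K * (C powr ?\<theta> * x powr (- (a * ?\<theta>) + \<nu>) * l)"
      using K C x l \<nu> noise(1) by (intro mult_left_mono powr_rate_le) auto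
    finally show "excess_risk g \<le> K * C powr ?\<theta> * x powr (- (a * ?\<theta>) + \<nu>) * l"
      by (simp add: mult.assoc)
  qed
qed

lemma svm_excess_risk_rate:
  assumes f: "hoelder_smooth u v c0 unit_cube f" "0 < v" "0 \<le> c0" and r: "r = real u + v"
    and noise: "0 \<le> q" "tsybakov \<rho>X \<eta> q" and \<nu>: "0 < \<nu>"
  shows "\<exists>C. \<forall>m \<delta>. 1 \<le> m \<and> 0 < \<delta> \<and> \<delta> < 1 \<longrightarrow>
    holds_with_prob (sample_space \<rho>X \<eta> m) (1 - \<delta>) (\<lambda>D. \<forall>g. svm_solution r m D g \<longrightarrow>
      excess_risk g \<le> C * real m powr (- (2 * r * (q + 1) / ((2 * r + CARD('d)) * (q + 2))) + \<nu>)
        * ln (4 / \<delta>))"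
proof -
  let ?a = "2 * r / (2 * r + CARD('d))"
  obtain C where C: "0 < C" and sq_dist_rate: "\<And>m \<delta>. 1 \<le> m \<Longrightarrow> 0 < \<delta> \<Longrightarrow> \<delta> < 1 \<Longrightarrow>
      holds_with_prob (sample_space \<rho>X \<eta> m) (1 - \<delta>) (\<lambda>D. \<forall>g. svm_solution r m D g \<longrightarrow>
        sq_dist (truncate g) \<le> C * real m powr (- ?a + \<nu>) * ln (4 / \<delta>))"
    by (rule svm_sq_dist_rate[OF f r \<nu>]) blast
  obtain K where K: "\<And>g x l a. g \<in> borel_measurable borel \<Longrightarrow> (\<And>x. \<bar>g x\<bar> \<le> 1) \<Longrightarrow> 1 \<le> x \<Longrightarrow> 1 \<le> l \<Longrightarrow>
      sq_dist g \<le> C * x powr (- a + \<nu>) * l \<Longrightarrow>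
      excess_risk g \<le> K * x powr (- (a * ((q + 1) / (q + 2))) + \<nu>) * l"
    by (rule excess_risk_le_rate[OF noise C less_imp_le[OF \<nu>]]) blast
  have "excess_risk g \<le> K * real m powr (- (?a * ((q + 1) / (q + 2))) + \<nu>) * ln (4 / \<delta>)"
    if m: "1 \<le> m" and \<delta>: "0 < \<delta>" "\<delta> < 1" and svm: "svm_solution r m D g"
      and "sq_dist (truncate g) \<le> C * real m powr (- ?a + \<nu>) * ln (4 / \<delta>)" for m \<delta> D g
    using that one_le_ln_4_div[OF \<delta>]
    by (intro order_trans[OF svm_excess_risk_le_truncate(2)[OF svm m]]
        K[OF svm_excess_risk_le_truncate(1)[OF svm m] truncate_abs_le]) auto
  moreover have "?a * ((q + 1) / (q + 2)) = 2 * r * (q + 1) / ((2 * r + CARD('d)) * (q + 2))"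
    by simp
  ultimately show ?thesis
    by (intro exI[of _ K] allI impI, elim conjE)
      (rule holds_with_prob_mono[OF sq_dist_rate order_refl], simp_all)
qed

end

theorem theorem2:
  fixes \<phi> :: "real \<Rightarrow> real"
    and \<rho>X :: "(real^'d) measure"
    and \<eta> :: "real^'d \<Rightarrow> real"
    and f\<rho> :: "real^'d \<Rightarrow> real"
    and r c0 q :: real
  assumes loss: "twice_smooth_classifying_loss \<phi>"
    and marg: "prob_space \<rho>X" "sets \<rho>X = sets borel" "measure \<rho>X unit_cube = 1"
    and eta: "\<eta> \<in> borel_measurable borel" "\<forall>x\<in>unit_cube. 0 \<le> \<eta> x \<and> \<eta> x \<le> 1"
    and target: "\<forall>x\<in>unit_cube. phi_minimizer \<phi> (\<eta> x) (f\<rho> x)"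
    and smooth: "r > 0" "c0 > 0" "hoelder_class r c0 unit_cube f\<rho>"
    and noise: "q \<ge> 0" "tsybakov \<rho>X \<eta> q"
  shows "\<forall>\<nu>. 0 < \<nu> \<and> \<nu> < 2 * r * (q + 1) / ((2 * r + CARD('d)) * (q + 2)) \<longrightarrow>
    (\<exists>C. \<forall>(m::nat) \<delta>. m \<ge> 1 \<and> 0 < \<delta> \<and> \<delta> < 1 \<longrightarrow>
       (\<exists>E \<in> sets (sample_space \<rho>X \<eta> m).
          measure (sample_space \<rho>X \<eta> m) E \<ge> 1 - \<delta> \<and>
          (\<forall>D\<in>E. \<forall>f. erm_solution \<phi> (gauss_kernel (real m powr (- 1 / (2 * r + CARD('d)))))
                         unit_cube (1 / real m) m D f \<longrightarrow>
             risk (rho_meas \<rho>X \<eta>) (sign_fun f) - risk (rho_meas \<rho>X \<eta>) (bayes_rule \<eta>)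
               \<le> C * real m powr (- (2 * r * (q + 1) / ((2 * r + CARD('d)) * (q + 2))) + \<nu>)
                   * ln (4 / \<delta>))))"
proof -
  obtain L \<mu> where "smooth_loss \<phi> (deriv \<phi>) L \<mu>"
    using loss by (rule twice_smooth_imp_smooth_loss)
  then interpret smooth_loss \<phi> "deriv \<phi>" L \<mu> .
  let ?f = "\<lambda>x. indicat_real unit_cube x * f\<rho> x"
  obtain u v where r: "r = real u + v" "0 < v" and f_smooth: "hoelder_smooth u v c0 unit_cube ?f"
    and f_measurable: "?f \<in> borel_measurable borel"
    using smooth(3) by (rule hoelder_class_cube_extension)
  interpret learning_problem \<phi> "deriv \<phi>" L \<mu> \<rho>X \<eta> ?f
    by (intro learning_problem.intro classification.intro learning_problem_axioms.intro
        smooth_loss_axioms)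
      (use marg eta target f_measurable in simp_all)
  show ?thesis
    using svm_excess_risk_rate[OF f_smooth r(2) _ r(1) noise] smooth(2)
    unfolding holds_with_prob_def by simp
qed

end
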